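(* Suppose $d=d(n)$ satisfies $dn$ even, $d=O(\sqrt n)$ and $d\to\infty$. Let $Z_{C_3}$ be the number of triangles in ${\mathcal G}(n,d)$ and $\mu_{C_3}={\mathbb E}Z_{C_3}$. Then \[ \frac{Z_{C_3}-\mu_{C_3}}{\sqrt{\mu_{C_3}}}\xrightarrow{d}{\mathcal N}(0,1)\quad\text{as }n\to\infty. \]
   Context: ${\mathcal G}(n,d)$ is a uniformly random $d$-regular simple graph on vertex set $[n]$. *)

theory Defs
  imports "HOL-Probability.Probability" "HOL-Library.Landau_Symbols"
begin

definition simple_graph_on :: "nat \<Rightarrow> nat set set \<Rightarrow> bool" where
  "simple_graph_on n E \<longleftrightarrow> (\<forall>e\<in>E. e \<subseteq> {..<n} \<and> card e = 2)"

definition degree :: "nat set set \<Rightarrow> nat \<Rightarrow> nat" where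
  "degree E v = card {e\<in>E. v \<in> e}"

definition regular_graphs :: "nat \<Rightarrow> nat \<Rightarrow> nat set set set" where
  "regular_graphs n d = {E. simple_graph_on n E \<and> (\<forall>v<n. degree E v = d)}"

definition random_regular_graph :: "nat \<Rightarrow> nat \<Rightarrow> nat set set pmf" where
  "random_regular_graph n d = pmf_of_set (regular_graphs n d)"

definition triangle_count :: "nat \<Rightarrow> nat set set \<Rightarrow> nat" where
  "triangle_count n E = card {T. T \<subseteq> {..<n} \<and> card T = 3 \<and> (\<forall>e. e \<subseteq> T \<and> card e = 2 \<longrightarrow> e \<in> E)}"

definition triangle_mean :: "nat \<Rightarrow> nat \<Rightarrow> real" where
  "triangle_mean n d = measure_pmf.expectation (random_regular_graph n d) (\<lambda>E. real (triangle_count n E))"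

end

theory Submission
  imports Defs "HOL-Combinatorics.Multiset_Permutations"
begin

text \<open>Switching the path b-a-v-c-d of a d-regular graph (with ac and bd not edges) into the triangle
  avc and the edge bd is reversible, so that the expected product of the number of inverse switchings
  with any function f of the triangle count equals the expected sum of f over the graphs obtained by
  switching. For f = exp(i t x) this is an approximate Stein equation, i.e. an approximate differential
  equation \<open>\<phi>'(t) = -t \<phi>(t)\<close> for the characteristic function of the normalised count, and Levy's
  continuity theorem applies. Both sides are computed up to errors that are small in mean.
  The error terms count short cycles with pendant paths; the number of k-cycles is shown to be
  \<open>d^k + O(d^(k-1))\<close> in mean by the same switching, closing a path to a k-cycle, with f a truncated
  linear function.\<close>

section \<open>Pattern counts in regular graphs\<close>

text \<open>For d of order sqrt n two vertices have about d^2 / n common neighbours, which need not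
  be small. Hence a switching does not simply add one triangle, and patterns with as many edges as
  vertices can compete with the main term. The centring comes for free: for f = 1 the switching
  identity says that closed and open embeddings are equally many on average, so the constant in the
  drift is identified with the mean without computing that mean to high precision. The limit
  variance can be read off in advance: with X six times the triangle count, the drift is about n d
  (X - E X) and the summed gain about n d^4; the quotient n d^4 / (6 n d) = d^3 / 6 is also the
  leading term of the mean, so dividing by the square root of the mean gives variance one. The
  remaining normalised errors are of order d^(-1/2) or d^(-1), and this is where the degree must
  tend to infinity.\<close>

definition emb :: "nat \<Rightarrow> nat \<Rightarrow> (nat \<times> nat) set \<Rightarrow> (nat \<times> nat) set \<Rightarrow> nat set set \<Rightarrow> nat list set" where
  "emb n k P N E = {xs. length xs = k \<and> distinct xs \<and> set xs \<subseteq> {..<n} \<and>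
     (\<forall>(i, j)\<in>P. {xs ! i, xs ! j} \<in> E) \<and> (\<forall>(i, j)\<in>N. {xs ! i, xs ! j} \<notin> E)}"

text \<open>Copies are labelled: a subgraph is counted once for each ordering of its vertices that
  fits the pattern, so a triangle counts six times.\<close>

definition cnt :: "nat \<Rightarrow> nat \<Rightarrow> (nat \<times> nat) set \<Rightarrow> (nat \<times> nat) set \<Rightarrow> nat set set \<Rightarrow> real" where
  "cnt n k P N E = real (card (emb n k P N E))"

lemma finite_emb [simp]: "finite (emb n k P N E)"
proof (rule finite_subset)
  show "emb n k P N E \<subseteq> {xs. set xs \<subseteq> {..<n} \<and> length xs = k}"
    by (auto simp: emb_def)
qed (rule finite_lists_length_eq, simp)

lemma cnt_nonneg [simp]: "cnt n k P N E \<ge> 0"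
  by (simp add: cnt_def)

lemma cnt_mono:
  assumes "\<And>i j. (i, j) \<in> P \<Longrightarrow> (i, j) \<in> P' \<or> (j, i) \<in> P'"
    and "\<And>i j. (i, j) \<in> N \<Longrightarrow> (i, j) \<in> N' \<or> (j, i) \<in> N'"
  shows "cnt n k P' N' E \<le> cnt n k P N E"
proof -
  have "emb n k P' N' E \<subseteq> emb n k P N E"
  proof
    fix xs assume xs: "xs \<in> emb n k P' N' E"
    have "{xs ! i, xs ! j} \<in> E" if "(i, j) \<in> P" for i j
      using assms(1)[OF that] xs insert_commute[of "xs ! i" "xs ! j" "{}"] by (auto simp: emb_def)
    moreover have "{xs ! i, xs ! j} \<notin> E" if "(i, j) \<in> N" for i j
      using assms(2)[OF that] xs insert_commute[of "xs ! i" "xs ! j" "{}"] by (auto simp: emb_def)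
    ultimately show "xs \<in> emb n k P N E"
      using xs by (auto simp: emb_def)
  qed
  then show ?thesis
    by (simp add: cnt_def card_mono)
qed

lemma cnt_cong:
  assumes "\<And>i j. (i, j) \<in> P \<Longrightarrow> (i, j) \<in> P' \<or> (j, i) \<in> P'"
    and "\<And>i j. (i, j) \<in> P' \<Longrightarrow> (i, j) \<in> P \<or> (j, i) \<in> P"
  shows "cnt n k P N E = cnt n k P' N E"
proof (rule antisym)
  show "cnt n k P N E \<le> cnt n k P' N E"
    by (rule cnt_mono) (use assms(2) in simp_all)
  show "cnt n k P' N E \<le> cnt n k P N E"
    by (rule cnt_mono) (use assms(1) in simp_all)
qed

text \<open>Used to resolve forbidden pairs by inclusion-exclusion, so that only pure edge patterns
  have to be estimated.\<close>

lemma cnt_insert_nonedge: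
  "cnt n k P (insert ij N) E = cnt n k P N E - cnt n k (insert ij P) N E"
proof -
  have "emb n k P N E = emb n k P (insert ij N) E \<union> emb n k (insert ij P) N E"
    "emb n k P (insert ij N) E \<inter> emb n k (insert ij P) N E = {}"
    by (auto simp: emb_def)
  then show ?thesis
    by (simp add: cnt_def card_Un_disjoint)
qed

lemma cnt_loop:
  assumes "simple_graph_on n E" "(i, i) \<in> P"
  shows "cnt n k P N E = 0"
proof -
  have "{v, v} \<notin> E" for v
    using assms(1) by (auto simp: simple_graph_on_def)
  then have "emb n k P N E = {}"
    using assms(2) by (fastforce simp: emb_def)
  then show ?thesis by (simp add: cnt_def)
qed

text \<open>Renumbering brings a pattern into the form core first, pendant vertices last, which is
  what \<open>cnt_pendant\<close> can peel off.\<close>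

lemma cnt_relabel:
  assumes s: "distinct s" "set s = {..<k}"
    and P: "P \<subseteq> {..<k} \<times> {..<k}"
  shows "cnt n k P {} E = cnt n k ((\<lambda>(i, j). (s ! i, s ! j)) ` P) {} E"
proof -
  have len: "length s = k"
    using s distinct_card by fastforce
  have s_lt: "s ! i < k" if "i < k" for i
    using s len nth_mem that by fastforce
  obtain t where t: "\<And>i. i < k \<Longrightarrow> t i < k" "\<And>i. i < k \<Longrightarrow> s ! t i = i" "\<And>i. i < k \<Longrightarrow> t (s ! i) = i"
  proof -
    have bij: "bij_betw ((!) s) {..<k} {..<k}"
      by (rule bij_betw_nth) (simp_all add: s len)
    define t where "t = inv_into {..<k} ((!) s)"
    have "t i < k" "s ! t i = i" "t (s ! i) = i" if "i < k" for i
      using that bij_betw_inv_into_left[OF bij, of i] bij_betw_inv_into_right[OF bij, of i]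
        bij_betw_apply[OF bij_betw_inv_into[OF bij], of i]
      unfolding t_def by simp_all
    then show thesis
      by (intro that[of t]) auto
  qed
  have "bij_betw (\<lambda>xs. map (\<lambda>i. xs ! i) s) (emb n k ((\<lambda>(i, j). (s ! i, s ! j)) ` P) {} E) (emb n k P {} E)"
  proof (rule bij_betw_byWitness[where f' = "\<lambda>xs. map (\<lambda>i. xs ! t i) [0..<k]"])
    show "\<forall>xs\<in>emb n k ((\<lambda>(i, j). (s ! i, s ! j)) ` P) {} E. map (\<lambda>i. map ((!) xs) s ! t i) [0..<k] = xs"
      using t len by (auto simp: emb_def intro!: nth_equalityI)
    show "\<forall>xs\<in>emb n k P {} E. map ((!) (map (\<lambda>i. xs ! t i) [0..<k])) s = xs"
      using t len s_lt by (auto simp: emb_def intro!: nth_equalityI)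
    show "(\<lambda>xs. map ((!) xs) s) ` emb n k ((\<lambda>(i, j). (s ! i, s ! j)) ` P) {} E \<subseteq> emb n k P {} E"
    proof safe
      fix xs assume xs: "xs \<in> emb n k ((\<lambda>(i, j). (s ! i, s ! j)) ` P) {} E"
      have "distinct (map ((!) xs) s)"
        using xs s(1) unfolding distinct_map s(2)
        by (simp add: emb_def inj_on_def nth_eq_iff_index_eq)
      moreover have "set (map ((!) xs) s) \<subseteq> {..<n}"
        using xs unfolding set_map s(2) by (auto simp: emb_def subset_iff)
      moreover have "\<forall>(i, j)\<in>P. {map ((!) xs) s ! i, map ((!) xs) s ! j} \<in> E"
      proof safe
        fix i j assume ij: "(i, j) \<in> P"
        then have "(s ! i, s ! j) \<in> (\<lambda>(i, j). (s ! i, s ! j)) ` P" by force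
        moreover have "i < k" "j < k" using ij P by auto
        ultimately show "{map ((!) xs) s ! i, map ((!) xs) s ! j} \<in> E"
          using xs len by (auto simp: emb_def)
      qed
      ultimately show "map ((!) xs) s \<in> emb n k P {} E"
        by (simp add: emb_def len)
    qed
    show "(\<lambda>xs. map (\<lambda>i. xs ! t i) [0..<k]) ` emb n k P {} E \<subseteq> emb n k ((\<lambda>(i, j). (s ! i, s ! j)) ` P) {} E"
    proof safe
      fix xs assume xs: "xs \<in> emb n k P {} E"
      have t_lt: "t i < k" if "i < k" for i
        using t(1)[OF that] .
      have inj: "i = j" if "t i = t j" "i < k" "j < k" for i j
        using t(2) that by metis
      have "distinct (map (\<lambda>i. xs ! t i) [0..<k])"
        using xs t_lt inj by (simp add: emb_def distinct_map inj_on_def nth_eq_iff_index_eq)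
      moreover have "set (map (\<lambda>i. xs ! t i) [0..<k]) \<subseteq> {..<n}"
        using xs t_lt by (auto simp: emb_def subset_iff)
      moreover have "{map (\<lambda>i. xs ! t i) [0..<k] ! (s ! i), map (\<lambda>i. xs ! t i) [0..<k] ! (s ! j)} \<in> E"
        if "(i, j) \<in> P" for i j
      proof -
        have "i < k" "j < k" using that P by auto
        then show ?thesis
          using xs that s_lt t(3) by (auto simp: emb_def)
      qed
      ultimately show "map (\<lambda>i. xs ! t i) [0..<k] \<in> emb n k ((\<lambda>(i, j). (s ! i, s ! j)) ` P) {} E"
        by (auto simp: emb_def)
    qed
  qed
  then show ?thesis
    by (metis bij_betw_same_card cnt_def)
qed

lemma regular_graphsD:
  assumes "E \<in> regular_graphs n d"
  shows "simple_graph_on n E" "\<And>v. v < n \<Longrightarrow> degree E v = d"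
  using assms by (auto simp: regular_graphs_def)

lemma finite_regular_graphs [simp]: "finite (regular_graphs n d)"
proof (rule finite_subset)
  show "regular_graphs n d \<subseteq> Pow (Pow {..<n})"
    by (auto simp: regular_graphs_def simple_graph_on_def)
qed simp

lemma edge_ends:
  assumes "simple_graph_on n E" "{v, w} \<in> E"
  shows "v < n" "w < n" "v \<noteq> w"
proof -
  have "{v, w} \<subseteq> {..<n}" "card {v, w} = 2"
    using assms by (auto simp: simple_graph_on_def)
  then show "v < n" "w < n" "v \<noteq> w"
    by auto
qed

lemma card_neighbours_eq_degree:
  assumes "simple_graph_on n E"
  shows "card {w. {v, w} \<in> E} = degree E v"
proof -
  have "(\<lambda>w. {v, w}) ` {w. {v, w} \<in> E} = {e \<in> E. v \<in> e}"
  proof (intro equalityI subsetI)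
    fix e assume e: "e \<in> {e \<in> E. v \<in> e}"
    then obtain x y where xy: "e = {x, y}"
      using assms by (auto simp: simple_graph_on_def card_2_iff)
    then have "e = {v, if v = x then y else x}"
      using e by auto
    then show "e \<in> (\<lambda>w. {v, w}) ` {w. {v, w} \<in> E}"
      using e by blast
  qed auto
  moreover have "inj_on (\<lambda>w. {v, w}) {w. {v, w} \<in> E}"
    by (auto simp: inj_on_def doubleton_eq_iff)
  ultimately show ?thesis
    unfolding degree_def using card_image by fastforce
qed

lemma card_neighbours:
  assumes "E \<in> regular_graphs n d" "v < n"
  shows "card {w. {v, w} \<in> E} = d" "card {w. {w, v} \<in> E} = d"
proof -
  show "card {w. {v, w} \<in> E} = d"
    using assms regular_graphsD[OF assms(1)] card_neighbours_eq_degree[of n E v] by simp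
  then show "card {w. {w, v} \<in> E} = d"
    by (simp only: insert_commute)
qed

lemma finite_neighbours:
  assumes "simple_graph_on n E"
  shows "finite {w. {v, w} \<in> E}" "finite {w. {w, v} \<in> E}"
proof -
  have "{w. {v, w} \<in> E} \<subseteq> {..<n}" "{w. {w, v} \<in> E} \<subseteq> {..<n}"
    using edge_ends[OF assms] by auto
  then show "finite {w. {v, w} \<in> E}" "finite {w. {w, v} \<in> E}"
    by (meson finite_lessThan finite_subset)+
qed

lemma card_arcs:
  assumes "E \<in> regular_graphs n d"
  shows "card {(z, w). {z, w} \<in> E} = n * d" "finite {(z, w). {z, w} \<in> E}"
proof -
  have eq: "{(z, w). {z, w} \<in> E} = (SIGMA z:{..<n}. {w. {z, w} \<in> E})"
    using edge_ends[OF regular_graphsD(1)[OF assms]] by auto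
  show "card {(z, w). {z, w} \<in> E} = n * d"
    unfolding eq using assms
    by (subst card_SigmaI) (auto simp: card_neighbours finite_neighbours[OF regular_graphsD(1)])
  show "finite {(z, w). {z, w} \<in> E}"
    unfolding eq using finite_neighbours[OF regular_graphsD(1)[OF assms]] by auto
qed

text \<open>A common neighbour of the vertices at the positions \<open>I\<close> is either an old
  vertex \<open>xs ! j\<close>, which adds pairs on the same k positions, or a new one, which
  extends the list. The cases of zero, one and two positions give isolated vertices, pendant
  vertices and codegrees.\<close>

lemma sum_card_common_neighbours:
  assumes I: "I \<subseteq> {..<k}" and P: "P \<subseteq> {..<k} \<times> {..<k}" and N: "N \<subseteq> {..<k} \<times> {..<k}"
  shows "(\<Sum>xs\<in>emb n k P N E. real (card {w. w < n \<and> (\<forall>i\<in>I. {w, xs ! i} \<in> E)})) =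
    (\<Sum>j<k. cnt n k (P \<union> Pair j ` I) N E) + cnt n (Suc k) (P \<union> Pair k ` I) N E"
proof -
  define W where "W xs = {w. w < n \<and> (\<forall>i\<in>I. {w, xs ! i} \<in> E)}" for xs :: "nat list"
  have finW: "finite (W xs)" for xs by (simp add: W_def)
  have split: "card (W xs) = card (W xs \<inter> set xs) + card (W xs - set xs)" for xs
    by (metis Int_Diff_Un Int_Diff_disjoint card_Un_disjoint finW finite_Diff finite_Int)
  have inner: "card (W xs \<inter> set xs) = (\<Sum>j<k. if \<forall>i\<in>I. {xs ! j, xs ! i} \<in> E then 1 else 0)"
    if "xs \<in> emb n k P N E" for xs
  proof -
    have xs: "length xs = k" "distinct xs" "set xs \<subseteq> {..<n}"
      using that by (auto simp: emb_def)
    have "W xs \<inter> set xs = (!) xs ` {j. j < k \<and> (\<forall>i\<in>I. {xs ! j, xs ! i} \<in> E)}"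
      using xs by (auto simp: W_def in_set_conv_nth subset_iff image_iff)
    moreover have "inj_on ((!) xs) {j. j < k \<and> (\<forall>i\<in>I. {xs ! j, xs ! i} \<in> E)}"
      using xs by (auto simp: inj_on_def nth_eq_iff_index_eq)
    ultimately have "card (W xs \<inter> set xs) = card {j. j < k \<and> (\<forall>i\<in>I. {xs ! j, xs ! i} \<in> E)}"
      by (simp add: card_image)
    also have "\<dots> = (\<Sum>j\<in>{j. j < k \<and> (\<forall>i\<in>I. {xs ! j, xs ! i} \<in> E)}. 1)"
      by simp
    also have "\<dots> = (\<Sum>j<k. if \<forall>i\<in>I. {xs ! j, xs ! i} \<in> E then 1 else 0)"
      by (rule sum.mono_neutral_cong_left) auto
    finally show ?thesis .
  qed
  have "(\<Sum>xs\<in>emb n k P N E. real (card (W xs \<inter> set xs)))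
      = (\<Sum>xs\<in>emb n k P N E. \<Sum>j<k. if \<forall>i\<in>I. {xs ! j, xs ! i} \<in> E then 1 else 0)"
    by (intro sum.cong refl) (auto simp: inner intro!: sum.cong)
  also have "\<dots> = (\<Sum>j<k. \<Sum>xs\<in>emb n k P N E. if \<forall>i\<in>I. {xs ! j, xs ! i} \<in> E then 1 else 0)"
    by (rule sum.swap)
  also have "\<dots> = (\<Sum>j<k. cnt n k (P \<union> Pair j ` I) N E)"
  proof (intro sum.cong refl)
    fix j
    have "emb n k P N E \<inter> {xs. \<forall>i\<in>I. {xs ! j, xs ! i} \<in> E} = emb n k (P \<union> Pair j ` I) N E"
      by (auto simp: emb_def)
    then show "(\<Sum>xs\<in>emb n k P N E. if \<forall>i\<in>I. {xs ! j, xs ! i} \<in> E then 1 else 0) = cnt n k (P \<union> Pair j ` I) N E"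
      by (simp add: sum.If_cases cnt_def)
  qed
  finally have 1: "(\<Sum>xs\<in>emb n k P N E. real (card (W xs \<inter> set xs))) = (\<Sum>j<k. cnt n k (P \<union> Pair j ` I) N E)" .
  have "bij_betw (\<lambda>(xs, w). xs @ [w]) (SIGMA xs:emb n k P N E. W xs - set xs) (emb n (Suc k) (P \<union> Pair k ` I) N E)"
  proof (rule bij_betw_byWitness[where f' = "\<lambda>ys. (butlast ys, last ys)"])
    show "\<forall>a\<in>SIGMA xs:emb n k P N E. W xs - set xs. (butlast (case a of (xs, w) \<Rightarrow> xs @ [w]), last (case a of (xs, w) \<Rightarrow> xs @ [w])) = a"
      by auto
    show "\<forall>a'\<in>emb n (Suc k) (P \<union> Pair k ` I) N E. (case (butlast a', last a') of (xs, w) \<Rightarrow> xs @ [w]) = a'"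
      by (auto simp: emb_def intro!: append_butlast_last_id)
    show "(\<lambda>(xs, w). xs @ [w]) ` (SIGMA xs:emb n k P N E. W xs - set xs) \<subseteq> emb n (Suc k) (P \<union> Pair k ` I) N E"
    proof safe
      fix xs w assume xs: "xs \<in> emb n k P N E" and w: "w \<in> W xs" "w \<notin> set xs"
      have [simp]: "length xs = k" using xs by (simp add: emb_def)
      have [simp]: "i < k \<Longrightarrow> (xs @ [w]) ! i = xs ! i" "(xs @ [w]) ! k = w" for i
        by (simp_all add: nth_append)
      show "xs @ [w] \<in> emb n (Suc k) (P \<union> Pair k ` I) N E"
        using xs w I P N by (fastforce simp: emb_def W_def)
    qed
    show "(\<lambda>ys. (butlast ys, last ys)) ` emb n (Suc k) (P \<union> Pair k ` I) N E \<subseteq> (SIGMA xs:emb n k P N E. W xs - set xs)"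
    proof (rule image_subsetI)
      fix ys assume ys: "ys \<in> emb n (Suc k) (P \<union> Pair k ` I) N E"
      then have "length ys = Suc k" by (simp add: emb_def)
      then obtain xs w where [simp]: "ys = xs @ [w]"
        by (metis length_Suc_conv_rev)
      have [simp]: "length xs = k" using ys by (simp add: emb_def)
      have old: "(xs @ [w]) ! i = xs ! i" if "i < k" for i
        using that by (simp add: nth_append)
      have new: "(xs @ [w]) ! k = w"
        by (simp add: nth_append)
      have edge: "{(xs @ [w]) ! i, (xs @ [w]) ! j} \<in> E" if "(i, j) \<in> P \<union> Pair k ` I" for i j
        using ys that unfolding emb_def by auto
      have nonedge: "{(xs @ [w]) ! i, (xs @ [w]) ! j} \<notin> E" if "(i, j) \<in> N" for i j
        using ys that unfolding emb_def by auto
      have "{xs ! i, xs ! j} \<in> E" if "(i, j) \<in> P" for i j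
        using edge[of i j] that P old[of i] old[of j] by auto
      moreover have "{xs ! i, xs ! j} \<notin> E" if "(i, j) \<in> N" for i j
        using nonedge[of i j] that N old[of i] old[of j] by auto
      moreover have "{w, xs ! i} \<in> E" if "i \<in> I" for i
        using edge[of k i] that I old[of i] new by auto
      ultimately show "(butlast ys, last ys) \<in> (SIGMA xs:emb n k P N E. W xs - set xs)"
        using ys by (auto simp: emb_def W_def)
    qed
  qed
  then have "card (SIGMA xs:emb n k P N E. W xs - set xs) = card (emb n (Suc k) (P \<union> Pair k ` I) N E)"
    by (rule bij_betw_same_card)
  then have 2: "(\<Sum>xs\<in>emb n k P N E. real (card (W xs - set xs))) = cnt n (Suc k) (P \<union> Pair k ` I) N E"
    using finW by (simp add: cnt_def flip: of_nat_sum)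
  have "(\<Sum>xs\<in>emb n k P N E. real (card (W xs))) =
     (\<Sum>xs\<in>emb n k P N E. real (card (W xs \<inter> set xs))) + (\<Sum>xs\<in>emb n k P N E. real (card (W xs - set xs)))"
    by (simp add: split sum.distrib)
  then show ?thesis
    using 1 2 by (simp add: W_def)
qed

text \<open>Regularity gives exactly d neighbours of the vertex at i, from which those already on
  the list are removed. In the sum, j = i is a loop and contributes 0, while a j already joined to i
  in \<open>P\<close> contributes the full count.\<close>

lemma cnt_pendant:
  assumes E: "E \<in> regular_graphs n d" and i: "i < k"
    and P: "P \<subseteq> {..<k} \<times> {..<k}" and N: "N \<subseteq> {..<k} \<times> {..<k}"
  shows "cnt n (Suc k) (insert (k, i) P) N E = d * cnt n k P N E - (\<Sum>j<k. cnt n k (insert (j, i) P) N E)"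
proof -
  have "real (card {w. w < n \<and> (\<forall>i\<in>{i}. {w, xs ! i} \<in> E)}) = d" if "xs \<in> emb n k P N E" for xs
  proof -
    have "{w. w < n \<and> (\<forall>i\<in>{i}. {w, xs ! i} \<in> E)} = {w. {w, xs ! i} \<in> E}"
      using edge_ends[OF regular_graphsD(1)[OF E]] by auto
    moreover have "xs ! i < n"
      using that i nth_mem by (force simp: emb_def)
    ultimately show ?thesis
      using card_neighbours[OF E, of "xs ! i"] by simp
  qed
  then have "(\<Sum>xs\<in>emb n k P N E. real (card {w. w < n \<and> (\<forall>i\<in>{i}. {w, xs ! i} \<in> E)})) = d * cnt n k P N E"
    by (simp add: cnt_def)
  then show ?thesis
    using sum_card_common_neighbours[of "{i}" k P N n E] i P N by simp
qed

lemma cnt_pendant_bounds: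
  assumes E: "E \<in> regular_graphs n d" and i: "i < k"
    and P: "P \<subseteq> {..<k} \<times> {..<k}" and N: "N \<subseteq> {..<k} \<times> {..<k}"
  shows "cnt n (Suc k) (insert (k, i) P) N E \<le> d * cnt n k P N E"
    "\<bar>cnt n (Suc k) (insert (k, i) P) N E - d * cnt n k P N E\<bar> \<le> k * cnt n k P N E"
proof -
  have "(\<Sum>j<k. cnt n k (insert (j, i) P) N E) \<le> (\<Sum>j<k. cnt n k P N E)"
    by (intro sum_mono cnt_mono) auto
  moreover have "(\<Sum>j<k. cnt n k (insert (j, i) P) N E) \<ge> 0"
    by (intro sum_nonneg) auto
  ultimately show "cnt n (Suc k) (insert (k, i) P) N E \<le> d * cnt n k P N E"
    "\<bar>cnt n (Suc k) (insert (k, i) P) N E - d * cnt n k P N E\<bar> \<le> k * cnt n k P N E"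
    using cnt_pendant[OF assms] by auto
qed

section \<open>Switchings\<close>

definition switch :: "nat \<Rightarrow> nat \<Rightarrow> nat \<Rightarrow> nat \<Rightarrow> nat set set \<Rightarrow> nat set set" where
  "switch p q r s E = (E - {{p, q}, {r, s}}) \<union> {{p, r}, {q, s}}"

lemma switch_other:
  assumes "e \<noteq> {p, q}" "e \<noteq> {r, s}" "e \<noteq> {p, r}" "e \<noteq> {q, s}"
  shows "e \<in> switch p q r s E \<longleftrightarrow> e \<in> E"
  using assms by (auto simp: switch_def)

context
  fixes p q r s :: nat and E :: "nat set set"
  assumes dist: "distinct [p, q, r, s]"
    and edges: "{p, q} \<in> E" "{r, s} \<in> E" "{p, r} \<notin> E" "{q, s} \<notin> E"
begin

lemma switch_edges:
  "{p, q} \<notin> switch p q r s E" "{r, s} \<notin> switch p q r s E"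
  "{p, r} \<in> switch p q r s E" "{q, s} \<in> switch p q r s E"
  using dist by (auto simp: switch_def doubleton_eq_iff)

lemma switch_switch: "switch p r q s (switch p q r s E) = E"
  using dist edges by (auto simp: switch_def doubleton_eq_iff)

lemma switch_regular:
  assumes E: "E \<in> regular_graphs n d" and lt: "p < n" "q < n" "r < n" "s < n"
  shows "switch p q r s E \<in> regular_graphs n d"
proof -
  have sg: "simple_graph_on n (switch p q r s E)"
    using regular_graphsD(1)[OF E] dist lt by (auto simp: switch_def simple_graph_on_def)
  have finE: "finite E"
    by (rule finite_subset[of _ "Pow {..<n}"])
       (use regular_graphsD(1)[OF E] in \<open>auto simp: simple_graph_on_def\<close>)
  have "degree (switch p q r s E) v = d" if "v < n" for v
  proof -
    have eq: "{e \<in> switch p q r s E. v \<in> e} =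
        ({e \<in> E. v \<in> e} - {e \<in> {{p, q}, {r, s}}. v \<in> e}) \<union> {e \<in> {{p, r}, {q, s}}. v \<in> e}"
      by (auto simp: switch_def)
    have d: "card {e \<in> E. v \<in> e} = d"
      using regular_graphsD(2)[OF E that] by (simp add: degree_def)
    have "card {e \<in> {{p, q}, {r, s}}. v \<in> e} = (if v \<in> {p, q, r, s} then 1 else 0)"
    proof -
      have "{e \<in> {{p, q}, {r, s}}. v \<in> e} =
          (if v \<in> {p, q} then {{p, q}} else if v \<in> {r, s} then {{r, s}} else {})"
        using dist by auto
      then show ?thesis by auto
    qed
    moreover have "card {e \<in> {{p, r}, {q, s}}. v \<in> e} = (if v \<in> {p, q, r, s} then 1 else 0)"
    proof -
      have "{e \<in> {{p, r}, {q, s}}. v \<in> e} =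
          (if v \<in> {p, r} then {{p, r}} else if v \<in> {q, s} then {{q, s}} else {})"
        using dist by auto
      then show ?thesis by auto
    qed
    moreover have sub: "{e \<in> {{p, q}, {r, s}}. v \<in> e} \<subseteq> {e \<in> E. v \<in> e}"
      using edges by auto
    moreover have "card {e \<in> {{p, q}, {r, s}}. v \<in> e} \<le> card {e \<in> E. v \<in> e}"
      using sub finE by (intro card_mono) auto
    moreover have "({e \<in> E. v \<in> e} - {e \<in> {{p, q}, {r, s}}. v \<in> e}) \<inter> {e \<in> {{p, r}, {q, s}}. v \<in> e} = {}"
      using edges by auto
    ultimately show ?thesis
      unfolding degree_def eq using finE d
      by (subst card_Un_disjoint) (auto simp: card_Diff_subset)
  qed
  then show ?thesis
    using sg by (simp add: regular_graphs_def)
qed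

end

text \<open>The inverse is the switching with q and r exchanged, so both directions rest on the same
  facts.\<close>

lemma switch_bij:
  assumes dist: "distinct [p, q, r, s]" and lt: "p < n" "q < n" "r < n" "s < n"
  shows "bij_betw (switch p q r s)
    {E \<in> regular_graphs n d. {p, q} \<in> E \<and> {r, s} \<in> E \<and> {p, r} \<notin> E \<and> {q, s} \<notin> E}
    {E \<in> regular_graphs n d. {p, q} \<notin> E \<and> {r, s} \<notin> E \<and> {p, r} \<in> E \<and> {q, s} \<in> E}"
proof (rule bij_betw_byWitness[where f' = "switch p r q s"])
  have dist': "distinct [p, r, q, s]"
    using dist by auto
  show "\<forall>E\<in>{E \<in> regular_graphs n d. {p, q} \<in> E \<and> {r, s} \<in> E \<and> {p, r} \<notin> E \<and> {q, s} \<notin> E}.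
      switch p r q s (switch p q r s E) = E"
    using switch_switch[OF dist] by simp
  show "\<forall>E\<in>{E \<in> regular_graphs n d. {p, q} \<notin> E \<and> {r, s} \<notin> E \<and> {p, r} \<in> E \<and> {q, s} \<in> E}.
      switch p q r s (switch p r q s E) = E"
    using switch_switch[OF dist'] by simp
  show "switch p q r s ` {E \<in> regular_graphs n d. {p, q} \<in> E \<and> {r, s} \<in> E \<and> {p, r} \<notin> E \<and> {q, s} \<notin> E}
      \<subseteq> {E \<in> regular_graphs n d. {p, q} \<notin> E \<and> {r, s} \<notin> E \<and> {p, r} \<in> E \<and> {q, s} \<in> E}"
  proof (rule image_subsetI)
    fix E assume "E \<in> {E \<in> regular_graphs n d. {p, q} \<in> E \<and> {r, s} \<in> E \<and> {p, r} \<notin> E \<and> {q, s} \<notin> E}"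
    then show "switch p q r s E \<in> {E \<in> regular_graphs n d. {p, q} \<notin> E \<and> {r, s} \<notin> E \<and> {p, r} \<in> E \<and> {q, s} \<in> E}"
      using switch_regular[OF dist, of E n d] switch_edges[OF dist, of E] lt by simp
  qed
  show "switch p r q s ` {E \<in> regular_graphs n d. {p, q} \<notin> E \<and> {r, s} \<notin> E \<and> {p, r} \<in> E \<and> {q, s} \<in> E}
      \<subseteq> {E \<in> regular_graphs n d. {p, q} \<in> E \<and> {r, s} \<in> E \<and> {p, r} \<notin> E \<and> {q, s} \<notin> E}"
  proof (rule image_subsetI)
    fix E assume "E \<in> {E \<in> regular_graphs n d. {p, q} \<notin> E \<and> {r, s} \<notin> E \<and> {p, r} \<in> E \<and> {q, s} \<in> E}"
    then show "switch p r q s E \<in> {E \<in> regular_graphs n d. {p, q} \<in> E \<and> {r, s} \<in> E \<and> {p, r} \<notin> E \<and> {q, s} \<notin> E}"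
      using switch_regular[OF dist', of E n d] switch_edges[OF dist', of E] lt by simp
  qed
qed

text \<open>The pairs of \<^const>\<open>emb\<close> patterns are oriented from the larger to the smaller index.
  A switching replaces the edges of the pairs (k, 0) and (k + 1, k - 1) by those of
  (k - 1, 0) and (k + 1, k); it closes the path 0, ..., k - 1 to a cycle.\<close>

definition path_pat :: "nat \<Rightarrow> (nat \<times> nat) set" where
  "path_pat k = {(Suc i, i) | i. Suc i < k}"

definition open_emb :: "nat \<Rightarrow> nat \<Rightarrow> nat set set \<Rightarrow> nat list set" where
  "open_emb n k E = emb n (k + 2) (insert (k, 0) (insert (k + 1, k - 1) (path_pat k))) {(k - 1, 0), (k + 1, k)} E"

definition closed_emb :: "nat \<Rightarrow> nat \<Rightarrow> nat set set \<Rightarrow> nat list set" where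
  "closed_emb n k E = emb n (k + 2) (insert (k - 1, 0) (insert (k + 1, k) (path_pat k))) {(k, 0), (k + 1, k - 1)} E"

definition close_path :: "nat \<Rightarrow> nat list \<Rightarrow> nat set set \<Rightarrow> nat set set" where
  "close_path k xs = switch (xs ! 0) (xs ! k) (xs ! (k - 1)) (xs ! (k + 1))"

text \<open>For a fixed tuple, switching is a bijection from the graphs in which the tuple is open
  to those in which it is closed. The tuple itself does not change, so summing over all tuples
  produces no multiplicities.\<close>

lemma switching_identity:
  fixes f :: "nat set set \<Rightarrow> 'b :: comm_monoid_add"
  assumes k: "k \<ge> 3"
  shows "(\<Sum>E\<in>regular_graphs n d. \<Sum>xs\<in>open_emb n k E. f (close_path k xs E)) =
    (\<Sum>E\<in>regular_graphs n d. \<Sum>xs\<in>closed_emb n k E. f E)"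
proof -
  define L where "L = {xs. length xs = k + 2 \<and> distinct xs \<and> set xs \<subseteq> {..<n}}"
  have finL: "finite L"
    unfolding L_def by (rule finite_subset[OF _ finite_lists_length_eq[of "{..<n}" "k + 2"]]) auto
  have R: "finite (regular_graphs n d)" by simp
  have open_L: "open_emb n k E = {xs \<in> L. xs \<in> open_emb n k E}"
    and closed_L: "closed_emb n k E = {xs \<in> L. xs \<in> closed_emb n k E}" for E
    by (auto simp: open_emb_def closed_emb_def emb_def L_def)
  have main: "(\<Sum>E\<in>{E \<in> regular_graphs n d. xs \<in> open_emb n k E}. f (close_path k xs E)) =
      (\<Sum>E\<in>{E \<in> regular_graphs n d. xs \<in> closed_emb n k E}. f E)" if xs: "xs \<in> L" for xs
  proof -
    define p q r s where "p = xs ! 0" "q = xs ! k" "r = xs ! (k - 1)" "s = xs ! (k + 1)"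
    note pqrs = p_q_r_s_def
    have len: "length xs = k + 2" and dx: "distinct xs" and sub: "set xs \<subseteq> {..<n}"
      using xs by (auto simp: L_def)
    have dist: "distinct [p, q, r, s]"
      using k len dx by (auto simp: pqrs nth_eq_iff_index_eq)
    have lt: "p < n" "q < n" "r < n" "s < n"
      using sub len k nth_mem[of _ xs] by (auto simp: pqrs subset_iff)
    define pa where "pa E \<longleftrightarrow> (\<forall>i. Suc i < k \<longrightarrow> {xs ! Suc i, xs ! i} \<in> E)" for E
    have o: "xs \<in> open_emb n k E \<longleftrightarrow> pa E \<and> {p, q} \<in> E \<and> {r, s} \<in> E \<and> {p, r} \<notin> E \<and> {q, s} \<notin> E" for E
      using len dx sub by (auto simp: open_emb_def emb_def path_pat_def pa_def pqrs insert_commute)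
    have c: "xs \<in> closed_emb n k E \<longleftrightarrow> pa E \<and> {p, q} \<notin> E \<and> {r, s} \<notin> E \<and> {p, r} \<in> E \<and> {q, s} \<in> E" for E
      using len dx sub by (auto simp: closed_emb_def emb_def path_pat_def pa_def pqrs insert_commute)
    \<comment> \<open>The switched pairs involve position k or k + 1, except the pair (k - 1, 0),
      which is not a path edge because k >= 3.\<close>
    have pa: "pa (switch p q r s E) = pa E" for E
    proof -
      have "{xs ! Suc i, xs ! i} \<in> switch p q r s E \<longleftrightarrow> {xs ! Suc i, xs ! i} \<in> E" if "Suc i < k" for i
        using that k len dx by (intro switch_other) (auto simp: pqrs doubleton_eq_iff nth_eq_iff_index_eq)
      then show ?thesis by (auto simp: pa_def)
    qed
    note bij = switch_bij[OF dist lt, of d]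
    have bij': "bij_betw (switch p q r s) {E \<in> regular_graphs n d. xs \<in> open_emb n k E} {E \<in> regular_graphs n d. xs \<in> closed_emb n k E}"
    proof (rule bij_betw_subset[OF bij])
      show "switch p q r s ` {E \<in> regular_graphs n d. xs \<in> open_emb n k E} = {E \<in> regular_graphs n d. xs \<in> closed_emb n k E}"
      proof
        show "switch p q r s ` {E \<in> regular_graphs n d. xs \<in> open_emb n k E} \<subseteq> {E \<in> regular_graphs n d. xs \<in> closed_emb n k E}"
          using bij pa unfolding o c bij_betw_def by blast
        show "{E \<in> regular_graphs n d. xs \<in> closed_emb n k E} \<subseteq> switch p q r s ` {E \<in> regular_graphs n d. xs \<in> open_emb n k E}"
        proof
          fix E assume E: "E \<in> {E \<in> regular_graphs n d. xs \<in> closed_emb n k E}"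
          then obtain E' where "E' \<in> {E \<in> regular_graphs n d. {p, q} \<in> E \<and> {r, s} \<in> E \<and> {p, r} \<notin> E \<and> {q, s} \<notin> E}"
             "E = switch p q r s E'"
            using bij unfolding c bij_betw_def by blast
          then show "E \<in> switch p q r s ` {E \<in> regular_graphs n d. xs \<in> open_emb n k E}"
            using E pa unfolding o c by blast
        qed
      qed
    qed (auto simp: o)
    show ?thesis
      using sum.reindex_bij_betw[OF bij', of f] by (simp add: close_path_def pqrs)
  qed
  have "(\<Sum>E\<in>regular_graphs n d. \<Sum>xs\<in>open_emb n k E. f (close_path k xs E)) =
      (\<Sum>E\<in>regular_graphs n d. \<Sum>xs | xs \<in> L \<and> xs \<in> open_emb n k E. f (close_path k xs E))"
    using open_L by (intro sum.cong refl) auto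
  also have "\<dots> = (\<Sum>xs\<in>L. \<Sum>E | E \<in> regular_graphs n d \<and> xs \<in> open_emb n k E. f (close_path k xs E))"
    by (rule sum.swap_restrict[OF R finL])
  also have "\<dots> = (\<Sum>xs\<in>L. \<Sum>E | E \<in> regular_graphs n d \<and> xs \<in> closed_emb n k E. f E)"
    by (intro sum.cong refl main)
  also have "\<dots> = (\<Sum>E\<in>regular_graphs n d. \<Sum>xs | xs \<in> L \<and> xs \<in> closed_emb n k E. f E)"
    by (rule sum.swap_restrict[OF R finL, symmetric])
  also have "\<dots> = (\<Sum>E\<in>regular_graphs n d. \<Sum>xs\<in>closed_emb n k E. f E)"
    using closed_L by (intro sum.cong refl) auto
  finally show ?thesis .
qed

text \<open>The edge xy is switched away: an arc (z, w) with xz and yw not edges and zw outside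
  \<open>H\<close> turns xy, zw into xz, yw and preserves \<open>H\<close>. At least n d - 2 d^2 - 4
  d - 2 |H| arcs are available, while a graph containing \<open>H\<close> arises with at most d^2
  arcs, since z is then a neighbour of x and w one of y.\<close>

lemma card_supergraphs_insert_le:
  assumes H: "finite H" and xy: "{x, y} \<notin> H" "x \<noteq> y" "x < n" "y < n"
  shows "real (card {E \<in> regular_graphs n d. insert {x, y} H \<subseteq> E}) *
      (real (n * d) - 2 * real d ^ 2 - 4 * real d - 2 * real (card H))
    \<le> real (card {E \<in> regular_graphs n d. H \<subseteq> E}) * real d ^ 2"
proof -
  define A where "A = {E \<in> regular_graphs n d. insert {x, y} H \<subseteq> E}"
  define B where "B = {E \<in> regular_graphs n d. H \<subseteq> E}"
  define good where "good E = {(z, w). {z, w} \<in> E \<and> z \<notin> {x, y} \<and> w \<notin> {x, y} \<and>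
      {x, z} \<notin> E \<and> {y, w} \<notin> E \<and> {z, w} \<notin> H}" for E :: "nat set set"
  define rets where "rets E = {w. {x, w} \<in> E} \<times> {w. {y, w} \<in> E}" for E :: "nat set set"
  have finA: "finite A" and finB: "finite B" by (auto simp: A_def B_def)
  have card_good: "real (card (good E)) \<ge> real (n * d) - 2 * real d ^ 2 - 4 * real d - 2 * real (card H)"
    if "E \<in> A" for E
  proof -
    have E: "E \<in> regular_graphs n d" using that by (simp add: A_def)
    define N where "N v = {w. {v, w} \<in> E}" for v
    have N: "card (N v) = d" if "v < n" for v
      unfolding N_def by (rule card_neighbours(1)[OF E that])
    have finN: "finite (N v)" for v
      unfolding N_def by (rule finite_neighbours[OF regular_graphsD(1)[OF E]])
    have Nlt: "v < n" if "v \<in> N u" for u v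
      using that edge_ends[OF regular_graphsD(1)[OF E]] by (auto simp: N_def)
    define arcs where "arcs = {(z, w). {z, w} \<in> E}"
    \<comment> \<open>The bad arcs: \<open>S\<close> covers those whose tail is x, y or a neighbour
      of x, \<open>S'\<close> reversed those whose head is x, y or a neighbour of y, and
      \<open>HH\<close> those lying in \<open>H\<close>, two for each edge.\<close>
    define S where "S = (SIGMA z:{x, y}. N z) \<union> (SIGMA z:N x. N z)"
    define HH where "HH = {(z, w). {z, w} \<in> H \<and> {z, w} \<in> E}"
    have arcs: "card arcs = n * d" "finite arcs"
      unfolding arcs_def using card_arcs[OF E] by auto
    define HE where "HE = {(z, w). z < w \<and> (z, w) \<in> HH}"
    have HHsub: "HH \<subseteq> HE \<union> prod.swap ` HE"
    proof
      fix a assume a: "a \<in> HH"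
      obtain z w where [simp]: "a = (z, w)" by force
      have "z \<noteq> w" using a edge_ends(3)[OF regular_graphsD(1)[OF E]] by (auto simp: HH_def)
      then consider "z < w" | "w < z" by linarith
      then show "a \<in> HE \<union> prod.swap ` HE"
        by cases (use a in \<open>auto simp: HE_def HH_def insert_commute image_iff\<close>)
    qed
    have cHE: "card HE \<le> card H"
    proof (rule card_inj_on_le[OF _ _ H])
      show "inj_on (\<lambda>(z, w). {z, w}) HE"
        by (auto simp: inj_on_def HE_def doubleton_eq_iff)
      show "(\<lambda>(z, w). {z, w}) ` HE \<subseteq> H"
        by (auto simp: HE_def HH_def)
    qed
    have finHE: "finite HE"
      by (rule finite_subset[OF _ arcs(2)]) (auto simp: HE_def HH_def arcs_def)
    have cHH: "card HH \<le> 2 * card H"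
    proof -
      have "card HH \<le> card (HE \<union> prod.swap ` HE)"
        using finHE by (intro card_mono HHsub) auto
      also have "\<dots> \<le> card HE + card (prod.swap ` HE)"
        by (rule card_Un_le)
      also have "\<dots> \<le> card HE + card HE"
        using finHE by (simp add: card_image_le)
      finally show ?thesis using cHE by simp
    qed
    have nH: "HH = {(z, w) \<in> arcs. {z, w} \<in> H}"
      by (auto simp: HH_def arcs_def)
    have finHH: "finite HH"
      using arcs(2) unfolding nH by (rule rev_finite_subset) auto
    define S' where "S' = (SIGMA z:{x, y}. N z) \<union> (SIGMA z:N y. N z)"
    have c1: "card (SIGMA z:{x, y}. N z) = 2 * d"
      using xy finN by (subst card_SigmaI) (auto simp: N)
    have c2: "card (SIGMA z:N v. N z) = d * d" if "v < n" for v
    proof -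
      have "(\<Sum>z\<in>N v. card (N z)) = (\<Sum>z\<in>N v. d)"
        by (intro sum.cong refl N) (use Nlt in auto)
      then show ?thesis using finN N[OF that] by (subst card_SigmaI) auto
    qed
    have cS: "card S \<le> 2 * d + d * d" and cS': "card S' \<le> 2 * d + d * d"
      unfolding S_def S'_def using c1 c2 xy card_Un_le by metis+
    have finS: "finite S" "finite S'" using finN by (auto simp: S_def S'_def)
    have sub: "arcs \<subseteq> good E \<union> (S \<union> prod.swap ` S' \<union> HH)"
    proof
      fix a assume a: "a \<in> arcs"
      obtain z w where zw: "a = (z, w)" by force
      have e: "{z, w} \<in> E" "{w, z} \<in> E"
        using a by (auto simp: arcs_def zw insert_commute)
      consider "z \<in> {x, y} \<or> {x, z} \<in> E" | "w \<in> {x, y} \<or> {y, w} \<in> E" | "{z, w} \<in> H" | "(z, w) \<in> good E"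
        using e by (auto simp: good_def)
      then show "a \<in> good E \<union> (S \<union> prod.swap ` S' \<union> HH)"
      proof cases
        case 1
        then have "(z, w) \<in> S" using e by (auto simp: S_def N_def)
        then show ?thesis by (simp add: zw)
      next
        case 2
        then have "(w, z) \<in> S'" using e by (auto simp: S'_def N_def)
        then have "prod.swap (w, z) \<in> prod.swap ` S'" by (rule imageI)
        then show ?thesis by (simp add: zw)
      qed (use e in \<open>auto simp: zw HH_def\<close>)
    qed
    have fing: "finite (good E)"
      by (rule finite_subset[OF _ arcs(2)]) (auto simp: good_def arcs_def)
    have c: "card arcs \<le> card (good E) + (card S + card (prod.swap ` S') + card HH)"
    proof -
      have "card arcs \<le> card (good E \<union> (S \<union> prod.swap ` S' \<union> HH))"
        using fing finS finHH by (intro card_mono sub) auto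
      also have "\<dots> \<le> card (good E) + card (S \<union> prod.swap ` S' \<union> HH)"
        by (rule card_Un_le)
      also have "card (S \<union> prod.swap ` S' \<union> HH) \<le> card (S \<union> prod.swap ` S') + card HH"
        by (rule card_Un_le)
      also have "card (S \<union> prod.swap ` S') \<le> card S + card (prod.swap ` S')"
        by (rule card_Un_le)
      finally show ?thesis by simp
    qed
    have "card (prod.swap ` S') \<le> card S'"
      using finS(2) by (rule card_image_le)
    note c
    also have "card (good E) + (card S + card (prod.swap ` S') + card HH)
        \<le> card (good E) + ((2 * d + d * d) + (2 * d + d * d) + 2 * card H)"
      using cS cS' cHH \<open>card (prod.swap ` S') \<le> card S'\<close> by (intro add_mono) auto
    finally have "n * d \<le> card (good E) + ((2 * d + d * d) + (2 * d + d * d) + 2 * card H)"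
      by (simp only: arcs(1))
    then have "real (n * d) \<le> real (card (good E) + ((2 * d + d * d) + (2 * d + d * d) + 2 * card H))"
      by (rule of_nat_mono)
    then show ?thesis by (simp add: power2_eq_square algebra_simps)
  qed
  have card_rets: "card (rets E) = d * d" "finite (rets E)" if "E \<in> B" for E
  proof -
    have E: "E \<in> regular_graphs n d" using that by (simp add: B_def)
    show "card (rets E) = d * d"
      using card_neighbours(1)[OF E] xy by (simp add: rets_def card_cartesian_product)
    show "finite (rets E)"
      using finite_neighbours[OF regular_graphsD(1)[OF E]] by (simp add: rets_def)
  qed
  have fin_good: "finite (good E)" if "E \<in> A" for E
    using that card_arcs(2)[of E n d] by (auto simp: A_def good_def intro: rev_finite_subset)
  \<comment> \<open>Recording (z, w) beside the switched graph makes the map injective, because the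
    switching can then be undone.\<close>
  have le: "card (Sigma A good) \<le> card (Sigma B rets)"
  proof (rule card_inj_on_le[where f = "\<lambda>(E, z, w). (switch x y z w E, z, w)"])
    have ok: "distinct [x, y, z, w] \<and> {x, y} \<in> E \<and> {z, w} \<in> E \<and> {x, z} \<notin> E \<and> {y, w} \<notin> E \<and> z < n \<and> w < n"
      if "E \<in> A" "(z, w) \<in> good E" for E z w
    proof -
      have "simple_graph_on n E" using that by (auto simp: A_def regular_graphs_def)
      then show ?thesis
        using that xy edge_ends[of n E z w] by (auto simp: A_def good_def)
    qed
    show "inj_on (\<lambda>(E, z, w). (switch x y z w E, z, w)) (Sigma A good)"
    proof (rule inj_onI)
      fix a b assume ab: "a \<in> Sigma A good" "b \<in> Sigma A good"
        and eq: "(case a of (E, z, w) \<Rightarrow> (switch x y z w E, z, w)) = (case b of (E, z, w) \<Rightarrow> (switch x y z w E, z, w))"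
      have inv: "switch x z y w (switch x y z w E) = E" if "E \<in> A" "(z, w) \<in> good E" for E z w
        using ok[OF that] by (intro switch_switch) simp_all
      obtain E z w where a: "a = (E, z, w)" by (cases a)
      obtain E' z' w' where b: "b = (E', z', w')" by (cases b)
      have e: "switch x y z w E = switch x y z w E'" "z' = z" "w' = w"
        using eq by (auto simp: a b)
      have "switch x z y w (switch x y z w E) = E" "switch x z y w (switch x y z w E') = E'"
        using inv[of E z w] inv[of E' z w] ab by (auto simp: a b e(2,3))
      then show "a = b"
        by (metis a b e)
    qed
    show "(\<lambda>(E, z, w). (switch x y z w E, z, w)) ` Sigma A good \<subseteq> Sigma B rets"
    proof clarify
      fix E z w assume *: "E \<in> A" "(z, w) \<in> good E"
      note o = ok[OF *]
      have "switch x y z w E \<in> regular_graphs n d"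
        using o * xy by (intro switch_regular) (auto simp: A_def)
      moreover have "H \<subseteq> switch x y z w E"
        using * xy by (auto simp: A_def good_def switch_def)
      moreover have "(z, w) \<in> rets (switch x y z w E)"
        by (auto simp: rets_def switch_def)
      ultimately show "switch x y z w E \<in> B \<and> (z, w) \<in> rets (switch x y z w E)"
        by (simp add: B_def)
    qed
    show "finite (Sigma B rets)"
      using finB card_rets by auto
  qed
  have "real (card A) * (real (n * d) - 2 * real d ^ 2 - 4 * real d - 2 * real (card H))
     \<le> (\<Sum>E\<in>A. real (card (good E)))"
    using sum_mono[of A "\<lambda>_. real (n * d) - 2 * real d ^ 2 - 4 * real d - 2 * real (card H)", OF card_good]
    by simp
  also have "\<dots> = real (card (Sigma A good))"
    using finA fin_good by (subst card_SigmaI) auto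
  also have "\<dots> \<le> real (card (Sigma B rets))"
    using le by simp
  also have "\<dots> = real (card B) * real d ^ 2"
    using finB card_rets by (subst card_SigmaI) (auto simp: power2_eq_square)
  finally show ?thesis by (simp add: A_def B_def)
qed

text \<open>Edges of \<open>H\<close> are removed one at a time, each at the cost of d^2 divided by
  at least n d / 2. The bound 16 covers the k + 3 edges that occur for k <= 13 in
  \<open>small_closed_emb\<close>.\<close>

lemma card_supergraphs_le:
  assumes H: "finite H" "\<And>e. e \<in> H \<Longrightarrow> e \<subseteq> {..<n} \<and> card e = 2" "card H \<le> 16"
    and d: "d \<ge> 8" "8 * d \<le> n"
  shows "real (card {E \<in> regular_graphs n d. H \<subseteq> E}) \<le> real (card (regular_graphs n d)) * (2 * real d / real n) ^ card H"
  using H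
proof (induction H rule: finite_induct)
  case empty
  then show ?case by simp
next
  case (insert e H)
  obtain x y where e: "e = {x, y}" "x \<noteq> y" "x < n" "y < n"
    using insert.prems(1)[of e] by (auto simp: card_2_iff)
  have cH: "card H \<le> 15" using insert by simp
  have IH: "real (card {E \<in> regular_graphs n d. H \<subseteq> E}) \<le> real (card (regular_graphs n d)) * (2 * real d / real n) ^ card H"
    using insert by simp
  have "8 * real d ^ 2 \<le> real n * real d"
  proof -
    have "real (8 * d) * real d \<le> real n * real d"
      using d(2) by (intro mult_right_mono) (simp_all only: of_nat_mono of_nat_0_le_iff)
    then show ?thesis by (simp add: power2_eq_square)
  qed
  moreover have "8 * real d \<le> real d ^ 2"
    using d(1) by (simp add: power2_eq_square mult_right_mono)
  \<comment> \<open>The losses are 2 d^2 <= n d / 4, 4 d <= n d / 16 and 2 |H| <= 30 < 32 <= n d /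
    16, together less than n d / 2.\<close>
  ultimately have *: "real n * real d / 2 \<le> real (n * d) - 2 * real d ^ 2 - 4 * real d - 2 * real (card H)"
  proof -
    have "real (card H) \<le> 15" "real d \<ge> 8"
      using cH d(1) by simp_all
    moreover from this have "8 * 8 \<le> 8 * real d" by simp
    ultimately show ?thesis
      using \<open>8 * real d ^ 2 \<le> real n * real d\<close> \<open>8 * real d \<le> real d ^ 2\<close>
      unfolding of_nat_mult by argo
  qed
  have "real (card {E \<in> regular_graphs n d. insert e H \<subseteq> E}) * (real n * real d / 2)
      \<le> real (card {E \<in> regular_graphs n d. insert e H \<subseteq> E}) * (real (n * d) - 2 * real d ^ 2 - 4 * real d - 2 * real (card H))"
    by (rule mult_left_mono[OF *]) simp
  also have "\<dots> \<le> real (card {E \<in> regular_graphs n d. H \<subseteq> E}) * real d ^ 2"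
    unfolding e(1) using insert e by (intro card_supergraphs_insert_le) auto
  also have "\<dots> \<le> real (card (regular_graphs n d)) * (2 * real d / real n) ^ card H * real d ^ 2"
    by (rule mult_right_mono[OF IH]) simp
  finally show ?case
    using d insert.hyps by (simp add: field_simps power2_eq_square)
qed

text \<open>First moment: there are at most n^k tuples, and each prescribes \<open>card P\<close>
  edges. The orientation j < i ensures that different pairs name different edges.\<close>

lemma sum_cnt_le:
  assumes P: "P \<subseteq> {(i, j). j < i \<and> i < k}" "card P \<le> 16" and d: "d \<ge> 8" "8 * d \<le> n"
  shows "(\<Sum>E\<in>regular_graphs n d. cnt n k P N E)
    \<le> real (card (regular_graphs n d)) * (real n ^ k * (2 * real d / real n) ^ card P)"
proof -
  define L where "L = {xs. length xs = k \<and> distinct xs \<and> set xs \<subseteq> {..<n}}"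
  have L: "L \<subseteq> {xs. set xs \<subseteq> {..<n} \<and> length xs = k}" by (auto simp: L_def)
  have finL: "finite L"
    by (rule finite_subset[OF L finite_lists_length_eq]) simp
  have "card L \<le> n ^ k"
    using card_mono[OF finite_lists_length_eq L] card_lists_length_eq[of "{..<n}" k] by simp
  then have cL: "real (card L) \<le> real n ^ k"
    by (metis of_nat_le_iff of_nat_power)
  have finP: "finite P"
    by (rule finite_subset[OF P(1), OF finite_subset[of _ "{..<k} \<times> {..<k}"]]) auto
  have "(\<Sum>E\<in>regular_graphs n d. cnt n k P N E) \<le> (\<Sum>E\<in>regular_graphs n d. cnt n k P {} E)"
    by (intro sum_mono cnt_mono) auto
  also have "\<dots> = (\<Sum>E\<in>regular_graphs n d. \<Sum>xs | xs \<in> L \<and> xs \<in> emb n k P {} E. 1)"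
    by (intro sum.cong refl) (auto simp: cnt_def L_def emb_def intro!: arg_cong[where f = card])
  also have "\<dots> = (\<Sum>xs\<in>L. \<Sum>E | E \<in> regular_graphs n d \<and> xs \<in> emb n k P {} E. 1)"
    by (rule sum.swap_restrict) (auto simp: finL)
  also have "\<dots> \<le> (\<Sum>xs\<in>L. real (card (regular_graphs n d)) * (2 * real d / real n) ^ card P)"
  proof (rule sum_mono)
    fix xs assume xs: "xs \<in> L"
    then have len: "length xs = k" and dx: "distinct xs" and sub: "set xs \<subseteq> {..<n}"
      by (auto simp: L_def)
    define H where "H = (\<lambda>(i, j). {xs ! i, xs ! j}) ` P"
    have inj: "inj_on (\<lambda>(i, j). {xs ! i, xs ! j}) P"
    proof (rule inj_onI, clarify)
      fix i j i' j' assume *: "(i, j) \<in> P" "(i', j') \<in> P" "{xs ! i, xs ! j} = {xs ! i', xs ! j'}"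
      have "j < i" "i < k" "j' < i'" "i' < k" using * P by auto
      then show "i = i' \<and> j = j'"
        using *(3) len dx by (auto simp: doubleton_eq_iff nth_eq_iff_index_eq)
    qed
    have cH: "card H = card P"
      unfolding H_def by (rule card_image[OF inj])
    have Hok: "e \<subseteq> {..<n} \<and> card e = 2" if "e \<in> H" for e
    proof -
      obtain i j where ij: "(i, j) \<in> P" "e = {xs ! i, xs ! j}"
        using \<open>e \<in> H\<close> unfolding H_def by (elim imageE) (auto split: prod.splits)
      then have "j < i" "i < k" using P by auto
      moreover from this have "xs ! i \<in> set xs" "xs ! j \<in> set xs" using len by auto
      ultimately show ?thesis
        using ij len dx sub by (auto simp: nth_eq_iff_index_eq subset_iff)
    qed
    have "{E \<in> regular_graphs n d. xs \<in> emb n k P {} E} = {E \<in> regular_graphs n d. H \<subseteq> E}"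
      using len dx sub by (auto simp: emb_def H_def)
    then show "(\<Sum>E | E \<in> regular_graphs n d \<and> xs \<in> emb n k P {} E. 1) \<le> real (card (regular_graphs n d)) * (2 * real d / real n) ^ card P"
      using card_supergraphs_le[of H n d] finP Hok P(2) d cH by (simp add: H_def)
  qed
  also have "\<dots> = real (card L) * (real (card (regular_graphs n d)) * (2 * real d / real n) ^ card P)"
    by simp
  also have "\<dots> \<le> real n ^ k * (real (card (regular_graphs n d)) * (2 * real d / real n) ^ card P)"
    by (rule mult_right_mono[OF cL]) simp
  finally show ?thesis by (simp add: mult_ac)
qed

section \<open>Cycles and pendant paths\<close>

definition cyc_pat :: "nat \<Rightarrow> (nat \<times> nat) set" where
  "cyc_pat k = insert (k - 1, 0) (path_pat k)"

lemma path_pat_Suc: "k \<ge> 1 \<Longrightarrow> path_pat (Suc k) = insert (k, k - 1) (path_pat k)"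
  by (auto simp: path_pat_def)

lemma path_pat_1: "path_pat 1 = {}"
  by (auto simp: path_pat_def)

lemma finite_path_pat [simp]: "finite (path_pat k)"
  by (rule finite_subset[of _ "{..<k} \<times> {..<k}"]) (auto simp: path_pat_def)

lemma card_path_pat: "card (path_pat k) = k - 1"
proof -
  have "path_pat k = (\<lambda>i. (Suc i, i)) ` {..<k - 1}"
    by (auto simp: path_pat_def)
  moreover have "inj_on (\<lambda>i. (Suc i, i)) {..<k - 1}"
    by (auto simp: inj_on_def)
  ultimately show ?thesis
    by (simp add: card_image)
qed

lemma path_pat_bounded: "(i, j) \<in> path_pat k \<Longrightarrow> i < k \<and> j < k"
  by (auto simp: path_pat_def)

lemma cnt_vertex: "cnt n 1 {} {} E = n"
proof -
  have "emb n 1 {} {} E = (\<lambda>v. [v]) ` {..<n}"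
    by (auto simp: emb_def length_Suc_conv)
  then show ?thesis
    by (simp add: cnt_def card_image inj_on_def)
qed

text \<open>Each further vertex has d choices up to the vertices already used, so the relative
  losses add up to at most k^2 / d. The second bound is multiplied by d instead of divided, which
  keeps it meaningful for d = 0.\<close>

lemma cnt_path_bounds:
  assumes E: "E \<in> regular_graphs n d" and k: "k \<ge> 1"
  shows "cnt n k (path_pat k) {} E \<le> real n * real d ^ (k - 1)"
    "real d * (real n * real d ^ (k - 1) - cnt n k (path_pat k) {} E) \<le> real k ^ 2 * (real n * real d ^ (k - 1))"
  using k
proof (induction k rule: dec_induct)
  case base
  { case 1 then show ?case by (simp only: path_pat_1 cnt_vertex) simp }
  { case 2 then show ?case by (simp only: path_pat_1 cnt_vertex) simp }
next
  case (step k)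
  have sub: "path_pat k \<subseteq> {..<k} \<times> {..<k}"
    using path_pat_bounded by auto
  have D: "real d ^ k = real d * real d ^ (k - 1)"
    using step(1) by (cases k) auto
  note pb = cnt_pendant_bounds[OF E _ sub, of "k - 1" "{}"]
  define a where "a = cnt n k (path_pat k) {} E"
  define b where "b = cnt n (Suc k) (path_pat (Suc k)) {} E"
  have b: "b \<le> d * a" "\<bar>b - d * a\<bar> \<le> k * a"
    using pb step(1) by (simp_all add: a_def b_def path_pat_Suc)
  have IH: "a \<le> real n * real d ^ (k - 1)"
    "real d * (real n * real d ^ (k - 1) - a) \<le> real k ^ 2 * (real n * real d ^ (k - 1))"
    using step by (simp_all add: a_def)
  { case 1
    have "b \<le> d * (real n * real d ^ (k - 1))"
      using b(1) mult_left_mono[OF IH(1), of "real d"] by simp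
    then show ?case by (simp add: b_def D mult_ac) }
  { case 2
    have "real n * real d ^ k - b \<le> real d * (real n * real d ^ (k - 1) - a) + k * a"
      using b(2) by (simp add: D algebra_simps)
    also have "\<dots> \<le> real k ^ 2 * (real n * real d ^ (k - 1)) + k * (real n * real d ^ (k - 1))"
      using IH by (intro add_mono mult_left_mono) auto
    also have "\<dots> \<le> real (Suc k) ^ 2 * (real n * real d ^ (k - 1))"
      unfolding distrib_right[symmetric]
      by (intro mult_right_mono) (auto simp: power2_eq_square algebra_simps)
    finally have "real d * (real n * real d ^ k - b) \<le> real d * (real (Suc k) ^ 2 * (real n * real d ^ (k - 1)))"
      by (rule mult_left_mono) simp
    then show ?case by (simp add: b_def D mult_ac) }
qed

lemma cnt_isolated_vertex:
  assumes "P \<subseteq> {..<k} \<times> {..<k}"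
  shows "cnt n (Suc k) P {} E = (real n - real k) * cnt n k P {} E"
  using sum_card_common_neighbours[of "{}" k P "{}" n E] assms
  by (simp add: cnt_def algebra_simps)

text \<open>The extra edge is built in two moves: an isolated vertex, with n - k choices, and a
  pendant vertex on it, with d choices up to coincidences with the pattern. Each move loses at most
  k d copies per copy of the pattern.\<close>

lemma cnt_isolated_edge_bounds:
  assumes E: "E \<in> regular_graphs n d" and P: "P \<subseteq> {..<k} \<times> {..<k}"
  shows "\<bar>cnt n (k + 2) (insert (k + 1, k) P) {} E - real n * real d * cnt n k P {} E\<bar> \<le> 2 * real k * real d * cnt n k P {} E"
proof -
  define X where "X = cnt n k P {} E"
  have P': "P \<subseteq> {..<Suc k} \<times> {..<Suc k}" using P by auto
  have loop: "cnt n (Suc k) (insert (k, k) P) {} E = 0"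
    by (rule cnt_loop[OF regular_graphsD(1)[OF E]]) auto
  have le: "cnt n (Suc k) (insert (j, k) P) {} E \<le> real d * X" if "j < k" for j
  proof -
    have "cnt n (Suc k) (insert (j, k) P) {} E = cnt n (Suc k) (insert (k, j) P) {} E"
      by (rule cnt_cong) auto
    also have "\<dots> \<le> real d * X"
      unfolding X_def by (rule cnt_pendant_bounds(1)[OF E that P]) auto
    finally show ?thesis .
  qed
  have eq: "cnt n (k + 2) (insert (k + 1, k) P) {} E =
      real d * ((real n - real k) * X) - (\<Sum>j<k. cnt n (Suc k) (insert (j, k) P) {} E)"
    using cnt_pendant[OF E _ P', of k "{}"] loop
    by (simp add: cnt_isolated_vertex[OF P] X_def)
  have "(\<Sum>j<k. cnt n (Suc k) (insert (j, k) P) {} E) \<le> (\<Sum>j<k. real d * X)"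
    by (intro sum_mono le) auto
  moreover have "(\<Sum>j<k. cnt n (Suc k) (insert (j, k) P) {} E) \<ge> 0"
    by (intro sum_nonneg) auto
  moreover have "X \<ge> 0" by (simp add: X_def)
  ultimately show ?thesis
    unfolding eq X_def[symmetric] by (simp add: algebra_simps)
qed

text \<open>As j = k is allowed, this covers two separate pendant vertices as well as a pendant path
  of length two.\<close>

lemma cnt_two_pendants_bounds:
  assumes E: "E \<in> regular_graphs n d" and P: "P \<subseteq> {..<k} \<times> {..<k}"
    and i: "i < k" and j: "j < Suc k"
  shows "\<bar>cnt n (k + 2) (insert (k + 1, j) (insert (k, i) P)) {} E - real d ^ 2 * cnt n k P {} E\<bar>
    \<le> (2 * real k + 1) * real d * cnt n k P {} E"
proof -
  define X where "X = cnt n k P {} E"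
  define Y where "Y = cnt n (Suc k) (insert (k, i) P) {} E"
  define Z where "Z = cnt n (k + 2) (insert (k + 1, j) (insert (k, i) P)) {} E"
  have P': "insert (k, i) P \<subseteq> {..<Suc k} \<times> {..<Suc k}" using P i by auto
  have Y: "Y \<le> d * X" "\<bar>Y - d * X\<bar> \<le> k * X"
    unfolding X_def Y_def using cnt_pendant_bounds[OF E i P] by auto
  have Z: "\<bar>Z - d * Y\<bar> \<le> Suc k * Y"
    unfolding Z_def Y_def using cnt_pendant_bounds(2)[OF E j P'] by auto
  have "\<bar>Z - real d ^ 2 * X\<bar> \<le> \<bar>Z - d * Y\<bar> + \<bar>d * (Y - d * X)\<bar>"
    by (simp add: power2_eq_square algebra_simps)
  also have "\<dots> \<le> Suc k * Y + d * (k * X)"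
    using Z mult_left_mono[OF Y(2), of d] by (simp add: abs_mult)
  also have "\<dots> \<le> Suc k * (d * X) + d * (k * X)"
    using Y(1) by (intro add_mono mult_left_mono) auto
  finally show ?thesis by (simp add: X_def Z_def algebra_simps)
qed

lemma card_path_from_arc:
  assumes E: "E \<in> regular_graphs n d" and k: "k \<ge> 2"
  shows "card {xs \<in> emb n k (path_pat k) {} E. xs ! 0 = p \<and> xs ! 1 = q} \<le> d ^ (k - 2)"
  using k
proof (induction k rule: dec_induct)
  case base
  have "{xs \<in> emb n 2 (path_pat 2) {} E. xs ! 0 = p \<and> xs ! 1 = q} \<subseteq> {[p, q]}"
    by (auto simp: emb_def length_Suc_conv numeral_2_eq_2)
  then have "card {xs \<in> emb n 2 (path_pat 2) {} E. xs ! 0 = p \<and> xs ! 1 = q} \<le> card {[p, q]}"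
    by (intro card_mono) auto
  then show ?case by simp
next
  case (step k)
  define S where "S k = {xs \<in> emb n k (path_pat k) {} E. xs ! 0 = p \<and> xs ! 1 = q}" for k
  define T where "T = (SIGMA ys:S k. {w. {ys ! (k - 1), w} \<in> E})"
  have fin: "finite (S k)" by (simp add: S_def)
  have finT: "finite T"
    using fin finite_neighbours[OF regular_graphsD(1)[OF E]] by (auto simp: T_def)
  have sub: "S (Suc k) \<subseteq> (\<lambda>(ys, w). ys @ [w]) ` T"
  proof
    fix xs assume xs: "xs \<in> S (Suc k)"
    then have "length xs = Suc k" by (simp add: S_def emb_def)
    then obtain ys w where ys: "xs = ys @ [w]" by (metis length_Suc_conv_rev)
    have len: "length ys = k" using xs ys by (simp add: S_def emb_def)
    have nth: "xs ! i = ys ! i" if "i < k" for i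
      using that len by (simp add: ys nth_append)
    have edge: "{xs ! Suc i, xs ! i} \<in> E" if "Suc i < Suc k" for i
      using xs that by (auto simp: S_def emb_def path_pat_def)
    have "{ys ! Suc i, ys ! i} \<in> E" if "Suc i < k" for i
      using edge[of i] nth[of i] nth[of "Suc i"] that by simp
    then have "ys \<in> S k"
      using xs len nth[of 0] nth[of 1] step(1) by (auto simp: S_def emb_def path_pat_def ys)
    moreover have "{ys ! (k - 1), w} \<in> E"
    proof -
      have "{xs ! Suc (k - 1), xs ! (k - 1)} \<in> E" using edge[of "k - 1"] step(1) by simp
      moreover have "xs ! Suc (k - 1) = w" using step(1) len by (simp add: ys nth_append)
      ultimately show ?thesis using nth[of "k - 1"] step(1) by (simp add: insert_commute)
    qed
    ultimately show "xs \<in> (\<lambda>(ys, w). ys @ [w]) ` T"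
      unfolding ys T_def by force
  qed
  have "card (S (Suc k)) \<le> card ((\<lambda>(ys, w). ys @ [w]) ` T)"
    using finT by (intro card_mono sub) auto
  also have "\<dots> \<le> card T" by (rule card_image_le[OF finT])
  also have "\<dots> = (\<Sum>ys\<in>S k. card {w. {ys ! (k - 1), w} \<in> E})"
    unfolding T_def using fin finite_neighbours[OF regular_graphsD(1)[OF E]] by (subst card_SigmaI) auto
  also have "\<dots> = (\<Sum>ys\<in>S k. d)"
  proof (intro sum.cong refl card_neighbours(1)[OF E])
    fix ys assume "ys \<in> S k"
    then have "length ys = k" "set ys \<subseteq> {..<n}" by (auto simp: S_def emb_def)
    moreover have "k - 1 < k" using step(1) by simp
    ultimately have "ys ! (k - 1) \<in> {..<n}" using nth_mem by blast
    then show "ys ! (k - 1) < n" by simp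
  qed
  also have "\<dots> \<le> d ^ (k - 2) * d"
    using step.IH by (simp add: S_def)
  also have "\<dots> = d ^ (Suc k - 2)"
    using step(1) by (metis Suc_diff_le numeral_2_eq_2 power_Suc2)
  finally show ?case by (simp add: S_def)
qed

lemma cyc_pat_edge:
  assumes xs: "xs \<in> emb n k (cyc_pat k) {} E" and m: "m < k"
  shows "{xs ! (Suc m mod k), xs ! m} \<in> E"
proof (cases "Suc m = k")
  case True
  then have "{xs ! m, xs ! 0} \<in> E"
    using xs by (auto simp: emb_def cyc_pat_def)
  then show ?thesis using True by (simp add: insert_commute)
next
  case False
  then show ?thesis
    using xs m by (auto simp: emb_def cyc_pat_def path_pat_def)
qed

text \<open>Rotation moves the prescribed arc to the front, and forgetting the closing edge leaves a
  path.\<close>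

lemma card_cycle_through_arc:
  assumes E: "E \<in> regular_graphs n d" and k: "k \<ge> 2"
  shows "card {xs \<in> emb n k (cyc_pat k) {} E. xs ! i = p \<and> xs ! (Suc i mod k) = q \<and> i < k} \<le> d ^ (k - 2)"
    (is "card ?S \<le> _")
proof -
  have "card ?S \<le> card {xs \<in> emb n k (path_pat k) {} E. xs ! 0 = p \<and> xs ! 1 = q}"
  proof (rule card_inj_on_le[where f = "rotate i"])
    show "inj_on (rotate i) ?S"
    proof (rule inj_onI)
      fix xs ys assume *: "xs \<in> ?S" "ys \<in> ?S" "rotate i xs = rotate i ys"
      have "rotate (k - i) (rotate i zs) = zs" if "zs \<in> ?S" for zs
        using that by (simp add: rotate_rotate emb_def)
      from this[OF *(1)] this[OF *(2)] show "xs = ys"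
        unfolding *(3) by (rule trans[OF sym])
    qed
    show "rotate i ` ?S \<subseteq> {xs \<in> emb n k (path_pat k) {} E. xs ! 0 = p \<and> xs ! 1 = q}"
    proof (rule image_subsetI)
      fix xs assume S: "xs \<in> ?S"
      then have xs: "xs \<in> emb n k (cyc_pat k) {} E" and len: "length xs = k" and i: "i < k"
        by (auto simp: emb_def)
      have nth: "rotate i xs ! j = xs ! ((i + j) mod k)" if "j < k" for j
        using nth_rotate[of j xs i] that len by (simp add: add.commute)
      have "{rotate i xs ! Suc j, rotate i xs ! j} \<in> E" if "Suc j < k" for j
        using cyc_pat_edge[OF xs, of "(i + j) mod k"] that nth[of j] nth[of "Suc j"] by (simp add: mod_Suc_eq)
      then have "rotate i xs \<in> emb n k (path_pat k) {} E"
        using xs by (auto simp: emb_def path_pat_def)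
      moreover have "rotate i xs ! 0 = p" "rotate i xs ! 1 = q"
        using S nth[of 0] nth[of 1] k i by auto
      ultimately show "rotate i xs \<in> {xs \<in> emb n k (path_pat k) {} E. xs ! 0 = p \<and> xs ! 1 = q}"
        by simp
    qed
  qed simp
  also have "\<dots> \<le> d ^ (k - 2)"
    by (rule card_path_from_arc[OF E k])
  finally show ?thesis .
qed

text \<open>A cycle present only in \<open>E'\<close> runs through one of two new edges. Two edges,
  two directions and k positions make the factor 4 k.\<close>

lemma cnt_cycle_diff_le:
  assumes E': "E' \<in> regular_graphs n d" and k: "k \<ge> 2"
    and sub: "E' - E \<subseteq> {{a, b}, {c, e}}"
  shows "cnt n k (cyc_pat k) {} E' - cnt n k (cyc_pat k) {} E \<le> 4 * real k * real d ^ (k - 2)"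
proof -
  define S where "S i p q = {xs \<in> emb n k (cyc_pat k) {} E'. xs ! i = p \<and> xs ! (Suc i mod k) = q \<and> i < k}" for i p q
  define Q where "Q = {(a, b), (b, a), (c, e), (e, c)}"
  have finS: "finite (S i p q)" for i p q by (simp add: S_def)
  have "emb n k (cyc_pat k) {} E' - emb n k (cyc_pat k) {} E \<subseteq> (\<Union>i<k. \<Union>(p, q)\<in>Q. S i p q)"
  proof
    fix xs assume xs: "xs \<in> emb n k (cyc_pat k) {} E' - emb n k (cyc_pat k) {} E"
    then obtain i j where ij: "(i, j) \<in> cyc_pat k" "{xs ! i, xs ! j} \<notin> E"
      by (auto simp: emb_def)
    \<comment> \<open>The position at which the pair starts in cyclic order: the closing pair (k -
      1, 0) starts at k - 1, a pair (Suc j, j) at j.\<close>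
    define m where "m = (if (i, j) = (k - 1, 0) then k - 1 else j)"
    have m: "m < k" "{xs ! i, xs ! j} = {xs ! m, xs ! (Suc m mod k)}"
      using ij(1) k by (auto simp: m_def cyc_pat_def path_pat_def insert_commute)
    have "{xs ! i, xs ! j} \<in> E'"
      using ij(1) xs by (auto simp: emb_def)
    then have "{xs ! m, xs ! (Suc m mod k)} \<in> {{a, b}, {c, e}}"
      using sub ij(2) m(2) by auto
    then have "(xs ! m, xs ! (Suc m mod k)) \<in> Q"
      by (auto simp: Q_def doubleton_eq_iff)
    moreover have "xs \<in> S m (xs ! m) (xs ! (Suc m mod k))"
      using xs m(1) by (simp add: S_def)
    ultimately show "xs \<in> (\<Union>i<k. \<Union>(p, q)\<in>Q. S i p q)"
      using m(1) by blast
  qed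
  then have "card (emb n k (cyc_pat k) {} E' - emb n k (cyc_pat k) {} E) \<le> card (\<Union>i<k. \<Union>(p, q)\<in>Q. S i p q)"
    by (intro card_mono) (auto simp: Q_def finS)
  also have "\<dots> \<le> (\<Sum>i<k. card (\<Union>(p, q)\<in>Q. S i p q))"
    by (rule card_UN_le) simp
  also have "\<dots> \<le> (\<Sum>i<k. 4 * d ^ (k - 2))"
  proof (rule sum_mono)
    fix i
    have "card (\<Union>(p, q)\<in>Q. S i p q) \<le> (\<Sum>(p, q)\<in>Q. card (S i p q))"
      using card_UN_le[of Q "\<lambda>(p, q). S i p q"] by (simp add: Q_def case_prod_beta)
    also have "\<dots> \<le> (\<Sum>(p, q)\<in>Q. d ^ (k - 2))"
      by (intro sum_mono) (auto simp: S_def intro: card_cycle_through_arc[OF E' k])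
    also have "\<dots> = card Q * d ^ (k - 2)"
      by (simp add: case_prod_beta)
    also have "\<dots> \<le> 4 * d ^ (k - 2)"
      using card_length[of "[(a, b), (b, a), (c, e), (e, c)]"] by (intro mult_right_mono) (simp_all add: Q_def)
    finally show "card (\<Union>(p, q)\<in>Q. S i p q) \<le> 4 * d ^ (k - 2)" .
  qed
  finally have 1: "card (emb n k (cyc_pat k) {} E' - emb n k (cyc_pat k) {} E) \<le> 4 * k * d ^ (k - 2)"
    by simp
  have "card (emb n k (cyc_pat k) {} E') \<le> card (emb n k (cyc_pat k) {} E \<union> (emb n k (cyc_pat k) {} E' - emb n k (cyc_pat k) {} E))"
    by (intro card_mono) auto
  also have "\<dots> \<le> card (emb n k (cyc_pat k) {} E) + card (emb n k (cyc_pat k) {} E' - emb n k (cyc_pat k) {} E)"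
    by (rule card_Un_le)
  finally have "card (emb n k (cyc_pat k) {} E') \<le> card (emb n k (cyc_pat k) {} E) + 4 * k * d ^ (k - 2)"
    using 1 by simp
  then have "real (card (emb n k (cyc_pat k) {} E')) \<le> real (card (emb n k (cyc_pat k) {} E) + 4 * k * d ^ (k - 2))"
    by (rule of_nat_mono)
  then show ?thesis by (simp add: cnt_def)
qed

section \<open>Concentration of cycle counts\<close>

text \<open>The expectation in the random regular graph whenever such graphs exist. Otherwise the
  quotient has value 0, and constants satisfy only the inequality
  \<open>gmean_const_le\<close>.\<close>

definition gmean :: "nat \<Rightarrow> nat \<Rightarrow> (nat set set \<Rightarrow> real) \<Rightarrow> real" where
  "gmean n d F = (\<Sum>E\<in>regular_graphs n d. F E) / card (regular_graphs n d)"

lemma gmean_add: "gmean n d (\<lambda>E. F E + G E) = gmean n d F + gmean n d G"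
  by (simp add: gmean_def sum.distrib add_divide_distrib)

lemma gmean_diff: "gmean n d (\<lambda>E. F E - G E) = gmean n d F - gmean n d G"
  by (simp add: gmean_def sum_subtractf diff_divide_distrib)

lemma gmean_cmult: "gmean n d (\<lambda>E. c * F E) = c * gmean n d F"
  by (simp add: gmean_def sum_distrib_left)

lemma gmean_mono:
  assumes "\<And>E. E \<in> regular_graphs n d \<Longrightarrow> F E \<le> G E"
  shows "gmean n d F \<le> gmean n d G"
  unfolding gmean_def using assms by (intro divide_right_mono sum_mono) auto

lemma gmean_nonneg:
  assumes "\<And>E. E \<in> regular_graphs n d \<Longrightarrow> F E \<ge> 0"
  shows "gmean n d F \<ge> 0"
  unfolding gmean_def using assms by (intro divide_nonneg_nonneg sum_nonneg) auto

lemma gmean_const_le: "c \<ge> 0 \<Longrightarrow> gmean n d (\<lambda>E. c) \<le> c"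
  by (simp add: gmean_def)

lemma abs_gmean_le: "\<bar>gmean n d F\<bar> \<le> gmean n d (\<lambda>E. \<bar>F E\<bar>)"
  by (simp add: gmean_def abs_divide divide_right_mono sum_abs)

lemma finite_open_emb [simp]: "finite (open_emb n k E)"
  by (simp add: open_emb_def)

lemma open_emb_switch:
  assumes E: "E \<in> regular_graphs n d" and k: "k \<ge> 3" and xs: "xs \<in> open_emb n k E"
  shows "close_path k xs E \<in> regular_graphs n d"
    "close_path k xs E - E \<subseteq> {{xs ! 0, xs ! (k - 1)}, {xs ! k, xs ! (k + 1)}}"
    "E - close_path k xs E \<subseteq> {{xs ! 0, xs ! k}, {xs ! (k - 1), xs ! (k + 1)}}"
proof -
  have len: "length xs = k + 2" and dx: "distinct xs" and sub: "set xs \<subseteq> {..<n}"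
    and e: "{xs ! k, xs ! 0} \<in> E" "{xs ! (k + 1), xs ! (k - 1)} \<in> E"
      "{xs ! (k - 1), xs ! 0} \<notin> E" "{xs ! (k + 1), xs ! k} \<notin> E"
    using xs by (auto simp: open_emb_def emb_def)
  have "distinct [xs ! 0, xs ! k, xs ! (k - 1), xs ! (k + 1)]"
    using k len dx by (auto simp: nth_eq_iff_index_eq)
  moreover have "xs ! i < n" if "i < k + 2" for i
  proof -
    have "xs ! i \<in> set xs" using that len by simp
    then show ?thesis using sub by auto
  qed
  ultimately show "close_path k xs E \<in> regular_graphs n d"
    unfolding close_path_def using E e k by (intro switch_regular) (auto simp: insert_commute)
qed (auto simp: close_path_def switch_def)

lemma path_pat_iff [simp]: "(i, j) \<in> path_pat k \<longleftrightarrow> i = Suc j \<and> i < k"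
  by (auto simp: path_pat_def)

lemma path_pat_subset_square: "path_pat k \<subseteq> {..<k} \<times> {..<k}"
  by auto

lemma card_cyc_pat: "k \<ge> 3 \<Longrightarrow> card (cyc_pat k) = k"
  unfolding cyc_pat_def by (subst card_insert_disjoint) (auto simp: card_path_pat)

lemma cyc_pat_subset: "k \<ge> 2 \<Longrightarrow> cyc_pat k \<subseteq> {(i, j). j < i \<and> i < k}"
  by (auto simp: cyc_pat_def)

lemma cnt_cycle_switch:
  assumes E: "E \<in> regular_graphs n d" and k: "k \<ge> 3" and xs: "xs \<in> open_emb n k E"
  shows "\<bar>cnt n k (cyc_pat k) {} (close_path k xs E) - cnt n k (cyc_pat k) {} E\<bar> \<le> 4 * real k * real d ^ (k - 2)"
  using cnt_cycle_diff_le[OF open_emb_switch(1)[OF assms] _ open_emb_switch(2)[OF assms]]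
    cnt_cycle_diff_le[OF E _ open_emb_switch(3)[OF assms]] k
  by (simp add: abs_le_iff)

abbreviation open_pat :: "nat \<Rightarrow> (nat \<times> nat) set" where
  "open_pat k \<equiv> insert (k + 1, k - 1) (insert (k, 0) (path_pat k))"

abbreviation closed_pat :: "nat \<Rightarrow> (nat \<times> nat) set" where
  "closed_pat k \<equiv> insert (k + 1, k) (cyc_pat k)"

lemma card_open_emb:
  "real (card (open_emb n k E)) = cnt n (k + 2) (open_pat k) {} E
    - cnt n (k + 2) (insert (k - 1, 0) (open_pat k)) {} E
    - cnt n (k + 2) (insert (k + 1, k) (open_pat k)) {} E
    + cnt n (k + 2) (insert (k - 1, 0) (insert (k + 1, k) (open_pat k))) {} E"
  unfolding open_emb_def cnt_def[symmetric]
  by (simp add: cnt_insert_nonedge insert_commute)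

lemma card_closed_emb:
  "real (card (closed_emb n k E)) = cnt n (k + 2) (closed_pat k) {} E
    - cnt n (k + 2) (insert (k, 0) (closed_pat k)) {} E
    - cnt n (k + 2) (insert (k + 1, k - 1) (closed_pat k)) {} E
    + cnt n (k + 2) (insert (k, 0) (insert (k + 1, k - 1) (closed_pat k))) {} E"
  unfolding closed_emb_def cnt_def[symmetric] cyc_pat_def
  by (simp add: cnt_insert_nonedge insert_commute)

text \<open>This holds for every regular graph and not just in mean: it bounds the number of
  switchings by which the largest change of the test function is multiplied.\<close>

lemma card_open_emb_le:
  assumes E: "E \<in> regular_graphs n d" and k: "k \<ge> 3"
  shows "real (card (open_emb n k E)) \<le> real n * real d ^ (k + 1)"
proof -
  have "cnt n (k + 2) (open_pat k) {} E \<le> d * cnt n (Suc k) (insert (k, 0) (path_pat k)) {} E"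
  proof -
    have "insert (k, 0) (path_pat k) \<subseteq> {..<Suc k} \<times> {..<Suc k}" by auto
    from cnt_pendant_bounds(1)[OF E _ this, of "k - 1" "{}"] show ?thesis by simp
  qed
  also have "\<dots> \<le> d * (d * cnt n k (path_pat k) {} E)"
    using cnt_pendant_bounds(1)[OF E _ path_pat_subset_square, of 0 k "{}"] k
    by (intro mult_left_mono) auto
  also have "\<dots> \<le> d * (d * (real n * real d ^ (k - 1)))"
    using cnt_path_bounds(1)[OF E, of k] k by (intro mult_left_mono) auto
  also have "\<dots> = real n * real d ^ (k + 1)"
    using k by (cases k) auto
  finally have "cnt n (k + 2) (open_pat k) {} E \<le> real n * real d ^ (k + 1)" .
  moreover have "real (card (open_emb n k E)) \<le> cnt n (k + 2) (open_pat k) {} E"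
    unfolding open_emb_def cnt_def[symmetric] by (rule cnt_mono) auto
  ultimately show ?thesis by simp
qed

text \<open>The path has relative error k^2 / d and the two pendant edges add (2 k + 1) / d, in
  total (k + 1)^2 / d.\<close>

lemma cnt_open_pat_approx:
  assumes E: "E \<in> regular_graphs n d" and k: "k \<ge> 3"
  shows "\<bar>cnt n (k + 2) (open_pat k) {} E - real n * real d ^ (k + 1)\<bar> \<le> (real k + 1) ^ 2 * (real n * real d ^ k)"
proof -
  define p where "p = cnt n k (path_pat k) {} E"
  have D: "real d ^ k = real d * real d ^ (k - 1)" using k by (cases k) auto
  have "\<bar>cnt n (k + 2) (open_pat k) {} E - real d ^ 2 * p\<bar> \<le> (2 * real k + 1) * real d * p"
    unfolding p_def using k by (intro cnt_two_pendants_bounds[OF E]) auto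
  also have "(2 * real k + 1) * real d * p \<le> (2 * real k + 1) * real d * (real n * real d ^ (k - 1))"
    unfolding p_def using cnt_path_bounds(1)[OF E, of k] k by (intro mult_left_mono) auto
  also have "\<dots> = (2 * real k + 1) * (real n * real d ^ k)"
    by (simp add: D)
  finally have 1: "\<bar>cnt n (k + 2) (open_pat k) {} E - real d ^ 2 * p\<bar> \<le> (2 * real k + 1) * (real n * real d ^ k)" .
  have "p \<le> real n * real d ^ (k - 1)"
    "real d * (real n * real d ^ (k - 1) - p) \<le> real k ^ 2 * (real n * real d ^ (k - 1))"
    unfolding p_def using cnt_path_bounds[OF E, of k] k by auto
  then have "real d * (real d * (real n * real d ^ (k - 1) - p)) \<le> real d * (real k ^ 2 * (real n * real d ^ (k - 1)))"
    "real d * (real d * p) \<le> real d * (real d * (real n * real d ^ (k - 1)))"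
    by (simp_all add: mult_left_mono)
  then have 2: "\<bar>real d ^ 2 * p - real n * real d ^ (k + 1)\<bar> \<le> real k ^ 2 * (real n * real d ^ k)"
    by (simp add: D power2_eq_square algebra_simps)
  show ?thesis
    using 1 2 by (simp add: power2_eq_square algebra_simps)
qed

section \<open>Calculus of error terms bounded in mean\<close>

locale sparse_degrees =
  fixes d :: "nat \<Rightarrow> nat"
  assumes even_arcs: "\<forall>n. even (d n * n)"
    and degree_bigo: "(\<lambda>n. real (d n)) \<in> O(\<lambda>n. sqrt (real n))"
    and degree_at_top: "filterlim d at_top sequentially"
begin

abbreviation R :: "nat \<Rightarrow> nat set set set" where "R n \<equiv> regular_graphs n (d n)"
abbreviation D :: "nat \<Rightarrow> real" where "D n \<equiv> real (d n)"
abbreviation avg :: "nat \<Rightarrow> (nat set set \<Rightarrow> real) \<Rightarrow> real" where "avg n \<equiv> gmean n (d n)"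
abbreviation cyc :: "nat \<Rightarrow> nat \<Rightarrow> nat set set \<Rightarrow> real" where "cyc k n \<equiv> cnt n k (cyc_pat k) {}"

text \<open>Big-O in L^1 for functions of the graph. It passes to sums, multiples and dominated
  functions, and for pattern counts it follows from a first-moment bound.\<close>

definition small :: "(nat \<Rightarrow> real) \<Rightarrow> (nat \<Rightarrow> nat set set \<Rightarrow> real) \<Rightarrow> bool" where
  "small r F \<longleftrightarrow> (\<lambda>n. avg n (\<lambda>E. \<bar>F n E\<bar>)) \<in> O(r)"

lemma D_sq_bigo: "(\<lambda>n. D n ^ 2) \<in> O(\<lambda>n. real n)"
proof -
  have "(\<lambda>n. D n ^ 2) \<in> O(\<lambda>n. sqrt (real n) ^ 2)"
    by (rule landau_o.big_power[OF degree_bigo])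
  then show ?thesis by simp
qed

lemma D_at_top: "filterlim D at_top sequentially"
  by (rule filterlim_compose[OF filterlim_real_sequentially degree_at_top])

lemma eventually_D_ge: "eventually (\<lambda>n. D n \<ge> c) sequentially"
  using D_at_top by (simp add: filterlim_at_top)

text \<open>In effect d = o(n): if d^2 <= C n and d >= c C with c >= 0, then c C d <= d^2 <= C
  n.\<close>

lemma eventually_size: "eventually (\<lambda>n. d n \<ge> 8 \<and> c * D n \<le> real n) sequentially"
proof -
  obtain C where C: "C > 0" "eventually (\<lambda>n. norm (D n ^ 2) \<le> C * norm (real n)) sequentially"
    using D_sq_bigo by (rule landau_o.bigE)
  show ?thesis
    using C(2) eventually_D_ge[of 8] eventually_D_ge[of "max 0 c * C"]
  proof eventually_elim
    case (elim n)
    have "(max 0 c * C) * D n \<le> D n * D n"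
      using elim by (intro mult_right_mono) auto
    also have "\<dots> \<le> C * real n"
      using elim by (simp add: power2_eq_square)
    finally have "C * (max 0 c * D n) \<le> C * real n"
      by (simp add: mult_ac)
    then have "max 0 c * D n \<le> real n"
      using C(1) by simp
    moreover have "c * D n \<le> max 0 c * D n"
      by (intro mult_right_mono) auto
    ultimately have "c * D n \<le> real n"
      by (rule order_trans[rotated])
    then show ?case using elim by simp
  qed
qed

lemma eventually_sizes: "eventually (\<lambda>n. d n \<ge> 8 \<and> 8 * d n \<le> n \<and> n > 0) sequentially"
  using eventually_size[of 8] eventually_gt_at_top[of 0]
  by eventually_elim linarith

lemma D_power_mono:
  assumes "i \<le> j"
  shows "(\<lambda>n. D n ^ i) \<in> O(\<lambda>n. D n ^ j)"
proof (rule bigoI[where c = 1])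
  show "eventually (\<lambda>n. norm (D n ^ i) \<le> 1 * norm (D n ^ j)) sequentially"
    using eventually_D_ge[of 1] by eventually_elim (use assms in \<open>simp add: power_increasing\<close>)
qed

lemma D_power_bigo_n: "(\<lambda>n. D n ^ (k + 2)) \<in> O(\<lambda>n. real n * D n ^ k)"
  using landau_o.big.mult[OF D_sq_bigo, of "\<lambda>n. D n ^ k" "\<lambda>n. D n ^ k"]
  by (simp add: power2_eq_square mult_ac)

lemma D_power_div_n_bigo: "(\<lambda>n. D n ^ (k + 2) / real n) \<in> O(\<lambda>n. D n ^ k)"
proof -
  have "(\<lambda>n. D n ^ (k + 2) / real n) \<in> O(\<lambda>n. real n * D n ^ k / real n)"
    by (intro landau_o.big.divide_right D_power_bigo_n)
       (use eventually_gt_at_top[of 0] in \<open>eventually_elim, simp\<close>)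
  also have "(\<lambda>n. real n * D n ^ k / real n) \<in> O(\<lambda>n. D n ^ k)"
    by (rule bigoI[where c = 1]) (use eventually_gt_at_top[of 0] in \<open>eventually_elim, simp\<close>)
  finally show ?thesis .
qed

lemma smallI_le:
  assumes "eventually (\<lambda>n. avg n (\<lambda>E. \<bar>F n E\<bar>) \<le> g n) sequentially" "g \<in> O(r)"
  shows "small r F"
  unfolding small_def
proof (rule landau_o.big_trans[OF bigoI[where c = 1] assms(2)])
  show "eventually (\<lambda>n. norm (avg n (\<lambda>E. \<bar>F n E\<bar>)) \<le> 1 * norm (g n)) sequentially"
    using assms(1)
  proof eventually_elim
    case (elim n)
    have "avg n (\<lambda>E. \<bar>F n E\<bar>) \<ge> 0" by (rule gmean_nonneg) simp
    then show ?case using elim by simp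
  qed
qed

lemma small_add:
  assumes "small r F" "small r G"
  shows "small r (\<lambda>n E. F n E + G n E)"
proof (rule smallI_le)
  show "(\<lambda>n. avg n (\<lambda>E. \<bar>F n E\<bar>) + avg n (\<lambda>E. \<bar>G n E\<bar>)) \<in> O(r)"
    using assms unfolding small_def by (rule sum_in_bigo)
  show "eventually (\<lambda>n. avg n (\<lambda>E. \<bar>F n E + G n E\<bar>) \<le> avg n (\<lambda>E. \<bar>F n E\<bar>) + avg n (\<lambda>E. \<bar>G n E\<bar>)) sequentially"
    unfolding gmean_add[symmetric] by (intro always_eventually allI gmean_mono abs_triangle_ineq)
qed

lemma small_dominated:
  assumes "small r G" "eventually (\<lambda>n. \<forall>E\<in>R n. \<bar>F n E\<bar> \<le> \<bar>G n E\<bar>) sequentially"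
  shows "small r F"
proof (rule smallI_le)
  show "(\<lambda>n. avg n (\<lambda>E. \<bar>G n E\<bar>)) \<in> O(r)" using assms(1) by (simp add: small_def)
  show "eventually (\<lambda>n. avg n (\<lambda>E. \<bar>F n E\<bar>) \<le> avg n (\<lambda>E. \<bar>G n E\<bar>)) sequentially"
    using assms(2) by eventually_elim (auto intro: gmean_mono)
qed

lemma small_scale:
  assumes "small r F"
  shows "small (\<lambda>n. c n * r n) (\<lambda>n E. c n * F n E)"
proof -
  have "(\<lambda>n. \<bar>c n\<bar> * avg n (\<lambda>E. \<bar>F n E\<bar>)) \<in> O(\<lambda>n. c n * r n)"
    using assms unfolding small_def by (intro landau_o.big.mult) auto
  then show ?thesis
    by (intro smallI_le) (auto simp: abs_mult gmean_cmult)
qed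

lemma small_rate: "small r F \<Longrightarrow> r \<in> O(r') \<Longrightarrow> small r' F"
  unfolding small_def by (rule landau_o.big_trans)

lemma small_const:
  assumes "c \<in> O(r)"
  shows "small r (\<lambda>n E. c n)"
proof (rule smallI_le)
  show "(\<lambda>n. \<bar>c n\<bar>) \<in> O(r)" using assms by simp
  show "eventually (\<lambda>n. avg n (\<lambda>E. \<bar>c n\<bar>) \<le> \<bar>c n\<bar>) sequentially"
    by (intro always_eventually allI gmean_const_le) simp
qed

lemma small_minus: "small r F \<Longrightarrow> small r (\<lambda>n E. - F n E)"
  by (simp add: small_def)

lemma small_diff: "small r F \<Longrightarrow> small r G \<Longrightarrow> small r (\<lambda>n E. F n E - G n E)"
  using small_add[OF _ small_minus, of r F G] by simp

lemma small_scale_D: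
  assumes "small (\<lambda>n. D n ^ k) F"
  shows "small (\<lambda>n. D n ^ (k + m)) (\<lambda>n E. c * D n ^ m * F n E)"
  using small_scale[OF assms, of "\<lambda>n. c * D n ^ m"]
  by (rule small_rate) (auto simp: power_add mult_ac)

lemma small_avg:
  assumes "small r F"
  shows "(\<lambda>n. avg n (F n)) \<in> O(r)"
proof (rule landau_o.big_trans[OF bigoI[where c = 1]])
  show "(\<lambda>n. avg n (\<lambda>E. \<bar>F n E\<bar>)) \<in> O(r)" using assms by (simp add: small_def)
  show "eventually (\<lambda>n. norm (avg n (F n)) \<le> 1 * norm (avg n (\<lambda>E. \<bar>F n E\<bar>))) sequentially"
  proof (intro always_eventually allI)
    fix n
    show "norm (avg n (F n)) \<le> 1 * norm (avg n (\<lambda>E. \<bar>F n E\<bar>))"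
      using abs_gmean_le[of n "d n" "F n"] by simp
  qed
qed

lemma small_cnt:
  assumes P: "P \<subseteq> {(i, j). j < i \<and> i < k}" "card P \<le> 16"
  shows "small (\<lambda>n. real n ^ k * (D n / real n) ^ card P) (\<lambda>n. cnt n k P N)"
proof (rule smallI_le)
  show "(\<lambda>n. real n ^ k * (2 * D n / real n) ^ card P) \<in> O(\<lambda>n. real n ^ k * (D n / real n) ^ card P)"
    by (rule bigoI[where c = "2 ^ card P"], rule always_eventually)
       (simp add: power_mult_distrib power_divide abs_mult mult_ac)
  show "eventually (\<lambda>n. avg n (\<lambda>E. \<bar>cnt n k P N E\<bar>) \<le> real n ^ k * (2 * D n / real n) ^ card P) sequentially"
    using eventually_sizes
  proof eventually_elim
    case (elim n)
    then have "(\<Sum>E\<in>R n. cnt n k P N E) \<le> real (card (R n)) * (real n ^ k * (2 * D n / real n) ^ card P)"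
      by (intro sum_cnt_le P) auto
    then show ?case
      by (cases "card (R n) = 0") (auto simp: gmean_def divide_simps mult_ac)
  qed
qed

text \<open>With as many edges as vertices, for instance in a cycle with pendant trees, the powers
  of n cancel.\<close>

lemma small_cnt_balanced:
  assumes "P \<subseteq> {(i, j). j < i \<and> i < k}" "card P \<le> 16" "card P = k"
  shows "small (\<lambda>n. D n ^ k) (\<lambda>n. cnt n k P N)"
proof (rule small_rate[OF small_cnt[OF assms(1,2)]])
  show "(\<lambda>n. real n ^ k * (D n / real n) ^ card P) \<in> O(\<lambda>n. D n ^ k)"
    by (rule bigoI[where c = 1], use eventually_gt_at_top[of 0] in eventually_elim)
       (simp add: assms(3) power_divide)
qed

text \<open>With one edge more than vertices the mean is of order d^(k + 2) / n, and d^2 = O(n)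
  brings this to d^k, one power of d below the balanced patterns on the same k + 1 vertices.\<close>

lemma small_cnt_chord:
  assumes "P \<subseteq> {(i, j). j < i \<and> i < Suc k}" "card P \<le> 16" "card P = k + 2"
  shows "small (\<lambda>n. D n ^ k) (\<lambda>n. cnt n (Suc k) P N)"
proof (rule small_rate[OF small_cnt[OF assms(1,2)]])
  have "(\<lambda>n. real n ^ Suc k * (D n / real n) ^ card P) \<in> O(\<lambda>n. D n ^ (k + 2) / real n)"
    by (rule bigoI[where c = 1], use eventually_gt_at_top[of 0] in eventually_elim)
       (simp add: assms(3) power_divide field_simps)
  also have "(\<lambda>n. D n ^ (k + 2) / real n) \<in> O(\<lambda>n. D n ^ k)"
    by (rule D_power_div_n_bigo)
  finally show "(\<lambda>n. real n ^ Suc k * (D n / real n) ^ card P) \<in> O(\<lambda>n. D n ^ k)" .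
qed

lemma small_cyc: "k \<ge> 3 \<Longrightarrow> k \<le> 16 \<Longrightarrow> small (\<lambda>n. D n ^ k) (cyc k)"
  using cyc_pat_subset[of k] by (intro small_cnt_balanced) (auto simp: card_cyc_pat)

text \<open>A k-cycle and a disjoint edge give n d copies per cycle. Each forbidden pair would join
  the edge to the cycle as a pendant path of length two, d^2 copies per cycle, whence 2 d^2; both
  pairs together give k + 3 edges on k + 2 vertices, which \<open>small_cnt_chord\<close>
  absorbs.\<close>

lemma small_closed_emb:
  assumes k: "k \<ge> 3" "k \<le> 13"
  shows "small (\<lambda>n. D n ^ (k + 1)) (\<lambda>n E. real (card (closed_emb n k E)) - (real n * D n - 2 * D n ^ 2) * cyc k n E)"
proof -
  have sub: "cyc_pat k \<subseteq> {..<k} \<times> {..<k}"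
    using cyc_pat_subset[of k] k by auto
  have notin: "(i, j) \<notin> cyc_pat k" if "i \<ge> k" for i j
    using cyc_pat_subset[of k] k that by auto
  have finc: "finite (cyc_pat k)"
    by (simp add: cyc_pat_def)
  define F where "F n E = cnt n (k + 2) (closed_pat k) {} E - real n * D n * cyc k n E" for n E
  define G where "G n E = cnt n (k + 2) (insert (k, 0) (closed_pat k)) {} E - D n ^ 2 * cyc k n E" for n E
  define H where "H n E = cnt n (k + 2) (insert (k + 1, k - 1) (closed_pat k)) {} E - D n ^ 2 * cyc k n E" for n E
  define J where "J n E = cnt n (k + 2) (insert (k, 0) (insert (k + 1, k - 1) (closed_pat k))) {} E" for n E
  have sc: "small (\<lambda>n. D n ^ (k + 1)) (\<lambda>n E. c * D n ^ 1 * cyc k n E)" for c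
    by (rule small_scale_D[OF small_cyc]) (use k in auto)
  have F: "small (\<lambda>n. D n ^ (k + 1)) F"
  proof (rule small_dominated[OF sc[of "2 * real k"]], intro always_eventually allI ballI)
    fix n E assume "E \<in> R n"
    from cnt_isolated_edge_bounds[OF this sub] show "\<bar>F n E\<bar> \<le> \<bar>2 * real k * D n ^ 1 * cyc k n E\<bar>"
      by (simp add: F_def)
  qed
  have G: "small (\<lambda>n. D n ^ (k + 1)) G"
  proof (rule small_dominated[OF sc[of "2 * real k + 1"]], intro always_eventually allI ballI)
    fix n E assume "E \<in> R n"
    from cnt_two_pendants_bounds[OF this sub, of 0 k] k show "\<bar>G n E\<bar> \<le> \<bar>(2 * real k + 1) * D n ^ 1 * cyc k n E\<bar>"
      by (simp add: G_def insert_commute)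
  qed
  have H: "small (\<lambda>n. D n ^ (k + 1)) H"
  proof (rule small_dominated[OF sc[of "2 * real k + 1"]], intro always_eventually allI ballI)
    fix n E assume E: "E \<in> R n"
    \<comment> \<open>In this pattern k + 1 is attached to the cycle and k hangs on k + 1, so the
      last two labels are exchanged before pendant vertices are added in order.\<close>
    define s where "s = [0..<k] @ [k + 1, k]"
    have len: "length [0..<k] = k" by simp
    have s_nth: "s ! i = i" if "i < k" for i
      using that by (simp add: s_def nth_append)
    have s_k: "s ! k = k + 1" "s ! Suc k = k"
      by (simp_all add: s_def nth_append)
    have set_s: "set s = {..<k + 2}"
      by (auto simp: s_def)
    have "(\<lambda>(i, j). (s ! i, s ! j)) ` cyc_pat k = cyc_pat k"
    proof -
      have "(case a of (i, j) \<Rightarrow> (s ! i, s ! j)) = a" if "a \<in> cyc_pat k" for a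
        using that sub s_nth by (cases a) auto
      then show ?thesis
        using image_cong[OF refl, of "cyc_pat k" "\<lambda>(i, j). (s ! i, s ! j)" "\<lambda>a. a"] by simp
    qed
    then have img: "(\<lambda>(i, j). (s ! i, s ! j)) ` (insert (k + 1, k) (insert (k, k - 1) (cyc_pat k)))
        = insert (k, k + 1) (insert (k + 1, k - 1) (cyc_pat k))"
      using k by (simp add: s_nth s_k)
    have "cnt n (k + 2) (insert (k + 1, k) (insert (k, k - 1) (cyc_pat k))) {} E
        = cnt n (k + 2) (insert (k, k + 1) (insert (k + 1, k - 1) (cyc_pat k))) {} E"
      unfolding img[symmetric] by (rule cnt_relabel) (use set_s sub k in \<open>auto simp: s_def\<close>)
    also have "\<dots> = cnt n (k + 2) (insert (k + 1, k - 1) (closed_pat k)) {} E"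
      by (rule cnt_cong) auto
    finally show "\<bar>H n E\<bar> \<le> \<bar>(2 * real k + 1) * D n ^ 1 * cyc k n E\<bar>"
      using cnt_two_pendants_bounds[OF E sub, of "k - 1" k] k by (simp add: H_def)
  qed
  have J: "small (\<lambda>n. D n ^ (k + 1)) J"
  proof -
    have c: "card (insert (k, 0) (insert (k + 1, k - 1) (closed_pat k))) = k + 1 + 2"
      using k by (auto simp: card_insert_if finc notin card_cyc_pat)
    have "insert (k, 0) (insert (k + 1, k - 1) (closed_pat k)) \<subseteq> {(i, j). j < i \<and> i < Suc (k + 1)}"
      using cyc_pat_subset[of k] k by auto
    from small_cnt_chord[OF this _ c] show ?thesis
      using k c unfolding J_def[abs_def] by simp
  qed
  have "small (\<lambda>n. D n ^ (k + 1)) (\<lambda>n E. F n E - G n E - H n E + J n E)"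
    by (rule small_add[OF small_diff[OF small_diff[OF F G] H] J])
  then show ?thesis
    by (simp add: card_closed_emb F_def G_def H_def J_def algebra_simps)
qed

text \<open>The pattern is a tree with k + 1 edges. An edge at a forbidden pair makes it balanced,
  so its mean is O(d^(k + 2)) = O(n d^k), no worse than the error for the tree itself.\<close>

lemma small_open_emb:
  assumes k: "k \<ge> 3" "k \<le> 13"
  shows "small (\<lambda>n. real n * D n ^ k) (\<lambda>n E. real (card (open_emb n k E)) - real n * D n ^ (k + 1))"
proof -
  have rate: "(\<lambda>n. D n ^ (k + 2)) \<in> O(\<lambda>n. real n * D n ^ k)"
    by (rule D_power_bigo_n)
  have c1: "card (insert (k - 1, 0) (open_pat k)) = k + 2" and c2: "card (insert (k + 1, k) (open_pat k)) = k + 2"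
    using k by (auto simp: card_path_pat card_insert_if)
  have "small (\<lambda>n. real n * D n ^ k) (\<lambda>n E. (real k + 1) ^ 2 * (real n * D n ^ k))"
    by (rule small_const) simp
  then have F: "small (\<lambda>n. real n * D n ^ k) (\<lambda>n E. cnt n (k + 2) (open_pat k) {} E - real n * D n ^ (k + 1))"
    by (rule small_dominated) (use cnt_open_pat_approx k in \<open>auto intro!: always_eventually\<close>)
  have G: "small (\<lambda>n. real n * D n ^ k) (\<lambda>n. cnt n (k + 2) (insert (k - 1, 0) (open_pat k)) {})"
    by (intro small_rate[OF small_cnt_balanced rate] c1) (use k c1 in auto)
  have H: "small (\<lambda>n. real n * D n ^ k) (\<lambda>n. cnt n (k + 2) (insert (k + 1, k) (open_pat k)) {})"
    by (intro small_rate[OF small_cnt_balanced rate] c2) (use k c2 in auto)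
  have J: "small (\<lambda>n. real n * D n ^ k) (\<lambda>n. cnt n (k + 2) (insert (k - 1, 0) (insert (k + 1, k) (open_pat k))) {})"
    by (rule small_dominated[OF G], intro always_eventually allI ballI) (auto intro!: cnt_mono)
  have "small (\<lambda>n. real n * D n ^ k) (\<lambda>n E. (cnt n (k + 2) (open_pat k) {} E - real n * D n ^ (k + 1))
      - cnt n (k + 2) (insert (k - 1, 0) (open_pat k)) {} E
      - cnt n (k + 2) (insert (k + 1, k) (open_pat k)) {} E
      + cnt n (k + 2) (insert (k - 1, 0) (insert (k + 1, k) (open_pat k))) {} E)"
    by (intro small_add[OF _ J] small_diff F G H)
  then show ?thesis
    by (simp add: card_open_emb algebra_simps)
qed

end

definition clip :: "real \<Rightarrow> real" where
  "clip x = max (-1) (min 1 x)"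

text \<open>The third bound recovers the absolute value from \<open>x * clip x\<close> up to 1; the
  first controls the approximation errors, the second the effect of a single switching.\<close>

lemma clip_bounds: "\<bar>clip x\<bar> \<le> 1" "\<bar>clip x - clip y\<bar> \<le> \<bar>x - y\<bar>" "\<bar>x\<bar> \<le> 1 + x * clip x"
proof -
  have "0 \<le> (x - 1) ^ 2 + x ^ 2" "0 \<le> (x + 1) ^ 2 + x ^ 2" by simp_all
  then have "\<bar>x\<bar> \<le> 1 + x * x"
    by (simp add: power2_eq_square algebra_simps abs_if)
  then show "\<bar>clip x\<bar> \<le> 1" "\<bar>clip x - clip y\<bar> \<le> \<bar>x - y\<bar>" "\<bar>x\<bar> \<le> 1 + x * clip x"
    by (auto simp: clip_def max_def min_def)
qed

context sparse_degrees
begin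

text \<open>Stein's method in \<open>L\<^sup>1\<close>: the switching identity is tested against a truncated linear function at scale \<open>s\<close>.\<close>

lemma avg_cycle_deviation_le:
  fixes n k :: nat and s m :: real
  assumes k: "k \<ge> 3" and s: "s > 0"
  defines "X \<equiv> cyc k n"
  shows "real n * D n * avg n (\<lambda>E. \<bar>X E - m\<bar>) \<le> real n * D n * s
    + avg n (\<lambda>E. \<bar>real (card (closed_emb n k E)) - real n * D n * X E\<bar>)
    + avg n (\<lambda>E. \<bar>real (card (open_emb n k E)) - real n * D n * m\<bar>)
    + real n * D n ^ (k + 1) * (4 * real k * D n ^ (k - 2) / s)"
proof -
  define f where "f E = clip ((X E - m) / s)" for E
  define A where "A E = real (card (open_emb n k E))" for E
  define B where "B E = real (card (closed_emb n k E))" for E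
  define T where "T E = (\<Sum>xs\<in>open_emb n k E. f (close_path k xs E) - f E)" for E
  have f1: "\<bar>f E\<bar> \<le> 1" for E
    by (simp add: f_def clip_bounds)
  have dev: "\<bar>X E - m\<bar> \<le> s + (X E - m) * f E" for E
  proof -
    define y where "y = (X E - m) / s"
    have "s * \<bar>y\<bar> \<le> s * (1 + y * clip y)"
      using s by (intro mult_left_mono clip_bounds(3)) auto
    moreover have "s * \<bar>y\<bar> = \<bar>X E - m\<bar>" "s * y = X E - m"
      using s by (simp_all add: y_def abs_divide)
    ultimately show ?thesis
      by (simp add: f_def y_def[symmetric] distrib_left mult.assoc[symmetric])
  qed
  \<comment> \<open>The test function has Lipschitz constant 1 / s in the cycle count, and one
    switching moves that count by at most 4 k d^(k - 2).\<close>
  have T: "\<bar>T E\<bar> \<le> real n * D n ^ (k + 1) * (4 * real k * D n ^ (k - 2) / s)" if E: "E \<in> R n" for E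
  proof -
    have "\<bar>T E\<bar> \<le> (\<Sum>xs\<in>open_emb n k E. \<bar>f (close_path k xs E) - f E\<bar>)"
      unfolding T_def by (rule sum_abs)
    also have "\<dots> \<le> (\<Sum>xs\<in>open_emb n k E. 4 * real k * D n ^ (k - 2) / s)"
    proof (rule sum_mono)
      fix xs assume xs: "xs \<in> open_emb n k E"
      have "\<bar>f (close_path k xs E) - f E\<bar> \<le> \<bar>(X (close_path k xs E) - m) / s - (X E - m) / s\<bar>"
        unfolding f_def by (rule clip_bounds(2))
      also have "\<dots> = \<bar>X (close_path k xs E) - X E\<bar> / s"
        using s by (simp add: abs_divide flip: diff_divide_distrib)
      also have "\<dots> \<le> 4 * real k * D n ^ (k - 2) / s"
        using cnt_cycle_switch[OF E k xs] s unfolding X_def by (intro divide_right_mono) auto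
      finally show "\<bar>f (close_path k xs E) - f E\<bar> \<le> 4 * real k * D n ^ (k - 2) / s" .
    qed
    also have "\<dots> = A E * (4 * real k * D n ^ (k - 2) / s)"
      by (simp add: A_def)
    also have "\<dots> \<le> real n * D n ^ (k + 1) * (4 * real k * D n ^ (k - 2) / s)"
      unfolding A_def using s by (intro mult_right_mono card_open_emb_le E k) auto
    finally show ?thesis .
  qed
  have "(\<Sum>E\<in>R n. A E * f E + T E) = (\<Sum>E\<in>R n. B E * f E)"
    using switching_identity[OF k, of f n "d n"] by (simp add: T_def A_def B_def sum_subtractf)
  then have "avg n (\<lambda>E. A E * f E + T E) = avg n (\<lambda>E. B E * f E)"
    by (simp add: gmean_def)
  \<comment> \<open>The identity is solved for its main part: the closed embeddings are compared
    with n d X, the open ones with n d m, and T collects the changes of f.\<close>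
  then have eq: "avg n (\<lambda>E. (real n * D n) * ((X E - m) * f E)) =
      avg n (\<lambda>E. (real n * D n * X E - B E) * f E + (A E - real n * D n * m) * f E + T E)"
    by (simp add: gmean_add gmean_diff algebra_simps)
  have "real n * D n * avg n (\<lambda>E. \<bar>X E - m\<bar>) = avg n (\<lambda>E. (real n * D n) * \<bar>X E - m\<bar>)"
    by (simp add: gmean_cmult)
  also have "\<dots> \<le> avg n (\<lambda>E. (real n * D n) * (s + (X E - m) * f E))"
    by (intro gmean_mono mult_left_mono dev) auto
  also have "\<dots> = avg n (\<lambda>E. real n * D n * s) + avg n (\<lambda>E. (real n * D n) * ((X E - m) * f E))"
    by (simp only: distrib_left gmean_add)
  also have "avg n (\<lambda>E. real n * D n * s) \<le> real n * D n * s"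
    using s by (intro gmean_const_le) auto
  also have "avg n (\<lambda>E. (real n * D n) * ((X E - m) * f E)) \<le>
      avg n (\<lambda>E. \<bar>B E - real n * D n * X E\<bar> + \<bar>A E - real n * D n * m\<bar> + real n * D n ^ (k + 1) * (4 * real k * D n ^ (k - 2) / s))"
    unfolding eq
  proof (rule gmean_mono)
    fix E assume E: "E \<in> R n"
    have le: "a * f E \<le> \<bar>a\<bar>" for a
      using mult_left_mono[OF f1[of E], of "\<bar>a\<bar>"] by (simp flip: abs_mult)
    show "(real n * D n * X E - B E) * f E + (A E - real n * D n * m) * f E + T E
       \<le> \<bar>B E - real n * D n * X E\<bar> + \<bar>A E - real n * D n * m\<bar> + real n * D n ^ (k + 1) * (4 * real k * D n ^ (k - 2) / s)"
      using le[of "real n * D n * X E - B E"] le[of "A E - real n * D n * m"] T[OF E] by linarith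
  qed
  also have "\<dots> \<le> avg n (\<lambda>E. \<bar>B E - real n * D n * X E\<bar>) + avg n (\<lambda>E. \<bar>A E - real n * D n * m\<bar>)
      + real n * D n ^ (k + 1) * (4 * real k * D n ^ (k - 2) / s)"
    using s by (simp only: gmean_add) (intro add_mono order_refl gmean_const_le, simp)
  finally show ?thesis
    by (simp add: A_def B_def)
qed

text \<open>The scale s = d^(k - 1) balances the bound: after division by n d, the truncation costs
  s, the switching term is of order d^(2 k - 2) / s, and the error of \<open>small_open_emb\<close>
  is of order d^(k - 1).\<close>

lemma small_cyc_deviation:
  assumes k: "k \<ge> 3" "k \<le> 13"
  shows "small (\<lambda>n. D n ^ (k - 1)) (\<lambda>n E. cyc k n E - D n ^ k)"
proof -
  define j where "j = k - 2"
  have j: "k = Suc (Suc j)"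
    using k by (simp add: j_def)
  define b where "b n = avg n (\<lambda>E. \<bar>real (card (closed_emb n k E)) - real n * D n * cyc k n E\<bar>)" for n
  define a where "a n = avg n (\<lambda>E. \<bar>real (card (open_emb n k E)) - real n * D n * D n ^ k\<bar>)" for n
  define r where "r n = real n * D n ^ k" for n
  \<comment> \<open>At this precision the correction 2 d^2 in \<open>small_closed_emb\<close> is
    itself an error, since d^(k + 2) = O(n d^k).\<close>
  have "small (\<lambda>n. D n ^ (k + 2)) (\<lambda>n E. 2 * D n ^ 2 * cyc k n E)"
    using small_scale_D[OF small_cyc, of k 2 2] k by linarith
  from small_diff[OF small_rate[OF small_closed_emb[OF k] D_power_mono[of "k + 1" "k + 2"]] this]
  have "small (\<lambda>n. D n ^ (k + 2)) (\<lambda>n E. (real (card (closed_emb n k E)) - (real n * D n - 2 * D n ^ 2) * cyc k n E)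
      - 2 * D n ^ 2 * cyc k n E)"
    by linarith
  then have "small r (\<lambda>n E. real (card (closed_emb n k E)) - real n * D n * cyc k n E)"
    unfolding r_def by (intro small_rate[OF _ D_power_bigo_n]) (simp add: algebra_simps)
  then have b: "b \<in> O(r)"
    by (simp add: small_def b_def[abs_def])
  have a: "a \<in> O(r)"
    using small_open_emb[OF k] by (simp add: small_def a_def[abs_def] r_def[abs_def] mult_ac)
  show ?thesis
  proof (rule smallI_le)
    define g where "g n = (r n + b n + a n + 4 * real k * r n) / (real n * D n)" for n
    have nz: "eventually (\<lambda>n. real n * D n \<noteq> 0) sequentially"
      using eventually_sizes by eventually_elim auto
    have "(\<lambda>n. r n + b n + a n + 4 * real k * r n) \<in> O(r)"
      using a b by (intro sum_in_bigo) auto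
    then have "g \<in> O(\<lambda>n. r n / (real n * D n))"
      unfolding g_def using nz by (intro landau_o.big.divide_right) auto
    also have "(\<lambda>n. r n / (real n * D n)) \<in> O(\<lambda>n. D n ^ (k - 1))"
      by (rule bigoI[where c = 1], use nz in eventually_elim) (simp add: r_def j)
    finally show "g \<in> O(\<lambda>n. D n ^ (k - 1))" .
    show "eventually (\<lambda>n. avg n (\<lambda>E. \<bar>cyc k n E - D n ^ k\<bar>) \<le> g n) sequentially"
      using eventually_sizes
    proof eventually_elim
      case (elim n)
      then have pos: "D n > 0" "real n > 0" by auto
      have "real n * D n * avg n (\<lambda>E. \<bar>cyc k n E - D n ^ k\<bar>)
          \<le> real n * D n * D n ^ (k - 1) + b n + a n + real n * D n ^ (k + 1) * (4 * real k * D n ^ (k - 2) / D n ^ (k - 1))"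
        unfolding a_def b_def using pos by (intro avg_cycle_deviation_le k) auto
      also have "\<dots> = r n + b n + a n + 4 * real k * r n"
        using pos by (simp add: r_def j)
      finally show ?case
        using pos by (simp add: g_def field_simps)
    qed
  qed
qed

end

section \<open>The effect of a switching on triangles\<close>

definition triangles :: "nat \<Rightarrow> nat set set \<Rightarrow> nat set set" where
  "triangles n E = {T. T \<subseteq> {..<n} \<and> card T = 3 \<and> (\<forall>e. e \<subseteq> T \<and> card e = 2 \<longrightarrow> e \<in> E)}"

lemma triangle_count_eq: "triangle_count n E = card (triangles n E)"
  by (simp add: triangle_count_def triangles_def)

lemma finite_triangles [simp]: "finite (triangles n E)"
  by (rule finite_subset[of _ "Pow {..<n}"]) (auto simp: triangles_def)

lemma all_pairs_subset_iff:
  assumes "distinct [a, b, c]"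
  shows "(\<forall>e. e \<subseteq> {a, b, c} \<and> card e = 2 \<longrightarrow> e \<in> E) \<longleftrightarrow> {a, b} \<in> E \<and> {b, c} \<in> E \<and> {a, c} \<in> E"
proof
  assume *: "\<forall>e. e \<subseteq> {a, b, c} \<and> card e = 2 \<longrightarrow> e \<in> E"
  show "{a, b} \<in> E \<and> {b, c} \<in> E \<and> {a, c} \<in> E"
    by (intro conjI *[rule_format]) (use assms in auto)
next
  assume *: "{a, b} \<in> E \<and> {b, c} \<in> E \<and> {a, c} \<in> E"
  show "\<forall>e. e \<subseteq> {a, b, c} \<and> card e = 2 \<longrightarrow> e \<in> E"
  proof (intro allI impI)
    fix e assume e: "e \<subseteq> {a, b, c} \<and> card e = 2"
    then obtain x y where "e = {x, y}" "x \<noteq> y" by (auto simp: card_2_iff)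
    then have "e = {a, b} \<or> e = {b, c} \<or> e = {a, c}" using e by auto
    then show "e \<in> E" using * by auto
  qed
qed

lemma triangle_mem_iff:
  assumes "distinct [a, b, c]"
  shows "{a, b, c} \<in> triangles n E \<longleftrightarrow> a < n \<and> b < n \<and> c < n \<and> {a, b} \<in> E \<and> {b, c} \<in> E \<and> {a, c} \<in> E"
  using assms by (auto simp: triangles_def all_pairs_subset_iff[OF assms])

lemma triangles_elim:
  assumes "T \<in> triangles n E"
  obtains a b c where "T = {a, b, c}" "distinct [a, b, c]"
  using assms by (auto simp: triangles_def card_3_iff)

lemma path_pat_numerals:
  "path_pat (Suc (Suc 0)) = {(1, 0)}" "path_pat (Suc (Suc (Suc 0))) = {(2, 1), (1, 0)}"
  "path_pat (Suc (Suc (Suc (Suc 0)))) = {(3, 2), (2, 1), (1, 0)}"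
  "path_pat (Suc (Suc (Suc (Suc (Suc 0))))) = {(4, 3), (3, 2), (2, 1), (1, 0)}"
  "path_pat (Suc (Suc (Suc (Suc (Suc (Suc 0)))))) = {(5, 4), (4, 3), (3, 2), (2, 1), (1, 0)}"
proof -
  have 1: "path_pat (Suc 0) = {}"
    using path_pat_1 by simp
  show 2: "path_pat (Suc (Suc 0)) = {(1, 0)}"
    by (subst path_pat_Suc) (simp_all add: 1)
  show 3: "path_pat (Suc (Suc (Suc 0))) = {(2, 1), (1, 0)}"
    by (subst path_pat_Suc) (simp_all add: 2 eval_nat_numeral)
  show 4: "path_pat (Suc (Suc (Suc (Suc 0)))) = {(3, 2), (2, 1), (1, 0)}"
    by (subst path_pat_Suc) (simp_all add: 3 eval_nat_numeral)
  show 5: "path_pat (Suc (Suc (Suc (Suc (Suc 0))))) = {(4, 3), (3, 2), (2, 1), (1, 0)}"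
    by (subst path_pat_Suc) (simp_all add: 4 eval_nat_numeral)
  show "path_pat (Suc (Suc (Suc (Suc (Suc (Suc 0)))))) = {(5, 4), (4, 3), (3, 2), (2, 1), (1, 0)}"
    by (subst path_pat_Suc) (simp_all add: 5 eval_nat_numeral)
qed

lemma path_pat_small:
  "path_pat 2 = {(1, 0)}" "path_pat 3 = {(2, 1), (1, 0)}" "path_pat 4 = {(3, 2), (2, 1), (1, 0)}"
  "path_pat 5 = {(4, 3), (3, 2), (2, 1), (1, 0)}" "path_pat 6 = {(5, 4), (4, 3), (3, 2), (2, 1), (1, 0)}"
  using path_pat_numerals by (simp_all only: eval_nat_numeral BitM.simps Suc_numeral)

lemma cyc_pat_small:
  "cyc_pat 3 = {(2, 0), (2, 1), (1, 0)}" "cyc_pat 4 = {(3, 0), (3, 2), (2, 1), (1, 0)}"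
  "cyc_pat 5 = {(4, 0), (4, 3), (3, 2), (2, 1), (1, 0)}" "cyc_pat 6 = {(5, 0), (5, 4), (4, 3), (3, 2), (2, 1), (1, 0)}"
  by (simp_all add: cyc_pat_def path_pat_small)

lemma cnt_cycle_3: "cnt n 3 (cyc_pat 3) {} E = 6 * real (triangle_count n E)"
proof -
  have "emb n 3 (cyc_pat 3) {} E = (\<Union>T\<in>triangles n E. permutations_of_set T)"
  proof (intro equalityI subsetI)
    fix xs assume xs: "xs \<in> emb n 3 (cyc_pat 3) {} E"
    then obtain a b c where abc: "xs = [a, b, c]"
      by (auto simp: emb_def length_Suc_conv numeral_3_eq_3)
    have "{a, b, c} \<in> triangles n E"
      using xs by (subst triangle_mem_iff) (auto simp: abc emb_def cyc_pat_small insert_commute numeral_2_eq_2)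
    then show "xs \<in> (\<Union>T\<in>triangles n E. permutations_of_set T)"
      using xs by (auto simp: abc emb_def permutations_of_set_def)
  next
    fix xs assume "xs \<in> (\<Union>T\<in>triangles n E. permutations_of_set T)"
    then have xs: "set xs \<in> triangles n E" "distinct xs"
      by (auto simp: permutations_of_set_def)
    have "length xs = 3"
      using xs distinct_card[of xs] by (simp add: triangles_def)
    then obtain a b c where abc: "xs = [a, b, c]"
      by (auto simp: length_Suc_conv numeral_3_eq_3)
    have "distinct [a, b, c]" using xs(2) by (simp add: abc)
    from triangle_mem_iff[OF this, of n E] show "xs \<in> emb n 3 (cyc_pat 3) {} E"
      using xs by (auto simp: abc emb_def cyc_pat_small insert_commute numeral_2_eq_2)
  qed
  also have "card \<dots> = (\<Sum>T\<in>triangles n E. card (permutations_of_set T))"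
    by (intro card_UN_disjoint) (auto dest: permutations_of_setD)
  also have "\<dots> = (\<Sum>T\<in>triangles n E. 6)"
  proof (intro sum.cong refl)
    fix T assume "T \<in> triangles n E"
    then have "card T = 3" "finite T"
      by (auto simp: triangles_def intro: finite_subset)
    then show "card (permutations_of_set T) = 6"
      by (simp add: fact_numeral)
  qed
  finally show ?thesis by (simp add: cnt_def triangle_count_eq)
qed

definition codegree :: "nat \<Rightarrow> nat set set \<Rightarrow> nat \<Rightarrow> nat \<Rightarrow> nat" where
  "codegree n E p q = card {w. w < n \<and> {w, p} \<in> E \<and> {w, q} \<in> E}"

lemma triangle_count_insert:
  assumes "p \<noteq> q" "p < n" "q < n" "{p, q} \<notin> E" "\<And>v. {v} \<notin> E"
  shows "triangle_count n (insert {p, q} E) = triangle_count n E + codegree n E p q"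
proof -
  define W where "W = {w. w < n \<and> {w, p} \<in> E \<and> {w, q} \<in> E}"
  have W: "w \<noteq> p" "w \<noteq> q" if "w \<in> W" for w
    using that assms(5) by (auto simp: W_def)
  have inj: "inj_on (\<lambda>w. {p, q, w}) W"
    using W by (auto simp: inj_on_def)
  have new: "{p, q, w} \<in> triangles n (insert {p, q} E)" "{p, q, w} \<notin> triangles n E" if w: "w \<in> W" for w
  proof -
    have dist: "distinct [p, q, w]" using W[OF w] assms by auto
    show "{p, q, w} \<in> triangles n (insert {p, q} E)"
      unfolding triangle_mem_iff[OF dist] using w assms by (auto simp: W_def insert_commute)
    show "{p, q, w} \<notin> triangles n E"
      unfolding triangle_mem_iff[OF dist] using assms by auto
  qed
  have "triangles n (insert {p, q} E) = triangles n E \<union> (\<lambda>w. {p, q, w}) ` W"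
  proof (intro equalityI subsetI)
    fix T assume T: "T \<in> triangles n (insert {p, q} E)"
    show "T \<in> triangles n E \<union> (\<lambda>w. {p, q, w}) ` W"
    proof (cases "T \<in> triangles n E")
      case False
      then have "{p, q} \<subseteq> T" "card T = 3" "T \<subseteq> {..<n}" using T by (auto simp: triangles_def)
      moreover obtain a b c where "T = {a, b, c}" "distinct [a, b, c]" using T by (rule triangles_elim)
      ultimately obtain w where w: "T = {p, q, w}" "w \<noteq> p" "w \<noteq> q"
        using assms(1) by auto
      have dist: "distinct [p, q, w]" using w assms by auto
      have "w \<in> W"
        using T unfolding w(1) triangle_mem_iff[OF dist] using w(2,3)
        by (auto simp: W_def doubleton_eq_iff insert_commute)
      then show ?thesis by (simp add: w(1))
    qed simp
  next
    fix T assume "T \<in> triangles n E \<union> (\<lambda>w. {p, q, w}) ` W"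
    then show "T \<in> triangles n (insert {p, q} E)"
      using new(1) by (auto simp: triangles_def)
  qed
  moreover have "triangles n E \<inter> (\<lambda>w. {p, q, w}) ` W = {}"
    using new(2) by auto
  moreover have "finite W" by (simp add: W_def)
  ultimately show ?thesis
    using inj by (simp add: triangle_count_eq card_Un_disjoint card_image codegree_def W_def)
qed

text \<open>Both graphs arise from \<open>E0\<close> by inserting two edges, and each insertion adds
  the codegree of its ends. Expressing the codegrees in \<open>E\<close> produces the last two
  terms: if qr is an edge, then q is a common neighbour of p and r, and r one of q and s, through
  removed edges. The edge ps likewise counts twice.\<close>

lemma triangle_count_switch:
  assumes sg: "simple_graph_on n E" and dist: "distinct [p, q, r, s]"
    and edges: "{p, q} \<in> E" "{r, s} \<in> E" "{p, r} \<notin> E" "{q, s} \<notin> E"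
  shows "real (triangle_count n (switch p q r s E)) - real (triangle_count n E) =
    real (codegree n E p r) + real (codegree n E q s) - real (codegree n E p q) - real (codegree n E r s)
    - 2 * of_bool ({q, r} \<in> E) - 2 * of_bool ({p, s} \<in> E)"
proof -
  define E0 where "E0 = E - {{p, q}, {r, s}}"
  have lt: "p < n" "q < n" "r < n" "s < n"
    using edge_ends[OF sg] edges by auto
  have loopE: "{v} \<notin> E" for v
    using edge_ends(3)[OF sg, of v v] by auto
  then have loop: "{v} \<notin> E0" for v
    by (simp add: E0_def)
  have E: "E = insert {r, s} (insert {p, q} E0)"
    using edges by (auto simp: E0_def)
  have sw: "switch p q r s E = insert {q, s} (insert {p, r} E0)"
    by (auto simp: switch_def E0_def)
  have mem0: "{x, y} \<in> E0 \<longleftrightarrow> {x, y} \<in> E \<and> \<not> (x = p \<and> y = q) \<and> \<not> (x = q \<and> y = p) \<and> \<not> (x = r \<and> y = s) \<and> \<not> (x = s \<and> y = r)" for x y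
    by (auto simp: E0_def doubleton_eq_iff)
  have "triangle_count n (insert {r, s} (insert {p, q} E0)) = triangle_count n (insert {p, q} E0) + codegree n (insert {p, q} E0) r s"
    using dist lt loop by (intro triangle_count_insert) (auto simp: E0_def doubleton_eq_iff)
  moreover have "triangle_count n (insert {p, q} E0) = triangle_count n E0 + codegree n E0 p q"
    using dist lt loop by (intro triangle_count_insert) (auto simp: E0_def)
  moreover have "codegree n (insert {p, q} E0) r s = codegree n E r s"
    unfolding codegree_def
    by (rule arg_cong[where f = card]) (use dist loopE in \<open>auto simp: mem0 doubleton_eq_iff\<close>)
  moreover have "codegree n E0 p q = codegree n E p q"
    unfolding codegree_def
    by (rule arg_cong[where f = card]) (use dist loopE in \<open>auto simp: mem0\<close>)
  ultimately have 1: "triangle_count n E = triangle_count n E0 + codegree n E p q + codegree n E r s"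
    using E by simp
  have "triangle_count n (insert {q, s} (insert {p, r} E0)) = triangle_count n (insert {p, r} E0) + codegree n (insert {p, r} E0) q s"
    using dist lt loop edges by (intro triangle_count_insert) (auto simp: E0_def doubleton_eq_iff)
  moreover have "triangle_count n (insert {p, r} E0) = triangle_count n E0 + codegree n E0 p r"
    using dist lt loop edges by (intro triangle_count_insert) (auto simp: E0_def)
  ultimately have 2: "triangle_count n (switch p q r s E) = triangle_count n E0 + codegree n E0 p r + codegree n (insert {p, r} E0) q s"
    by (simp add: sw)
  define C where "C = {w. w < n \<and> {w, p} \<in> E \<and> {w, r} \<in> E}"
  define C' where "C' = {w. w < n \<and> {w, q} \<in> E \<and> {w, s} \<in> E}"
  have fin: "finite C" "finite C'" by (auto simp: C_def C'_def)
  have "{w. w < n \<and> {w, p} \<in> E0 \<and> {w, r} \<in> E0} = C - {q, s}"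
    using dist by (auto simp: C_def mem0)
  moreover have "C \<inter> {q, s} = (if {q, r} \<in> E then {q} else {}) \<union> (if {p, s} \<in> E then {s} else {})"
    using edges lt by (auto simp: C_def insert_commute)
  then have "card (C \<inter> {q, s}) = of_bool ({q, r} \<in> E) + of_bool ({p, s} \<in> E)"
    using dist by auto
  moreover have "card C = card (C - {q, s}) + card (C \<inter> {q, s})"
    using fin by (metis Int_Diff_Un Int_Diff_disjoint add.commute card_Un_disjoint finite_Diff finite_Int)
  ultimately have 3: "codegree n E p r = codegree n E0 p r + of_bool ({q, r} \<in> E) + of_bool ({p, s} \<in> E)"
    by (simp add: codegree_def C_def)
  have "{w. w < n \<and> {w, q} \<in> insert {p, r} E0 \<and> {w, s} \<in> insert {p, r} E0} = C' - {p, r}"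
    using dist by (auto simp: C'_def mem0 doubleton_eq_iff)
  moreover have "C' \<inter> {p, r} = (if {p, s} \<in> E then {p} else {}) \<union> (if {q, r} \<in> E then {r} else {})"
    using edges lt by (auto simp: C'_def insert_commute)
  then have "card (C' \<inter> {p, r}) = of_bool ({q, r} \<in> E) + of_bool ({p, s} \<in> E)"
    using dist by auto
  moreover have "card C' = card (C' - {p, r}) + card (C' \<inter> {p, r})"
    using fin by (metis Int_Diff_Un Int_Diff_disjoint add.commute card_Un_disjoint finite_Diff finite_Int)
  ultimately have 4: "codegree n E q s = codegree n (insert {p, r} E0) q s + of_bool ({q, r} \<in> E) + of_bool ({p, s} \<in> E)"
    by (simp add: codegree_def C'_def)
  show ?thesis
    unfolding 1 2 3 4 by simp
qed

text \<open>The path 3-0-1-2-4, whose switching creates the triangle 0, 1, 2 and the edge 3-4.\<close>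

abbreviation cherry_pat :: "(nat \<times> nat) set" where
  "cherry_pat \<equiv> {(4, 2), (3, 0), (2, 1), (1, 0)}"

lemma open_pat_3: "open_pat 3 = cherry_pat"
  by (simp add: path_pat_small)

lemma open_emb_3: "open_emb n 3 E = emb n 5 cherry_pat {(2, 0), (4, 3)} E"
proof -
  have "insert (3, 0) (insert (3 + 1, 3 - 1) (path_pat 3)) = cherry_pat"
    by (auto simp: path_pat_small)
  then show ?thesis
    unfolding open_emb_def by simp
qed

text \<open>Turns codegrees into pattern counts: the common neighbour is one of the five vertices of
  the path or a sixth vertex.\<close>

lemma sum_codegree:
  assumes "i < 5" "j < 5"
  shows "(\<Sum>xs\<in>open_emb n 3 E. real (codegree n E (xs ! i) (xs ! j))) =
    (\<Sum>l<5. cnt n 5 (cherry_pat \<union> {(l, i), (l, j)}) {(2, 0), (4, 3)} E)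
    + cnt n 6 (cherry_pat \<union> {(5, i), (5, j)}) {(2, 0), (4, 3)} E"
  using sum_card_common_neighbours[of "{i, j}" 5 cherry_pat "{(2, 0), (4, 3)}" n E] assms
  by (simp add: codegree_def open_emb_3)

lemma sum_of_bool_edge:
  "(\<Sum>xs\<in>open_emb n 3 E. of_bool ({xs ! i, xs ! j} \<in> E)) = cnt n 5 (insert (i, j) cherry_pat) {(2, 0), (4, 3)} E"
proof -
  have "open_emb n 3 E \<inter> {xs. {xs ! i, xs ! j} \<in> E} = emb n 5 (insert (i, j) cherry_pat) {(2, 0), (4, 3)} E"
    by (auto simp: open_emb_3 emb_def)
  then show ?thesis
    by (simp add: of_bool_def sum.If_cases cnt_def)
qed

definition triangle_gain :: "nat \<Rightarrow> nat set set \<Rightarrow> nat list \<Rightarrow> real" where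
  "triangle_gain n E xs = real (triangle_count n (close_path 3 xs E)) - real (triangle_count n E)"

lemma triangle_gain_eq:
  assumes E: "E \<in> regular_graphs n d" and xs: "xs \<in> open_emb n 3 E"
  shows "triangle_gain n E xs =
    real (codegree n E (xs ! 0) (xs ! 2)) + real (codegree n E (xs ! 3) (xs ! 4))
    - real (codegree n E (xs ! 0) (xs ! 3)) - real (codegree n E (xs ! 2) (xs ! 4))
    - 2 * of_bool ({xs ! 3, xs ! 2} \<in> E) - 2 * of_bool ({xs ! 0, xs ! 4} \<in> E)"
proof -
  have len: "length xs = 5" and dx: "distinct xs"
    and e: "{xs ! 3, xs ! 0} \<in> E" "{xs ! 4, xs ! 2} \<in> E" "{xs ! 2, xs ! 0} \<notin> E" "{xs ! 4, xs ! 3} \<notin> E"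
    using xs by (auto simp: open_emb_3 emb_def)
  have "distinct [xs ! 0, xs ! 3, xs ! 2, xs ! 4]"
    using len dx by (auto simp: nth_eq_iff_index_eq)
  from triangle_count_switch[OF regular_graphsD(1)[OF E] this] show ?thesis
    using e by (simp add: triangle_gain_def close_path_def insert_commute)
qed

text \<open>The cycle bound 4 k d^(k - 2) is 12 d for k = 3, and the labelled count is six times the
  number of triangles.\<close>

lemma triangle_gain_le:
  assumes E: "E \<in> regular_graphs n d" and xs: "xs \<in> open_emb n 3 E"
  shows "\<bar>triangle_gain n E xs\<bar> \<le> 2 * real d"
  using cnt_cycle_switch[OF E _ xs] by (simp add: cnt_cycle_3 triangle_gain_def)

section \<open>Codegree sums over the switchings of a path\<close>

context sparse_degrees
begin

lemma small_loop: "(i, i) \<in> P \<Longrightarrow> small r (\<lambda>n. cnt n k P N)"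
  by (rule small_dominated[OF small_const[of "\<lambda>_. 0"]])
     (auto intro!: always_eventually simp: cnt_loop[OF regular_graphsD(1)])

text \<open>A further edge on the five vertices of the path gives five edges on five vertices, hence
  O(d^5) = O(n d^3). This disposes of common neighbours that lie on the path only by virtue of an
  extra edge.\<close>

lemma small_new_edge:
  assumes "j < i" "i < 5" "(i, j) \<notin> cherry_pat" "cherry_pat \<subseteq> Q" "(i, j) \<in> Q \<or> (j, i) \<in> Q"
  shows "small (\<lambda>n. real n * D n ^ 3) (\<lambda>n. cnt n 5 Q N)"
proof -
  have "small (\<lambda>n. D n ^ 5) (\<lambda>n. cnt n 5 (insert (i, j) cherry_pat) {})"
    by (rule small_cnt_balanced) (use assms in \<open>auto simp: card_insert_if\<close>)
  then have "small (\<lambda>n. real n * D n ^ 3) (\<lambda>n. cnt n 5 (insert (i, j) cherry_pat) {})"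
    by (rule small_rate) (use D_power_bigo_n[of 3] in simp)
  then show ?thesis
  proof (rule small_dominated, intro always_eventually allI ballI)
    fix n E
    have "cnt n 5 Q N E \<le> cnt n 5 (insert (i, j) cherry_pat) {} E"
      using assms(4,5) by (intro cnt_mono) blast+
    then show "\<bar>cnt n 5 Q N E\<bar> \<le> \<bar>cnt n 5 (insert (i, j) cherry_pat) {} E\<bar>"
      by simp
  qed
qed

text \<open>By inclusion-exclusion a forbidden pair costs a count with seven edges on six vertices,
  which is O(d^5) and hence O(n d^3).\<close>

lemma small_drop_nonedges:
  assumes Q: "Q \<subseteq> {(i, j). j < i \<and> i < 6}" "card Q = 6" "(2, 0) \<notin> Q" "(4, 3) \<notin> Q"
    and a: "small (\<lambda>n. D n ^ 5) (\<lambda>n E. cnt n 6 Q {} E - D n ^ 6)"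
  shows "small (\<lambda>n. real n * D n ^ 3) (\<lambda>n E. cnt n 6 Q {(2, 0), (4, 3)} E - D n ^ 6)"
proof -
  have finQ: "finite Q" using Q(2) by (metis card.infinite numeral_eq_iff zero_neq_numeral)
  have 1: "small (\<lambda>n. D n ^ 5) (\<lambda>n. cnt n 6 (insert ij Q) {})" if "ij = (2, 0) \<or> ij = (4, 3)" for ij
    using small_cnt_chord[of "insert ij Q" 5 "{}"] Q finQ that by (auto simp: card_insert_if)
  have 2: "small (\<lambda>n. D n ^ 5) (\<lambda>n. cnt n 6 (insert (2, 0) (insert (4, 3) Q)) {})"
    by (rule small_dominated[OF 1[of "(2, 0)"]], simp, intro always_eventually allI ballI) (auto intro!: cnt_mono)
  have "small (\<lambda>n. D n ^ 5) (\<lambda>n E. cnt n 6 Q {} E - D n ^ 6 - cnt n 6 (insert (2, 0) Q) {} E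
      - cnt n 6 (insert (4, 3) Q) {} E + cnt n 6 (insert (2, 0) (insert (4, 3) Q)) {} E)"
    by (rule small_add[OF small_diff[OF small_diff[OF a 1] 1] 2]) auto
  then have "small (\<lambda>n. D n ^ 5) (\<lambda>n E. cnt n 6 Q {(2, 0), (4, 3)} E - D n ^ 6)"
    by (simp add: cnt_insert_nonedge insert_commute algebra_simps)
  then show ?thesis
    by (rule small_rate) (use D_power_bigo_n[of 3] in simp)
qed

text \<open>The sixth vertex closes the square 0, 1, 2, 5, and 3 and 4 hang on its corners 0 and 2.
  The concentration of the 4-cycle count supplies d^4, the pendant edges d^2.\<close>

lemma small_square_two_pendants:
  "small (\<lambda>n. D n ^ 5) (\<lambda>n E. cnt n 6 (cherry_pat \<union> {(5, 0), (5, 2)}) {} E - D n ^ 6)"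
proof -
  define F where "F n E = cnt n 6 (insert (5, 2) (insert (4, 0) (cyc_pat 4))) {} E - D n ^ 2 * cyc 4 n E" for n E
  have sub: "cyc_pat 4 \<subseteq> {..<4} \<times> {..<4}" by (auto simp: cyc_pat_small)
  have "small (\<lambda>n. D n ^ (4 + 1)) (\<lambda>n E. 9 * D n ^ 1 * cyc 4 n E)"
    by (rule small_scale_D[OF small_cyc]) auto
  then have "small (\<lambda>n. D n ^ (4 + 1)) F"
  proof (rule small_dominated, intro always_eventually allI ballI)
    fix n E assume "E \<in> R n"
    from cnt_two_pendants_bounds[OF this sub, of 0 2] show "\<bar>F n E\<bar> \<le> \<bar>9 * D n ^ 1 * cyc 4 n E\<bar>"
      by (simp add: F_def)
  qed
  moreover have "small (\<lambda>n. D n ^ (3 + 2)) (\<lambda>n E. 1 * D n ^ 2 * (cyc 4 n E - D n ^ 4))"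
    using small_cyc_deviation[of 4] by (intro small_scale_D) simp
  ultimately have "small (\<lambda>n. D n ^ 5) (\<lambda>n E. F n E + 1 * D n ^ 2 * (cyc 4 n E - D n ^ 4))"
    by (intro small_add) simp_all
  moreover have "cnt n 6 (cherry_pat \<union> {(5, 0), (5, 2)}) {} E = cnt n 6 (insert (5, 2) (insert (4, 0) (cyc_pat 4))) {} E" for n E
  proof -
    have "cnt n 6 (insert (5, 2) (insert (4, 0) (cyc_pat 4))) {} E =
      cnt n 6 ((\<lambda>(i, j). ([0, 1, 2, 5, 3, 4] ! i, [0, 1, 2, 5, 3, 4] ! j)) ` insert (5, 2) (insert (4, 0) (cyc_pat 4))) {} E"
      by (rule cnt_relabel) (auto simp: cyc_pat_small)
    also have "\<dots> = cnt n 6 (cherry_pat \<union> {(5, 0), (5, 2)}) {} E"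
      by (rule cnt_cong) (auto simp: cyc_pat_small)
    finally show ?thesis by simp
  qed
  ultimately show ?thesis
    by (simp add: F_def algebra_simps)
qed

lemma small_hexagon:
  "small (\<lambda>n. D n ^ 5) (\<lambda>n E. cnt n 6 (cherry_pat \<union> {(5, 3), (5, 4)}) {} E - D n ^ 6)"
proof -
  have "cnt n 6 (cherry_pat \<union> {(5, 3), (5, 4)}) {} E = cyc 6 n E" for n E
  proof -
    have "cyc 6 n E = cnt n 6 ((\<lambda>(i, j). ([3, 0, 1, 2, 4, 5] ! i, [3, 0, 1, 2, 4, 5] ! j)) ` cyc_pat 6) {} E"
      by (rule cnt_relabel) (auto simp: cyc_pat_small)
    also have "\<dots> = cnt n 6 (cherry_pat \<union> {(5, 3), (5, 4)}) {} E"
      by (rule cnt_cong) (auto simp: cyc_pat_small)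
    finally show ?thesis by simp
  qed
  then show ?thesis
    using small_cyc_deviation[of 6] by simp
qed

text \<open>The triangle 0, 1, 2 with the tail 0-3-4-5. Of the constant 12, the first two tail edges
  contribute 7 and the third contributes 5.\<close>

lemma small_triangle_tail:
  "small (\<lambda>n. D n ^ 5) (\<lambda>n E. cnt n 6 (insert (5, 4) (insert (4, 3) (insert (3, 0) (cyc_pat 3)))) {} E - D n ^ 6)"
proof -
  define F where "F n E = cnt n 6 (insert (5, 4) (insert (4, 3) (insert (3, 0) (cyc_pat 3)))) {} E - D n ^ 3 * cyc 3 n E" for n E
  have sub: "cyc_pat 3 \<subseteq> {..<3} \<times> {..<3}" by (auto simp: cyc_pat_small)
  have "small (\<lambda>n. D n ^ (3 + 2)) (\<lambda>n E. 12 * D n ^ 2 * cyc 3 n E)"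
    by (rule small_scale_D[OF small_cyc]) auto
  then have "small (\<lambda>n. D n ^ (3 + 2)) F"
  proof (rule small_dominated, intro always_eventually allI ballI)
    fix n E assume E: "E \<in> R n"
    define X Y Z where "X = cyc 3 n E" "Y = cnt n 5 (insert (4, 3) (insert (3, 0) (cyc_pat 3))) {} E"
      "Z = cnt n 6 (insert (5, 4) (insert (4, 3) (insert (3, 0) (cyc_pat 3)))) {} E"
    note XYZ = X_Y_Z_def
    have Y: "\<bar>Y - D n ^ 2 * X\<bar> \<le> 7 * D n * X"
      using cnt_two_pendants_bounds[OF E sub, of 0 3] by (simp add: XYZ)
    have sub3: "insert (3, 0) (cyc_pat 3) \<subseteq> {..<4} \<times> {..<4}" using sub by auto
    have "Y \<le> D n * cnt n 4 (insert (3, 0) (cyc_pat 3)) {} E"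
      using cnt_pendant_bounds(1)[OF E _ sub3, of 3 "{}"] by (simp add: XYZ)
    also have "\<dots> \<le> D n * (D n * X)"
      using cnt_pendant_bounds(1)[OF E _ sub, of 0 "{}"] by (intro mult_left_mono) (simp_all add: XYZ)
    finally have Y': "Y \<le> D n ^ 2 * X" by (simp add: power2_eq_square)
    have sub4: "insert (4, 3) (insert (3, 0) (cyc_pat 3)) \<subseteq> {..<5} \<times> {..<5}" using sub by auto
    have Z: "\<bar>Z - D n * Y\<bar> \<le> 5 * Y"
      using cnt_pendant_bounds(2)[OF E _ sub4, of 4 "{}"] by (simp add: XYZ)
    have "\<bar>Z - D n ^ 3 * X\<bar> \<le> \<bar>Z - D n * Y\<bar> + \<bar>D n * (Y - D n ^ 2 * X)\<bar>"
      by (simp add: algebra_simps power2_eq_square power3_eq_cube)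
    also have "\<dots> \<le> 5 * (D n ^ 2 * X) + D n * (7 * D n * X)"
      using Z Y' mult_left_mono[OF Y, of "D n"] by (simp add: abs_mult)
    also have "\<dots> = 12 * D n ^ 2 * X"
      by (simp add: power2_eq_square)
    finally show "\<bar>F n E\<bar> \<le> \<bar>12 * D n ^ 2 * cyc 3 n E\<bar>"
      by (simp add: F_def XYZ)
  qed
  moreover have "small (\<lambda>n. D n ^ (2 + 3)) (\<lambda>n E. 1 * D n ^ 3 * (cyc 3 n E - D n ^ 3))"
    using small_cyc_deviation[of 3] by (intro small_scale_D) simp
  ultimately have "small (\<lambda>n. D n ^ 5) (\<lambda>n E. F n E + 1 * D n ^ 3 * (cyc 3 n E - D n ^ 3))"
    by (intro small_add) simp_all
  then show ?thesis
    by (simp add: F_def algebra_simps)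
qed

text \<open>The sixth vertex forms a triangle with an end edge of the path, and the other three path
  edges become its tail. The two cases are mirror images.\<close>

lemma small_triangle_tails:
  "small (\<lambda>n. D n ^ 5) (\<lambda>n E. cnt n 6 (cherry_pat \<union> {(5, 0), (5, 3)}) {} E - D n ^ 6)"
  "small (\<lambda>n. D n ^ 5) (\<lambda>n E. cnt n 6 (cherry_pat \<union> {(5, 2), (5, 4)}) {} E - D n ^ 6)"
proof -
  define Q where "Q = insert (5, 4) (insert (4, 3) (insert (3, 0) (cyc_pat 3)))"
  have Q: "small (\<lambda>n. D n ^ 5) (\<lambda>n E. cnt n 6 Q {} E - D n ^ 6)"
    using small_triangle_tail by (simp add: Q_def)
  have "cnt n 6 (cherry_pat \<union> {(5, 0), (5, 3)}) {} E = cnt n 6 Q {} E" for n E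
  proof -
    have "cnt n 6 Q {} E = cnt n 6 ((\<lambda>(i, j). ([0, 3, 5, 1, 2, 4] ! i, [0, 3, 5, 1, 2, 4] ! j)) ` Q) {} E"
      by (rule cnt_relabel) (auto simp: cyc_pat_small Q_def)
    also have "\<dots> = cnt n 6 (cherry_pat \<union> {(5, 0), (5, 3)}) {} E"
      by (rule cnt_cong) (auto simp: cyc_pat_small Q_def)
    finally show ?thesis by simp
  qed
  then show "small (\<lambda>n. D n ^ 5) (\<lambda>n E. cnt n 6 (cherry_pat \<union> {(5, 0), (5, 3)}) {} E - D n ^ 6)"
    using Q by simp
  have "cnt n 6 (cherry_pat \<union> {(5, 2), (5, 4)}) {} E = cnt n 6 Q {} E" for n E
  proof -
    have "cnt n 6 Q {} E = cnt n 6 ((\<lambda>(i, j). ([2, 4, 5, 1, 0, 3] ! i, [2, 4, 5, 1, 0, 3] ! j)) ` Q) {} E"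
      by (rule cnt_relabel) (auto simp: cyc_pat_small Q_def)
    also have "\<dots> = cnt n 6 (cherry_pat \<union> {(5, 2), (5, 4)}) {} E"
      by (rule cnt_cong) (auto simp: cyc_pat_small Q_def)
    finally show ?thesis by simp
  qed
  then show "small (\<lambda>n. D n ^ 5) (\<lambda>n E. cnt n 6 (cherry_pat \<union> {(5, 2), (5, 4)}) {} E - D n ^ 6)"
    using Q by simp
qed

lemma sum_lessThan_5: "(\<Sum>l<(5::nat). f l) = f 0 + f 1 + f 2 + f 3 + (f 4 :: real)"
  by (simp add: eval_nat_numeral)

text \<open>Vertex 1 is a common neighbour of 0 and 2 in every embedding and yields the main term n
  d^4; a sixth vertex yields d^6. Positions 0 and 2 would be loops, and 3 and 4 would require an
  extra edge.\<close>

lemma small_codegree_sum_closing: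
  "small (\<lambda>n. real n * D n ^ 3)
    (\<lambda>n E. (\<Sum>xs\<in>open_emb n 3 E. real (codegree n E (xs ! 0) (xs ! 2))) - (real n * D n ^ 4 + D n ^ 6))"
proof -
  let ?N = "{(2, 0), (4, 3)} :: (nat \<times> nat) set"
  let ?Q = "\<lambda>l. cherry_pat \<union> {(l, 0), (l, 2)} :: (nat \<times> nat) set"
  have 0: "small (\<lambda>n. real n * D n ^ 3) (\<lambda>n. cnt n 5 (?Q 0) ?N)"
    and 2: "small (\<lambda>n. real n * D n ^ 3) (\<lambda>n. cnt n 5 (?Q 2) ?N)"
    by (rule small_loop, blast)+
  have 3: "small (\<lambda>n. real n * D n ^ 3) (\<lambda>n. cnt n 5 (?Q 3) ?N)"
    by (rule small_new_edge[of 2 3]) auto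
  have 4: "small (\<lambda>n. real n * D n ^ 3) (\<lambda>n. cnt n 5 (?Q 4) ?N)"
    by (rule small_new_edge[of 0 4]) auto
  have 1: "cnt n 5 (?Q 1) ?N E = real (card (open_emb n 3 E))" for n E
    unfolding open_emb_3 cnt_def[symmetric] by (rule cnt_cong) auto
  have 5: "small (\<lambda>n. real n * D n ^ 3) (\<lambda>n E. cnt n 6 (cherry_pat \<union> {(5, 0), (5, 2)}) ?N E - D n ^ 6)"
    by (rule small_drop_nonedges[OF _ _ _ _ small_square_two_pendants]) auto
  have "small (\<lambda>n. real n * D n ^ 3) (\<lambda>n E. real (card (open_emb n 3 E)) - real n * D n ^ 4)"
    using small_open_emb[of 3] by simp
  from small_add[OF small_add[OF small_add[OF small_add[OF small_add[OF 0 2] 3] 4] this] 5]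
  show ?thesis
    by (simp only: sum_codegree sum_lessThan_5 1) (simp add: algebra_simps)
qed

text \<open>The ends 3 and 4 have no common neighbour along the path, so only the hexagons through a
  sixth vertex remain.\<close>

lemma small_codegree_sum_opposite:
  "small (\<lambda>n. real n * D n ^ 3)
    (\<lambda>n E. (\<Sum>xs\<in>open_emb n 3 E. real (codegree n E (xs ! 3) (xs ! 4))) - D n ^ 6)"
proof -
  let ?N = "{(2, 0), (4, 3)} :: (nat \<times> nat) set"
  let ?Q = "\<lambda>l. cherry_pat \<union> {(l, 3), (l, 4)} :: (nat \<times> nat) set"
  have 3: "small (\<lambda>n. real n * D n ^ 3) (\<lambda>n. cnt n 5 (?Q 3) ?N)"
    and 4: "small (\<lambda>n. real n * D n ^ 3) (\<lambda>n. cnt n 5 (?Q 4) ?N)"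
    by (rule small_loop, blast)+
  have 0: "small (\<lambda>n. real n * D n ^ 3) (\<lambda>n. cnt n 5 (?Q 0) ?N)"
    by (rule small_new_edge[of 0 4]) auto
  have 1: "small (\<lambda>n. real n * D n ^ 3) (\<lambda>n. cnt n 5 (?Q 1) ?N)"
    by (rule small_new_edge[of 1 3]) auto
  have 2: "small (\<lambda>n. real n * D n ^ 3) (\<lambda>n. cnt n 5 (?Q 2) ?N)"
    by (rule small_new_edge[of 2 3]) auto
  have 5: "small (\<lambda>n. real n * D n ^ 3) (\<lambda>n E. cnt n 6 (cherry_pat \<union> {(5, 3), (5, 4)}) ?N E - D n ^ 6)"
    by (rule small_drop_nonedges[OF _ _ _ _ small_hexagon]) auto
  from small_add[OF small_add[OF small_add[OF small_add[OF small_add[OF 0 1] 2] 3] 4] 5]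
  show ?thesis
    by (simp only: sum_codegree sum_lessThan_5) (simp add: algebra_simps)
qed

text \<open>These are the triangles on the removed edge 3-0; with the rest of the path as a tail
  they again number about d^6.\<close>

lemma small_codegree_sum_left:
  "small (\<lambda>n. real n * D n ^ 3)
    (\<lambda>n E. (\<Sum>xs\<in>open_emb n 3 E. real (codegree n E (xs ! 0) (xs ! 3))) - D n ^ 6)"
proof -
  let ?N = "{(2, 0), (4, 3)} :: (nat \<times> nat) set"
  let ?Q = "\<lambda>l. cherry_pat \<union> {(l, 0), (l, 3)} :: (nat \<times> nat) set"
  have 0: "small (\<lambda>n. real n * D n ^ 3) (\<lambda>n. cnt n 5 (?Q 0) ?N)"
    and 3: "small (\<lambda>n. real n * D n ^ 3) (\<lambda>n. cnt n 5 (?Q 3) ?N)"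
    by (rule small_loop, blast)+
  have 1: "small (\<lambda>n. real n * D n ^ 3) (\<lambda>n. cnt n 5 (?Q 1) ?N)"
    by (rule small_new_edge[of 1 3]) auto
  have 2: "small (\<lambda>n. real n * D n ^ 3) (\<lambda>n. cnt n 5 (?Q 2) ?N)"
    by (rule small_new_edge[of 2 3]) auto
  have 4: "small (\<lambda>n. real n * D n ^ 3) (\<lambda>n. cnt n 5 (?Q 4) ?N)"
    by (rule small_new_edge[of 0 4]) auto
  have 5: "small (\<lambda>n. real n * D n ^ 3) (\<lambda>n E. cnt n 6 (cherry_pat \<union> {(5, 0), (5, 3)}) ?N E - D n ^ 6)"
    by (rule small_drop_nonedges[OF _ _ _ _ small_triangle_tails(1)]) auto
  from small_add[OF small_add[OF small_add[OF small_add[OF small_add[OF 0 1] 2] 3] 4] 5]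
  show ?thesis
    by (simp only: sum_codegree sum_lessThan_5) (simp add: algebra_simps)
qed

lemma small_codegree_sum_right:
  "small (\<lambda>n. real n * D n ^ 3)
    (\<lambda>n E. (\<Sum>xs\<in>open_emb n 3 E. real (codegree n E (xs ! 2) (xs ! 4))) - D n ^ 6)"
proof -
  let ?N = "{(2, 0), (4, 3)} :: (nat \<times> nat) set"
  let ?Q = "\<lambda>l. cherry_pat \<union> {(l, 2), (l, 4)} :: (nat \<times> nat) set"
  have 2: "small (\<lambda>n. real n * D n ^ 3) (\<lambda>n. cnt n 5 (?Q 2) ?N)"
    and 4: "small (\<lambda>n. real n * D n ^ 3) (\<lambda>n. cnt n 5 (?Q 4) ?N)"
    by (rule small_loop, blast)+
  have 0: "small (\<lambda>n. real n * D n ^ 3) (\<lambda>n. cnt n 5 (?Q 0) ?N)"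
    by (rule small_new_edge[of 0 4]) auto
  have 1: "small (\<lambda>n. real n * D n ^ 3) (\<lambda>n. cnt n 5 (?Q 1) ?N)"
    by (rule small_new_edge[of 1 4]) auto
  have 3: "small (\<lambda>n. real n * D n ^ 3) (\<lambda>n. cnt n 5 (?Q 3) ?N)"
    by (rule small_new_edge[of 2 3]) auto
  have 5: "small (\<lambda>n. real n * D n ^ 3) (\<lambda>n E. cnt n 6 (cherry_pat \<union> {(5, 2), (5, 4)}) ?N E - D n ^ 6)"
    by (rule small_drop_nonedges[OF _ _ _ _ small_triangle_tails(2)]) auto
  from small_add[OF small_add[OF small_add[OF small_add[OF small_add[OF 0 1] 2] 3] 4] 5]
  show ?thesis
    by (simp only: sum_codegree sum_lessThan_5) (simp add: algebra_simps)
qed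

lemma small_cross_edges:
  "small (\<lambda>n. real n * D n ^ 3) (\<lambda>n E. \<Sum>xs\<in>open_emb n 3 E. of_bool ({xs ! 3, xs ! 2} \<in> E))"
  "small (\<lambda>n. real n * D n ^ 3) (\<lambda>n E. \<Sum>xs\<in>open_emb n 3 E. of_bool ({xs ! 0, xs ! 4} \<in> E))"
  unfolding sum_of_bool_edge
  by (rule small_new_edge[of 2 3]; auto) (rule small_new_edge[of 0 4]; auto)

abbreviation gain :: "nat \<Rightarrow> nat set set \<Rightarrow> nat list \<Rightarrow> real" where
  "gain n E xs \<equiv> triangle_gain n E xs"

text \<open>Besides the intended triangle, a switching creates triangles through 4-cycles and 6-cycles and
  destroys those on the two removed edges. Each of these four sums is about \<open>d^6\<close>, which may be as
  large as the main term \<open>n d^4\<close>, but they cancel.\<close>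

lemma small_gain_sum:
  "small (\<lambda>n. real n * D n ^ 3) (\<lambda>n E. (\<Sum>xs\<in>open_emb n 3 E. gain n E xs) - real n * D n ^ 4)"
proof -
  have s: "small (\<lambda>n. real n * D n ^ 3) (\<lambda>n E. 2 * F n E)" if "small (\<lambda>n. real n * D n ^ 3) F" for F
    using small_add[OF that that] by (simp only: mult_2)
  show ?thesis
    by (rule small_dominated[OF small_diff[OF small_diff[OF small_diff[OF small_diff[OF
      small_add[OF small_codegree_sum_closing small_codegree_sum_opposite]
      small_codegree_sum_left] small_codegree_sum_right]
      s[OF small_cross_edges(1)]] s[OF small_cross_edges(2)]]],
      intro always_eventually allI ballI)
     (simp add: triangle_gain_eq sum.distrib sum_subtractf sum_distrib_left cong: sum.cong)
qed

text \<open>In absolute value the d^6 terms no longer cancel, but d^6 = O(n d^4) suffices for the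
  quadratic remainder.\<close>

lemma small_gain_abs_sum:
  "small (\<lambda>n. real n * D n ^ 4) (\<lambda>n E. \<Sum>xs\<in>open_emb n 3 E. \<bar>gain n E xs\<bar>)"
proof -
  have r3: "(\<lambda>n. real n * D n ^ 3) \<in> O(\<lambda>n. real n * D n ^ 4)"
    by (intro landau_o.big.mult_left D_power_mono) simp
  have r6: "(\<lambda>n. D n ^ 6) \<in> O(\<lambda>n. real n * D n ^ 4)"
    using D_power_bigo_n[of 4] by simp
  have c: "small (\<lambda>n. real n * D n ^ 4) F"
    if "small (\<lambda>n. real n * D n ^ 3) (\<lambda>n E. F n E - c n)" "c \<in> O(\<lambda>n. real n * D n ^ 4)" for F c
    using small_add[OF small_rate[OF that(1) r3] small_const[OF that(2)]] by simp
  have s: "small (\<lambda>n. real n * D n ^ 4) (\<lambda>n E. 2 * F n E)" if "small (\<lambda>n. real n * D n ^ 3) F" for F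
    using small_rate[OF small_add[OF that that] r3] by (simp only: mult_2)
  have r: "(\<lambda>n. real n * D n ^ 4 + D n ^ 6) \<in> O(\<lambda>n. real n * D n ^ 4)"
    by (intro sum_in_bigo r6) simp
  define G where "G n E = (\<Sum>xs\<in>open_emb n 3 E. real (codegree n E (xs ! 0) (xs ! 2)))
      + (\<Sum>xs\<in>open_emb n 3 E. real (codegree n E (xs ! 3) (xs ! 4)))
      + (\<Sum>xs\<in>open_emb n 3 E. real (codegree n E (xs ! 0) (xs ! 3)))
      + (\<Sum>xs\<in>open_emb n 3 E. real (codegree n E (xs ! 2) (xs ! 4)))
      + 2 * (\<Sum>xs\<in>open_emb n 3 E. of_bool ({xs ! 3, xs ! 2} \<in> E))
      + 2 * (\<Sum>xs\<in>open_emb n 3 E. of_bool ({xs ! 0, xs ! 4} \<in> E))" for n E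
  have "small (\<lambda>n. real n * D n ^ 4) G"
    unfolding G_def
    by (rule small_add[OF small_add[OF small_add[OF small_add[OF small_add[OF
      c[OF small_codegree_sum_closing r] c[OF small_codegree_sum_opposite r6]]
      c[OF small_codegree_sum_left r6]] c[OF small_codegree_sum_right r6]]
      s[OF small_cross_edges(1)]] s[OF small_cross_edges(2)]])
  then show ?thesis
  proof (rule small_dominated, intro always_eventually allI ballI)
    fix n E assume E: "E \<in> R n"
    have "(\<Sum>xs\<in>open_emb n 3 E. \<bar>gain n E xs\<bar>) \<le>
       (\<Sum>xs\<in>open_emb n 3 E. real (codegree n E (xs ! 0) (xs ! 2)) + real (codegree n E (xs ! 3) (xs ! 4))
         + real (codegree n E (xs ! 0) (xs ! 3)) + real (codegree n E (xs ! 2) (xs ! 4))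
         + 2 * of_bool ({xs ! 3, xs ! 2} \<in> E) + 2 * of_bool ({xs ! 0, xs ! 4} \<in> E))"
    proof (rule sum_mono)
      have bound: "\<bar>a + b - c - e - 2 * x - 2 * y\<bar> \<le> a + b + c + e + 2 * x + 2 * y"
        if "a \<ge> 0" "b \<ge> 0" "c \<ge> 0" "e \<ge> 0" "x \<ge> 0" "y \<ge> 0" for a b c e x y :: real
        using that by linarith
      fix xs assume "xs \<in> open_emb n 3 E"
      then show "\<bar>gain n E xs\<bar> \<le> real (codegree n E (xs ! 0) (xs ! 2)) + real (codegree n E (xs ! 3) (xs ! 4))
         + real (codegree n E (xs ! 0) (xs ! 3)) + real (codegree n E (xs ! 2) (xs ! 4))
         + 2 * of_bool ({xs ! 3, xs ! 2} \<in> E) + 2 * of_bool ({xs ! 0, xs ! 4} \<in> E)"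
        unfolding triangle_gain_eq[OF E \<open>xs \<in> open_emb n 3 E\<close>] by (intro bound) auto
    qed
    also have "\<dots> = G n E"
      by (simp add: G_def sum.distrib sum_distrib_left)
    finally show "\<bar>\<Sum>xs\<in>open_emb n 3 E. \<bar>gain n E xs\<bar>\<bar> \<le> \<bar>G n E\<bar>"
      by (simp add: sum_nonneg)
  qed
qed

text \<open>The error n d^3 of \<open>cnt_open_pat_approx\<close> would be too coarse for the drift.
  Running the exact recurrence \<open>cnt_pendant\<close> along the path leaves only d times the
  triangles, the triangles with one pendant edge and the squares, each O(d^4) in mean.\<close>

lemma small_path_5:
  "small (\<lambda>n. D n ^ 4) (\<lambda>n E. cnt n 5 cherry_pat {} E - real n * D n * (D n - 1) ^ 3)"
proof -
  define y where "y n E = cnt n 4 (insert (2, 0) (insert (3, 0) (path_pat 3))) {} E" for n E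
  define z where "z n E = cnt n 4 (insert (3, 2) (insert (3, 0) (path_pat 3))) {} E" for n E
  have y: "small (\<lambda>n. D n ^ 4) y" and z: "small (\<lambda>n. D n ^ 4) z"
    unfolding y_def[abs_def] z_def[abs_def] by (rule small_cnt_balanced; auto simp: path_pat_small)+
  have "small (\<lambda>n. D n ^ (3 + 1)) (\<lambda>n E. 1 * D n ^ 1 * cyc 3 n E)"
    by (rule small_scale_D[OF small_cyc]) auto
  then have x: "small (\<lambda>n. D n ^ 4) (\<lambda>n E. D n * cyc 3 n E)" by simp
  have "small (\<lambda>n. D n ^ 4) (\<lambda>n E. D n * cyc 3 n E + y n E + z n E)"
    by (rule small_add[OF small_add[OF x y] z])
  then show ?thesis
  proof (rule small_dominated)
    show "eventually (\<lambda>n. \<forall>E\<in>R n. \<bar>cnt n 5 cherry_pat {} E - real n * D n * (D n - 1) ^ 3\<bar>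
        \<le> \<bar>D n * cyc 3 n E + y n E + z n E\<bar>) sequentially"
      using eventually_D_ge[of 1]
    proof (eventually_elim, intro ballI)
      fix n E assume D1: "D n \<ge> 1" and E: "E \<in> R n"
      have loop: "cnt n k P {} E = 0" if "(i, i) \<in> P" for k i P
        by (rule cnt_loop[OF regular_graphsD(1)[OF E] that])
      have c2: "cnt n 2 {(1, 0)} {} E = D n * real n"
        using cnt_pendant[OF E, of 0 1 "{}" "{}"] by (simp add: cnt_vertex[simplified] loop numeral_2_eq_2)
      have flip2: "cnt n 2 (insert (0, 1) {(1, 0)}) {} E = cnt n 2 {(1, 0)} {} E"
        by (rule cnt_cong) auto
      have c3: "cnt n 3 (path_pat 3) {} E = (D n - 1) * (D n * real n)"
      proof -
        have "cnt n 3 (insert (2, 1) {(1, 0)}) {} E = D n * cnt n 2 {(1, 0)} {} E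
            - (\<Sum>j<2. cnt n 2 (insert (j, 1) {(1, 0)}) {} E)"
          using cnt_pendant[OF E, of 1 2 "{(1, 0)}" "{}"] by simp
        also have "(\<Sum>j<2. cnt n 2 (insert (j, 1) {(1, 0)}) {} E)
            = cnt n 2 (insert (0, 1) {(1, 0)}) {} E + cnt n 2 (insert (1, 1) {(1, 0)}) {} E"
          by (simp add: eval_nat_numeral)
        also have "cnt n 2 (insert (1, 1) {(1, 0)}) {} E = 0"
          by (rule loop[of 1]) simp
        finally show ?thesis
          unfolding path_pat_small flip2 c2 by (simp add: algebra_simps)
      qed
      have "cnt n 4 (insert (3, 0) (path_pat 3)) {} E = D n * cnt n 3 (path_pat 3) {} E
          - (\<Sum>j<3. cnt n 3 (insert (j, 0) (path_pat 3)) {} E)"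
        using cnt_pendant[OF E, of 0 3 "path_pat 3" "{}"] path_pat_subset_square by simp
      also have "(\<Sum>j<3. cnt n 3 (insert (j, 0) (path_pat 3)) {} E) = cnt n 3 (path_pat 3) {} E + cyc 3 n E"
      proof -
        have "(\<Sum>j<3. cnt n 3 (insert (j, 0) (path_pat 3)) {} E) =
            cnt n 3 (insert (0, 0) (path_pat 3)) {} E + cnt n 3 (insert (1, 0) (path_pat 3)) {} E
            + cnt n 3 (insert (2, 0) (path_pat 3)) {} E"
          by (simp add: eval_nat_numeral)
        moreover have "insert (1, 0) (path_pat 3) = path_pat 3" by auto
        moreover have "insert (2, 0) (path_pat 3) = cyc_pat 3" by (simp add: cyc_pat_def)
        ultimately show ?thesis using loop[of 0 "insert (0, 0) (path_pat 3)" 3] by simp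
      qed
      finally have c4: "cnt n 4 (insert (3, 0) (path_pat 3)) {} E = (D n - 1) * ((D n - 1) * (D n * real n)) - cyc 3 n E"
        by (simp add: c3 algebra_simps)
      have sub: "insert (3, 0) (path_pat 3) \<subseteq> {..<4} \<times> {..<4}" by auto
      have "cnt n 5 (insert (4, 2) (insert (3, 0) (path_pat 3))) {} E = D n * cnt n 4 (insert (3, 0) (path_pat 3)) {} E
          - (\<Sum>j<4. cnt n 4 (insert (j, 2) (insert (3, 0) (path_pat 3))) {} E)"
        using cnt_pendant[OF E _ sub, of 2 "{}"] by simp
      also have "(\<Sum>j<4. cnt n 4 (insert (j, 2) (insert (3, 0) (path_pat 3))) {} E)
          = y n E + cnt n 4 (insert (3, 0) (path_pat 3)) {} E + z n E"
      proof -
        have "(\<Sum>j<4. cnt n 4 (insert (j, 2) (insert (3, 0) (path_pat 3))) {} E) =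
            cnt n 4 (insert (0, 2) (insert (3, 0) (path_pat 3))) {} E
            + cnt n 4 (insert (1, 2) (insert (3, 0) (path_pat 3))) {} E
            + cnt n 4 (insert (2, 2) (insert (3, 0) (path_pat 3))) {} E
            + cnt n 4 (insert (3, 2) (insert (3, 0) (path_pat 3))) {} E"
          by (simp add: eval_nat_numeral)
        moreover have "cnt n 4 (insert (0, 2) (insert (3, 0) (path_pat 3))) {} E = y n E"
          unfolding y_def by (rule cnt_cong) auto
        moreover have "cnt n 4 (insert (1, 2) (insert (3, 0) (path_pat 3))) {} E = cnt n 4 (insert (3, 0) (path_pat 3)) {} E"
          by (rule cnt_cong) auto
        ultimately show ?thesis
          using loop[of 2 "insert (2, 2) (insert (3, 0) (path_pat 3))" 4] by (simp add: z_def)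
      qed
      also have "insert (4, 2) (insert (3, 0) (path_pat 3)) = cherry_pat"
        using open_pat_3 by simp
      finally have c5: "cnt n 5 cherry_pat {} E - real n * D n * (D n - 1) ^ 3 = - ((D n - 1) * cyc 3 n E + y n E + z n E)"
        by (simp add: c4 power3_eq_cube algebra_simps)
      have "0 \<le> (D n - 1) * cyc 3 n E" "(D n - 1) * cyc 3 n E \<le> D n * cyc 3 n E" "0 \<le> y n E" "0 \<le> z n E"
        using D1 by (auto simp: y_def z_def intro!: mult_right_mono)
      then show "\<bar>cnt n 5 cherry_pat {} E - real n * D n * (D n - 1) ^ 3\<bar> \<le> \<bar>D n * cyc 3 n E + y n E + z n E\<bar>"
        unfolding c5 by linarith
    qed
  qed
qed

text \<open>An edge 2-0 would make a triangle with two pendant edges, d^2 copies per triangle, which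
  stays as a term linear in the count. An edge 4-3 would make a pentagon, whose count is replaced by
  d^5 by concentration.\<close>

lemma small_open_emb_3:
  "small (\<lambda>n. D n ^ 4) (\<lambda>n E. real (card (open_emb n 3 E))
    - (real n * D n * (D n - 1) ^ 3 - D n ^ 2 * cyc 3 n E - D n ^ 5))"
proof -
  have sub: "cyc_pat 3 \<subseteq> {..<3} \<times> {..<3}" by (auto simp: cyc_pat_small)
  define F where "F n E = cnt n 5 (insert (2, 0) cherry_pat) {} E - D n ^ 2 * cyc 3 n E" for n E
  have "small (\<lambda>n. D n ^ (3 + 1)) (\<lambda>n E. 7 * D n ^ 1 * cyc 3 n E)"
    by (rule small_scale_D[OF small_cyc]) auto
  then have "small (\<lambda>n. D n ^ (3 + 1)) F"
  proof (rule small_dominated, intro always_eventually allI ballI)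
    fix n E assume E: "E \<in> R n"
    have "insert (2, 0) cherry_pat = insert (4, 2) (insert (3, 0) (cyc_pat 3))"
      by (auto simp: cyc_pat_small)
    then show "\<bar>F n E\<bar> \<le> \<bar>7 * D n ^ 1 * cyc 3 n E\<bar>"
      using cnt_two_pendants_bounds[OF E sub, of 0 2] by (simp add: F_def)
  qed
  then have F: "small (\<lambda>n. D n ^ 4) F" by simp
  have pent: "cnt n 5 (insert (4, 3) cherry_pat) {} E = cyc 5 n E" for n E
  proof -
    have "cyc 5 n E = cnt n 5 ((\<lambda>(i, j). ([3, 0, 1, 2, 4] ! i, [3, 0, 1, 2, 4] ! j)) ` cyc_pat 5) {} E"
      by (rule cnt_relabel) (auto simp: cyc_pat_small)
    also have "\<dots> = cnt n 5 (insert (4, 3) cherry_pat) {} E"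
      by (rule cnt_cong) (auto simp: cyc_pat_small)
    finally show ?thesis by simp
  qed
  have P: "small (\<lambda>n. D n ^ 4) (\<lambda>n E. cyc 5 n E - D n ^ 5)"
    using small_cyc_deviation[of 5] by simp
  have H: "small (\<lambda>n. D n ^ 4) (\<lambda>n. cnt n 5 (insert (2, 0) (insert (4, 3) cherry_pat)) {})"
    using small_cnt_chord[of "insert (2, 0) (insert (4, 3) cherry_pat)" 4 "{}"] by auto
  have eq: "real (card (open_emb n 3 E)) = cnt n 5 cherry_pat {} E - cnt n 5 (insert (2, 0) cherry_pat) {} E
      - cnt n 5 (insert (4, 3) cherry_pat) {} E + cnt n 5 (insert (2, 0) (insert (4, 3) cherry_pat)) {} E" for n E
    unfolding open_emb_3 cnt_def[symmetric] by (simp add: cnt_insert_nonedge insert_commute)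
  show ?thesis
    unfolding eq pent
    using small_add[OF small_diff[OF small_diff[OF small_path_5 F] P] H]
    by (simp add: F_def algebra_simps)
qed

text \<open>Relative to the restoring factor \<open>6 n d\<close>, an error \<open>O(d^4)\<close> in the drift is \<open>O(d^3 / n)\<close>, hence
  negligible against the standard deviation, which has order \<open>d^(3/2)\<close>.\<close>

lemma small_triangle_drift:
  "small (\<lambda>n. D n ^ 4) (\<lambda>n E. real (card (closed_emb n 3 E)) - real (card (open_emb n 3 E))
    - ((real n * D n - D n ^ 2) * cyc 3 n E - (real n * D n * (D n - 1) ^ 3 - D n ^ 5)))"
  using small_diff[OF _ small_open_emb_3, of "\<lambda>n E. real (card (closed_emb n 3 E)) - (real n * D n - 2 * D n ^ 2) * cyc 3 n E"]
    small_closed_emb[of 3]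
  by (simp add: algebra_simps)

end

section \<open>Existence of regular graphs\<close>

text \<open>The Cayley graph of the integers mod n with the symmetric connection set
  \<open>S\<close>.\<close>

lemma circulant_regular:
  assumes S: "S \<subseteq> {1..<n}" "\<And>x. x \<in> S \<Longrightarrow> n - x \<in> S"
  shows "{{i, j} | i j. i < n \<and> j < n \<and> (j + n - i) mod n \<in> S} \<in> regular_graphs n (card S)"
    (is "?E \<in> _")
proof -
  have ne: "i \<noteq> j" if "(j + n - i) mod n \<in> S" "i < n" "j < n" for i j
    using that S(1) by (cases "i = j") auto
  have sg: "simple_graph_on n ?E"
    using ne by (auto simp: simple_graph_on_def)
  have sym: "(i + n - j) mod n \<in> S" if "(j + n - i) mod n \<in> S" "i < n" "j < n" for i j
  proof -
    have "(i + n - j) mod n = n - (j + n - i) mod n"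
      using ne[OF that] that by (cases "i < j") (auto simp: mod_if le_mod_geq)
    then show ?thesis using S(2)[OF that(1)] by simp
  qed
  have "degree ?E v = card S" if v: "v < n" for v
  proof -
    have nb: "{w. {v, w} \<in> ?E} = {w. w < n \<and> (w + n - v) mod n \<in> S}"
      using v sym by (auto simp: doubleton_eq_iff)
    have "bij_betw (\<lambda>w. (w + n - v) mod n) {w. w < n \<and> (w + n - v) mod n \<in> S} S"
    proof (rule bij_betw_byWitness[where f' = "\<lambda>x. (x + v) mod n"])
      show "\<forall>a\<in>{w. w < n \<and> (w + n - v) mod n \<in> S}. ((a + n - v) mod n + v) mod n = a"
        using v by (auto simp: mod_simps)
      have inv: "((x + v) mod n + n - v) mod n = x" if "x \<in> S" for x
      proof -
        have "x < n" using S(1) that by auto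
        then show ?thesis using v by (cases "x + v < n") (auto simp: mod_if)
      qed
      show "\<forall>a'\<in>S. ((a' + v) mod n + n - v) mod n = a'"
        using inv by blast
      show "(\<lambda>w. (w + n - v) mod n) ` {w. w < n \<and> (w + n - v) mod n \<in> S} \<subseteq> S"
        by auto
      show "(\<lambda>x. (x + v) mod n) ` S \<subseteq> {w. w < n \<and> (w + n - v) mod n \<in> S}"
        using inv v by auto
    qed
    then have "card {w. w < n \<and> (w + n - v) mod n \<in> S} = card S"
      by (rule bij_betw_same_card)
    then show ?thesis
      using card_neighbours_eq_degree[OF sg, of v] nb by simp
  qed
  then show ?thesis
    using sg by (simp add: regular_graphs_def)
qed

text \<open>Nonemptiness gives the uniform distribution its meaning and makes the average of a
  constant equal to that constant.\<close>

lemma regular_graphs_nonempty: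
  assumes "even (d * n)" "d < n"
  shows "regular_graphs n d \<noteq> {}"
proof -
  define h where "h = d div 2"
  \<comment> \<open>The differences from -h to h except 0, and for odd d also n / 2, its own
    negative, which exists because d n is even. From d < n the pieces are disjoint.\<close>
  define S where "S = {1..h} \<union> {n - h..<n} \<union> (if odd d then {n div 2} else {})"
  have h: "2 * h \<le> d" "odd d \<Longrightarrow> d = 2 * h + 1" "even d \<Longrightarrow> d = 2 * h"
    by (auto simp: h_def)
  have n: "odd d \<Longrightarrow> n = 2 * (n div 2)"
    using assms(1) by auto
  have "card ({1..h} \<union> {n - h..<n}) = 2 * h"
    using h assms(2) by (subst card_Un_disjoint) auto
  moreover have "n div 2 \<notin> {1..h} \<union> {n - h..<n}" if "odd d"
    using h(2)[OF that] n[OF that] assms(2) by auto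
  ultimately have "card S = d"
    using h by (auto simp: S_def)
  moreover have "S \<subseteq> {1..<n}"
    using h assms(2) n by (auto simp: S_def)
  moreover have "n - x \<in> S" if "x \<in> S" for x
    using that h assms(2) n by (auto simp: S_def split: if_splits)
  ultimately show ?thesis
    using circulant_regular[of S n] by auto
qed

section \<open>The characteristic function of the triangle count\<close>

text \<open>With the integrating factor exp(t^2 / 2), the function \<open>g\<close> has derivative
  (\<phi>' + t \<phi>) exp(t^2 / 2), so the mean value inequality keeps it near 1. Dividing by the
  factor at t cancels the exponential in the bound.\<close>

lemma gaussian_ode_stability:
  fixes \<phi> \<phi>' :: "real \<Rightarrow> complex"
  assumes deriv: "\<And>t. (\<phi> has_vector_derivative \<phi>' t) (at t)"
    and init: "\<phi> 0 = 1"
    and bound: "\<And>t. cmod (\<phi>' t + of_real t * \<phi> t) \<le> \<epsilon> * (1 + \<bar>t\<bar> + t\<^sup>2)"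
  shows "cmod (\<phi> t - of_real (exp (- (t\<^sup>2) / 2))) \<le> \<epsilon> * (1 + \<bar>t\<bar> + t\<^sup>2) * \<bar>t\<bar>"
proof -
  have eps: "\<epsilon> \<ge> 0"
    using order_trans[OF norm_ge_zero bound[of 0]] by simp
  define g where "g s = \<phi> s * of_real (exp (s\<^sup>2 / 2))" for s
  define g' where "g' s = (\<phi>' s + of_real s * \<phi> s) * of_real (exp (s\<^sup>2 / 2))" for s
  define B where "B = \<epsilon> * (1 + \<bar>t\<bar> + t\<^sup>2) * exp (t\<^sup>2 / 2)"
  have g: "(g has_vector_derivative g' s) (at s)" for s
  proof -
    have "((\<lambda>s. exp (s\<^sup>2 / 2)) has_real_derivative s * exp (s\<^sup>2 / 2)) (at s)"
      by (auto intro!: derivative_eq_intros)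
    then have "((\<lambda>s. complex_of_real (exp (s\<^sup>2 / 2))) has_vector_derivative of_real (s * exp (s\<^sup>2 / 2))) (at s)"
      by (intro has_vector_derivative_of_real) (simp add: has_real_derivative_iff_has_vector_derivative)
    from has_vector_derivative_mult[OF deriv[of s] this]
    show ?thesis
      by (simp add: g_def[abs_def] g'_def algebra_simps)
  qed
  have "norm (g t - g 0) \<le> B * norm (t - 0)"
  proof (rule differentiable_bound[of "closed_segment 0 t" g "\<lambda>s h. h *\<^sub>R g' s"])
    fix s assume s: "s \<in> closed_segment 0 t"
    then have st: "\<bar>s\<bar> \<le> \<bar>t\<bar>"
      by (auto simp: closed_segment_eq_real_ivl split: if_splits)
    then have st2: "s\<^sup>2 \<le> t\<^sup>2"
      by (simp add: abs_le_square_iff)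
    show "(g has_derivative (\<lambda>h. h *\<^sub>R g' s)) (at s within closed_segment 0 t)"
      using g[of s] unfolding has_vector_derivative_def by (rule has_derivative_at_withinI)
    have "norm (g' s) \<le> \<epsilon> * (1 + \<bar>s\<bar> + s\<^sup>2) * exp (s\<^sup>2 / 2)"
      using mult_right_mono[OF bound[of s], of "exp (s\<^sup>2 / 2)"] by (simp add: g'_def norm_mult)
    also have "\<dots> \<le> B"
      unfolding B_def using st st2 eps by (intro mult_mono add_mono) auto
    finally have g's: "norm (g' s) \<le> B" .
    show "onorm (\<lambda>h. h *\<^sub>R g' s) \<le> B"
    proof (intro onorm_le)
      fix h :: real
      show "norm (h *\<^sub>R g' s) \<le> B * norm h"
        using mult_right_mono[OF g's, of "norm h"] by (simp add: mult.commute)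
    qed
  qed auto
  then have *: "cmod (g t - 1) \<le> B * \<bar>t\<bar>"
    by (simp add: g_def init)
  have "cmod (\<phi> t - of_real (exp (- (t\<^sup>2) / 2))) = cmod ((g t - 1) * of_real (exp (- (t\<^sup>2) / 2)))"
    by (simp add: g_def algebra_simps flip: of_real_mult exp_add)
  also have "\<dots> = cmod (g t - 1) * exp (- (t\<^sup>2) / 2)"
    by (simp add: norm_mult)
  also have "\<dots> \<le> B * \<bar>t\<bar> * exp (- (t\<^sup>2) / 2)"
    using * by (rule mult_right_mono) simp
  also have "\<dots> = \<epsilon> * (1 + \<bar>t\<bar> + t\<^sup>2) * \<bar>t\<bar> * (exp (t\<^sup>2 / 2) * exp (- (t\<^sup>2) / 2))"
    by (simp add: B_def)
  also have "exp (t\<^sup>2 / 2) * exp (- (t\<^sup>2) / 2) = 1"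
    by (simp flip: exp_add)
  finally show ?thesis by simp
qed

lemma cmod_iexp_minus_linear_le: "cmod (iexp y - 1 - \<i> * of_real y) \<le> y\<^sup>2 / 2"
  using iexp_approx1[of y 1] by (simp add: power2_eq_square algebra_simps)

section \<open>The approximate Stein equation for fixed n and d\<close>

locale stein_setting =
  fixes n d :: nat and \<mu> \<sigma> :: real
  assumes \<sigma>: "\<sigma> > 0" and nonempty: "regular_graphs n d \<noteq> {}"
begin

definition W :: "nat set set \<Rightarrow> real" where
  "W E = (real (triangle_count n E) - \<mu>) / \<sigma>"

definition cf :: "real \<Rightarrow> complex" where
  "cf t = (\<Sum>E\<in>regular_graphs n d. iexp (t * W E)) / of_nat (card (regular_graphs n d))"

definition cf' :: "real \<Rightarrow> complex" where
  "cf' t = (\<Sum>E\<in>regular_graphs n d. \<i> * of_real (W E) * iexp (t * W E)) / of_nat (card (regular_graphs n d))"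

lemma card_pos: "card (regular_graphs n d) > 0"
  using nonempty by (simp add: card_gt_0_iff)

lemma cf_0: "cf 0 = 1"
  using nonempty by (simp add: cf_def)

lemma cmod_cf_le: "cmod (cf t) \<le> 1"
proof -
  have "cmod (\<Sum>E\<in>regular_graphs n d. iexp (t * W E)) \<le> (\<Sum>E\<in>regular_graphs n d. 1)"
    by (rule sum_norm_le) simp
  then show ?thesis
    using card_pos by (simp add: cf_def norm_divide)
qed

lemma cf_deriv: "(cf has_vector_derivative cf' t) (at t)"
proof -
  have "((\<lambda>t. iexp (t * c)) has_vector_derivative \<i> * of_real c * iexp (t * c)) (at t)" for c
  proof -
    have "((\<lambda>z. exp (\<i> * (z * of_real c))) has_field_derivative \<i> * of_real c * iexp (t * c)) (at (of_real t))"
      by (auto intro!: derivative_eq_intros)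
    from has_vector_derivative_real_field[OF this] show ?thesis by simp
  qed
  then have "((\<lambda>t. \<Sum>E\<in>regular_graphs n d. iexp (t * W E)) has_vector_derivative
      (\<Sum>E\<in>regular_graphs n d. \<i> * of_real (W E) * iexp (t * W E))) (at t)"
    by (intro has_vector_derivative_sum) auto
  from has_vector_derivative_divide[OF this, of "of_nat (card (regular_graphs n d))"] show ?thesis
    by (simp add: cf_def[abs_def] cf'_def)
qed

text \<open>Each error has one source: replacing closed minus open embeddings by a linear function
  of slope \<open>K\<close>, replacing the summed gain by n d^4, and the remainder of the
  exponential, where a gain y with |y| <= 2 d has y^2 / 2 <= d |y|. The factor 6 passes from
  triangles to labelled triangles.\<close>

lemma stein_identity_bound:
  fixes K :: real
  shows "cmod (of_real (6 * K * \<sigma>) * cf' t + of_real (t * (real n * real d ^ 4) / \<sigma>) * cf t)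
    \<le> gmean n d (\<lambda>E. \<bar>real (card (closed_emb n 3 E)) - real (card (open_emb n 3 E)) - K * (cnt n 3 (cyc_pat 3) {} E - 6 * \<mu>)\<bar>)
      + \<bar>t\<bar> / \<sigma> * gmean n d (\<lambda>E. \<bar>(\<Sum>xs\<in>open_emb n 3 E. triangle_gain n E xs) - real n * real d ^ 4\<bar>)
      + t\<^sup>2 / \<sigma>\<^sup>2 * real d * gmean n d (\<lambda>E. \<Sum>xs\<in>open_emb n 3 E. \<bar>triangle_gain n E xs\<bar>)"
proof -
  let ?R = "regular_graphs n d"
  define A where "A E = real (card (open_emb n 3 E))" for E
  define B where "B E = real (card (closed_emb n 3 E))" for E
  define X where "X E = cnt n 3 (cyc_pat 3) {} E" for E
  define e where "e E = iexp (t * W E)" for E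
  define T where "T E = (\<Sum>xs\<in>open_emb n 3 E. e (close_path 3 xs E) - e E)" for E
  define G where "G E = (\<Sum>xs\<in>open_emb n 3 E. triangle_gain n E xs)" for E
  define G1 where "G1 E = (\<Sum>xs\<in>open_emb n 3 E. \<bar>triangle_gain n E xs\<bar>)" for E
  define m where "m = real n * real d ^ 4"
  \<comment> \<open>Compared with the expression sought, \<open>Q\<close> contains in addition (A -
    B) e + T, whose sum over all graphs vanishes by the switching identity.\<close>
  define Q where "Q E = of_real (K * (X E - 6 * \<mu>) - (B E - A E)) * e E + (T E - \<i> * of_real (t * m / \<sigma>) * e E)" for E
  have ident: "(\<Sum>E\<in>?R. of_real (A E) * e E + T E) = (\<Sum>E\<in>?R. of_real (B E) * e E)"
    using switching_identity[of 3 e n d] by (simp add: T_def A_def B_def sum_subtractf)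
  have W6: "6 * K * \<sigma> * W E = K * (X E - 6 * \<mu>)" for E
    using \<sigma> by (simp add: W_def X_def cnt_cycle_3 field_simps)
  have pull: "of_real a * ((\<Sum>E\<in>?R. F E) / c) = (\<Sum>E\<in>?R. of_real a * F E) / c" for a and F :: "nat set set \<Rightarrow> complex" and c
    by (simp add: sum_distrib_left)
  have "of_real (6 * K * \<sigma>) * cf' t + of_real (t * m / \<sigma>) * cf t =
      (\<Sum>E\<in>?R. of_real (6 * K * \<sigma>) * (\<i> * of_real (W E) * e E) + of_real (t * m / \<sigma>) * e E) / of_nat (card ?R)"
    unfolding cf_def cf'_def e_def pull by (simp only: sum.distrib add_divide_distrib)
  also have "(\<Sum>E\<in>?R. of_real (6 * K * \<sigma>) * (\<i> * of_real (W E) * e E) + of_real (t * m / \<sigma>) * e E) =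
      (\<Sum>E\<in>?R. \<i> * (of_real (K * (X E - 6 * \<mu>)) * e E - \<i> * of_real (t * m / \<sigma>) * e E))"
  proof (intro sum.cong refl)
    fix E
    have "of_real (6 * K * \<sigma>) * (\<i> * of_real (W E) * e E) = \<i> * (of_real (6 * K * \<sigma> * W E) * e E)"
      by simp
    then show "of_real (6 * K * \<sigma>) * (\<i> * of_real (W E) * e E) + of_real (t * m / \<sigma>) * e E =
      \<i> * (of_real (K * (X E - 6 * \<mu>)) * e E - \<i> * of_real (t * m / \<sigma>) * e E)"
      unfolding W6 by (simp add: algebra_simps)
  qed
  also have "\<dots> = \<i> * (\<Sum>E\<in>?R. Q E)"
  proof -
    have "(\<Sum>E\<in>?R. Q E) = (\<Sum>E\<in>?R. of_real (K * (X E - 6 * \<mu>)) * e E - \<i> * of_real (t * m / \<sigma>) * e E)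
        - (\<Sum>E\<in>?R. of_real (B E) * e E) + (\<Sum>E\<in>?R. of_real (A E) * e E + T E)"
      unfolding sum_subtractf[symmetric] sum.distrib[symmetric]
      by (intro sum.cong refl) (simp add: Q_def algebra_simps)
    then show ?thesis
      unfolding ident by (simp add: sum_distrib_left)
  qed
  finally have eq: "of_real (6 * K * \<sigma>) * cf' t + of_real (t * m / \<sigma>) * cf t = \<i> * (\<Sum>E\<in>?R. Q E) / of_nat (card ?R)" .
  have e1: "cmod (e E) = 1" for E
    unfolding e_def by (rule norm_exp_i_times)
  have Q: "cmod (Q E) \<le> \<bar>B E - A E - K * (X E - 6 * \<mu>)\<bar> + \<bar>t\<bar> / \<sigma> * \<bar>G E - m\<bar> + t\<^sup>2 / \<sigma>\<^sup>2 * real d * G1 E"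
    if E: "E \<in> ?R" for E
  proof -
    \<comment> \<open>A switching multiplies \<open>e E\<close> by the exponential of the normalised
      gain; \<open>r\<close> is what remains of that factor after its linear part.\<close>
    define r where "r xs = iexp (t * (triangle_gain n E xs / \<sigma>)) - 1 - \<i> * of_real (t * (triangle_gain n E xs / \<sigma>))" for xs
    have "e (close_path 3 xs E) - e E = e E * (r xs + \<i> * of_real (t * (triangle_gain n E xs / \<sigma>)))" for xs
    proof -
      have "W (close_path 3 xs E) = W E + triangle_gain n E xs / \<sigma>"
        by (simp add: W_def triangle_gain_def diff_divide_distrib)
      then have "e (close_path 3 xs E) = e E * iexp (t * (triangle_gain n E xs / \<sigma>))"
        by (simp add: e_def distrib_left exp_add)
      then show ?thesis by (simp add: r_def algebra_simps)
    qed
    then have "T E = (\<Sum>xs\<in>open_emb n 3 E. e E * (r xs + \<i> * of_real (t * (triangle_gain n E xs / \<sigma>))))"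
      unfolding T_def by (intro sum.cong refl)
    also have "\<dots> = e E * ((\<Sum>xs\<in>open_emb n 3 E. r xs) + \<i> * of_real (t * G E / \<sigma>))"
    proof -
      have "(\<Sum>xs\<in>open_emb n 3 E. \<i> * complex_of_real (t * (triangle_gain n E xs / \<sigma>))) = \<i> * of_real (t * G E / \<sigma>)"
        by (simp add: G_def sum_distrib_left sum_divide_distrib)
      then show ?thesis
        by (simp only: sum_distrib_left[symmetric] sum.distrib)
    qed
    finally have T: "T E - \<i> * of_real (t * m / \<sigma>) * e E =
        e E * ((\<Sum>xs\<in>open_emb n 3 E. r xs) + \<i> * of_real (t / \<sigma> * (G E - m)))"
      by (simp add: algebra_simps diff_divide_distrib)
    have "cmod (\<Sum>xs\<in>open_emb n 3 E. r xs) \<le> (\<Sum>xs\<in>open_emb n 3 E. t\<^sup>2 / \<sigma>\<^sup>2 * real d * \<bar>triangle_gain n E xs\<bar>)"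
    proof (rule sum_norm_le)
      fix xs assume xs: "xs \<in> open_emb n 3 E"
      define y where "y = triangle_gain n E xs"
      have "cmod (r xs) \<le> (t * (y / \<sigma>))\<^sup>2 / 2"
        unfolding r_def y_def by (rule cmod_iexp_minus_linear_le)
      also have "\<dots> = t\<^sup>2 / \<sigma>\<^sup>2 * (\<bar>y\<bar> * \<bar>y\<bar> / 2)"
        by (simp add: power_mult_distrib power_divide power2_eq_square flip: abs_mult)
      also have "\<dots> \<le> t\<^sup>2 / \<sigma>\<^sup>2 * (real d * \<bar>y\<bar>)"
        using triangle_gain_le[OF E xs] mult_right_mono[of "\<bar>y\<bar>" "2 * real d" "\<bar>y\<bar>"]
        by (intro mult_left_mono) (simp_all add: y_def)
      finally show "cmod (r xs) \<le> t\<^sup>2 / \<sigma>\<^sup>2 * real d * \<bar>triangle_gain n E xs\<bar>"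
        by (simp add: y_def)
    qed
    then have r: "cmod (\<Sum>xs\<in>open_emb n 3 E. r xs) \<le> t\<^sup>2 / \<sigma>\<^sup>2 * real d * G1 E"
      by (simp add: G1_def sum_distrib_left)
    have "cmod (\<i> * complex_of_real (t / \<sigma> * (G E - m))) = \<bar>t\<bar> / \<sigma> * \<bar>G E - m\<bar>"
      using \<sigma> by (simp only: norm_mult norm_ii norm_of_real abs_mult abs_divide)
    then have "cmod (T E - \<i> * of_real (t * m / \<sigma>) * e E) \<le> t\<^sup>2 / \<sigma>\<^sup>2 * real d * G1 E + \<bar>t\<bar> / \<sigma> * \<bar>G E - m\<bar>"
      unfolding T norm_mult[of "e E"] e1 mult_1_left
      using norm_triangle_ineq[of "\<Sum>xs\<in>open_emb n 3 E. r xs" "\<i> * complex_of_real (t / \<sigma> * (G E - m))"] r by linarith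
    moreover have "cmod (of_real (K * (X E - 6 * \<mu>) - (B E - A E)) * e E) = \<bar>B E - A E - K * (X E - 6 * \<mu>)\<bar>"
      unfolding norm_mult e1 norm_of_real by simp
    ultimately show ?thesis
      unfolding Q_def
      using norm_triangle_ineq[of "of_real (K * (X E - 6 * \<mu>) - (B E - A E)) * e E" "T E - \<i> * of_real (t * m / \<sigma>) * e E"]
      by linarith
  qed
  have "cmod (\<i> * (\<Sum>E\<in>?R. Q E) / of_nat (card ?R)) = cmod (\<Sum>E\<in>?R. Q E) / card ?R"
    by (simp add: norm_divide norm_mult)
  also have "\<dots> \<le> (\<Sum>E\<in>?R. \<bar>B E - A E - K * (X E - 6 * \<mu>)\<bar> + \<bar>t\<bar> / \<sigma> * \<bar>G E - m\<bar> + t\<^sup>2 / \<sigma>\<^sup>2 * real d * G1 E) / card ?R"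
    by (intro divide_right_mono sum_norm_le Q) auto
  also have "\<dots> = gmean n d (\<lambda>E. \<bar>B E - A E - K * (X E - 6 * \<mu>)\<bar>) + \<bar>t\<bar> / \<sigma> * gmean n d (\<lambda>E. \<bar>G E - m\<bar>)
      + t\<^sup>2 / \<sigma>\<^sup>2 * real d * gmean n d G1"
    by (simp only: gmean_def[symmetric] gmean_add gmean_cmult)
  finally show ?thesis
    unfolding eq[symmetric] by (simp add: A_def B_def X_def G_def G1_def[abs_def] m_def)
qed

text \<open>After division by 6 K \<sigma> the Stein bound has t \<rho> in place of t. The defect 1
  - \<rho> is charged to the error, using that the characteristic function is at most 1 in
  modulus.\<close>

lemma cf_approx:
  fixes K \<epsilon> :: real
  assumes K: "K > 0"
    and eps: "gmean n d (\<lambda>E. \<bar>real (card (closed_emb n 3 E)) - real (card (open_emb n 3 E)) - K * (cnt n 3 (cyc_pat 3) {} E - 6 * \<mu>)\<bar>) / (6 * K * \<sigma>)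
      + gmean n d (\<lambda>E. \<bar>(\<Sum>xs\<in>open_emb n 3 E. triangle_gain n E xs) - real n * real d ^ 4\<bar>) / (6 * K * \<sigma>\<^sup>2)
      + real d * gmean n d (\<lambda>E. \<Sum>xs\<in>open_emb n 3 E. \<bar>triangle_gain n E xs\<bar>) / (6 * K * \<sigma>\<^sup>2 * \<sigma>)
      + \<bar>1 - real n * real d ^ 4 / (6 * K * \<sigma>\<^sup>2)\<bar> \<le> \<epsilon>"
  shows "cmod (cf t - of_real (exp (- (t\<^sup>2) / 2))) \<le> \<epsilon> * (1 + \<bar>t\<bar> + t\<^sup>2) * \<bar>t\<bar>"
proof (rule gaussian_ode_stability[OF cf_deriv cf_0])
  fix t
  define a b c where "a = gmean n d (\<lambda>E. \<bar>real (card (closed_emb n 3 E)) - real (card (open_emb n 3 E)) - K * (cnt n 3 (cyc_pat 3) {} E - 6 * \<mu>)\<bar>)"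
    "b = gmean n d (\<lambda>E. \<bar>(\<Sum>xs\<in>open_emb n 3 E. triangle_gain n E xs) - real n * real d ^ 4\<bar>)"
    "c = gmean n d (\<lambda>E. \<Sum>xs\<in>open_emb n 3 E. \<bar>triangle_gain n E xs\<bar>)"
  note abc = a_b_c_def
  have abc0: "a \<ge> 0" "b \<ge> 0" "c \<ge> 0"
    unfolding abc by (auto intro!: gmean_nonneg sum_nonneg)
  define \<rho> where "\<rho> = real n * real d ^ 4 / (6 * K * \<sigma>\<^sup>2)"
  define L where "L = 6 * K * \<sigma>"
  have L: "L > 0" using K \<sigma> by (simp add: L_def)
  have \<rho>L: "t * (real n * real d ^ 4) / \<sigma> = L * (t * \<rho>)"
    using K \<sigma> by (simp add: \<rho>_def L_def power2_eq_square field_simps)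
  have "cmod (of_real L * (cf' t + of_real (t * \<rho>) * cf t)) \<le> a + \<bar>t\<bar> / \<sigma> * b + t\<^sup>2 / \<sigma>\<^sup>2 * real d * c"
    using stein_identity_bound[of K t] unfolding abc[symmetric] L_def[symmetric] \<rho>L
    by (simp add: distrib_left mult.assoc)
  then have "L * cmod (cf' t + of_real (t * \<rho>) * cf t) \<le> a + \<bar>t\<bar> / \<sigma> * b + t\<^sup>2 / \<sigma>\<^sup>2 * real d * c"
    using L by (simp add: norm_mult)
  then have "cmod (cf' t + of_real (t * \<rho>) * cf t) \<le> (a + \<bar>t\<bar> / \<sigma> * b + t\<^sup>2 / \<sigma>\<^sup>2 * real d * c) / L"
    using L by (simp add: field_simps)
  also have "\<dots> = a / (6 * K * \<sigma>) + \<bar>t\<bar> * (b / (6 * K * \<sigma>\<^sup>2)) + t\<^sup>2 * (real d * c / (6 * K * \<sigma>\<^sup>2 * \<sigma>))"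
    using K \<sigma> by (simp add: L_def power2_eq_square field_simps)
  finally have 1: "cmod (cf' t + of_real (t * \<rho>) * cf t) \<le> a / (6 * K * \<sigma>) + \<bar>t\<bar> * (b / (6 * K * \<sigma>\<^sup>2)) + t\<^sup>2 * (real d * c / (6 * K * \<sigma>\<^sup>2 * \<sigma>))" .
  have "cmod (of_real (t * (1 - \<rho>)) * cf t) \<le> \<bar>t\<bar> * \<bar>1 - \<rho>\<bar>"
    unfolding norm_mult norm_of_real abs_mult using cmod_cf_le[of t] by (simp add: mult_left_le)
  then have "cmod (cf' t + of_real t * cf t) \<le> a / (6 * K * \<sigma>) + \<bar>t\<bar> * (b / (6 * K * \<sigma>\<^sup>2))
      + t\<^sup>2 * (real d * c / (6 * K * \<sigma>\<^sup>2 * \<sigma>)) + \<bar>t\<bar> * \<bar>1 - \<rho>\<bar>"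
    using 1 norm_triangle_ineq[of "cf' t + of_real (t * \<rho>) * cf t" "of_real (t * (1 - \<rho>)) * cf t"]
    by (simp add: algebra_simps)
  also have "\<dots> \<le> (a / (6 * K * \<sigma>) + b / (6 * K * \<sigma>\<^sup>2) + real d * c / (6 * K * \<sigma>\<^sup>2 * \<sigma>) + \<bar>1 - \<rho>\<bar>) * (1 + \<bar>t\<bar> + t\<^sup>2)"
  proof -
    have mono: "u + \<bar>t\<bar> * v + t\<^sup>2 * w + \<bar>t\<bar> * x \<le> (u + v + w + x) * (1 + \<bar>t\<bar> + t\<^sup>2)"
      if "u \<ge> 0" "v \<ge> 0" "w \<ge> 0" "x \<ge> 0" for u v w x
    proof -
      have "0 \<le> u * (\<bar>t\<bar> + t\<^sup>2) + v * (1 + t\<^sup>2) + w * (1 + \<bar>t\<bar>) + x * (1 + t\<^sup>2)"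
        using that by (intro add_nonneg_nonneg mult_nonneg_nonneg) auto
      then show ?thesis by (simp add: algebra_simps)
    qed
    show ?thesis
      using abc0 K \<sigma> by (intro mono) auto
  qed
  also have "\<dots> \<le> \<epsilon> * (1 + \<bar>t\<bar> + t\<^sup>2)"
    using eps unfolding abc[symmetric] \<rho>_def[symmetric] by (intro mult_right_mono) auto
  finally show "cmod (cf' t + of_real t * cf t) \<le> \<epsilon> * (1 + \<bar>t\<bar> + t\<^sup>2)" .
qed

lemma char_eq_cf:
  "char (distr (measure_pmf (random_regular_graph n d)) borel
     (\<lambda>E. (real (triangle_count n E) - \<mu>) / \<sigma>)) t = cf t"
  unfolding char_def cf_def W_def random_regular_graph_def
  using nonempty
  by (subst integral_distr, simp, simp, subst integral_measure_pmf[of "regular_graphs n d"])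
     (simp_all add: pmf_of_set scaleR_conv_of_real sum_divide_distrib)

end

section \<open>Asymptotics of the Stein error\<close>

context sparse_degrees
begin

text \<open>A mean of labelled triangles, so the triangle mean is \<open>M n / 6\<close>.\<close>

definition M :: "nat \<Rightarrow> real" where "M n = avg n (cyc 3 n)"
definition K :: "nat \<Rightarrow> real" where "K n = real n * D n - D n ^ 2"

lemma eventually_nonempty: "eventually (\<lambda>n. R n \<noteq> {}) sequentially"
  using eventually_sizes
proof eventually_elim
  case (elim n)
  then show ?case
    using even_arcs by (intro regular_graphs_nonempty) auto
qed

lemma M_deviation: "(\<lambda>n. M n - D n ^ 3) \<in> O(\<lambda>n. D n ^ 2)"
proof -
  have "(\<lambda>n. M n - D n ^ 3) \<in> O(\<lambda>n. avg n (\<lambda>E. cyc 3 n E - D n ^ 3))"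
    by (rule bigoI[where c = 1], use eventually_nonempty in eventually_elim)
       (simp add: M_def gmean_diff, simp add: gmean_def)
  also have "(\<lambda>n. avg n (\<lambda>E. cyc 3 n E - D n ^ 3)) \<in> O(\<lambda>n. D n ^ 2)"
    using small_avg[OF small_cyc_deviation[of 3]] by simp
  finally show ?thesis .
qed

lemma avg_card_emb_eq: "avg n (\<lambda>E. real (card (closed_emb n 3 E))) = avg n (\<lambda>E. real (card (open_emb n 3 E)))"
  using switching_identity[of 3 "\<lambda>_. 1 :: real" n "d n"] by (simp add: gmean_def)

text \<open>Closed minus open embeddings average exactly to 0, so K M differs from the explicit
  constant \<open>c\<close> only by the average of the error term, and \<open>c\<close> may be
  exchanged for K M within the same order.\<close>

lemma small_centred_drift:
  "small (\<lambda>n. D n ^ 4) (\<lambda>n E. real (card (closed_emb n 3 E)) - real (card (open_emb n 3 E)) - K n * (cyc 3 n E - M n))"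
proof -
  define c where "c n = real n * D n * (D n - 1) ^ 3 - D n ^ 5" for n
  define F where "F n E = real (card (closed_emb n 3 E)) - real (card (open_emb n 3 E)) - (K n * cyc 3 n E - c n)" for n E
  have F: "small (\<lambda>n. D n ^ 4) F"
    using small_triangle_drift by (simp add: F_def[abs_def] c_def K_def)
  have "(\<lambda>n. K n * M n - c n) \<in> O(\<lambda>n. avg n (F n))"
  proof (rule bigoI[where c = 1], use eventually_nonempty in eventually_elim)
    fix n assume ne: "R n \<noteq> {}"
    have "avg n (F n) = avg n (\<lambda>E. real (card (closed_emb n 3 E))) - avg n (\<lambda>E. real (card (open_emb n 3 E)))
        - (K n * M n - avg n (\<lambda>E. c n))"
      unfolding F_def M_def by (simp only: gmean_diff gmean_cmult)
    also have "avg n (\<lambda>E. c n) = c n"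
      using ne by (simp add: gmean_def)
    finally show "norm (K n * M n - c n) \<le> 1 * norm (avg n (F n))"
      by (simp add: avg_card_emb_eq)
  qed
  also have "(\<lambda>n. avg n (F n)) \<in> O(\<lambda>n. D n ^ 4)"
    by (rule small_avg[OF F])
  finally have "small (\<lambda>n. D n ^ 4) (\<lambda>n E. K n * M n - c n)"
    by (rule small_const)
  from small_add[OF F this] show ?thesis
    by (simp add: F_def algebra_simps)
qed

lemma tendsto_0_if_bigo:
  fixes f g :: "nat \<Rightarrow> real"
  assumes "f \<in> O(g)" "g \<longlonglongrightarrow> 0"
  shows "f \<longlonglongrightarrow> 0"
proof -
  obtain C where C: "eventually (\<lambda>n. norm (f n) \<le> C * norm (g n)) sequentially"
    using assms(1) by (rule landau_o.bigE)
  have "(\<lambda>n. C * norm (g n)) \<longlonglongrightarrow> C * norm (0 :: real)"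
    by (intro tendsto_intros assms(2))
  then show ?thesis
    using Lim_null_comparison[OF C] by simp
qed

definition rate :: "nat \<Rightarrow> real" where "rate n = 1 / sqrt (D n)"

lemma eventually_pos: "eventually (\<lambda>n. D n > 0 \<and> real n > 0) sequentially"
  using eventually_sizes by eventually_elim auto

lemma rate_tendsto: "rate \<longlonglongrightarrow> 0"
proof -
  have "filterlim (\<lambda>n. sqrt (D n)) at_top sequentially"
    by (rule filterlim_compose[OF sqrt_at_top D_at_top])
  then have "(\<lambda>n. inverse (sqrt (D n))) \<longlonglongrightarrow> 0"
    by (rule tendsto_inverse_0_at_top)
  then show ?thesis by (simp add: rate_def[abs_def] inverse_eq_divide)
qed

lemma inverse_D_tendsto: "(\<lambda>n. 1 / D n) \<longlonglongrightarrow> 0"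
  using tendsto_inverse_0_at_top[OF D_at_top] by (simp add: inverse_eq_divide)

text \<open>The ratio is 1 - d / n, and d / n = (d^2 / n) / d = O(1 / d).\<close>

lemma K_ratio: "(\<lambda>n. K n / (real n * D n)) \<longlonglongrightarrow> 1"
proof -
  have "(\<lambda>n. D n / real n) \<in> O(\<lambda>n. 1 / D n)"
  proof -
    have "(\<lambda>n. D n / real n) \<in> O(\<lambda>n. D n ^ 2 / real n * (1 / D n))"
      by (rule bigoI[where c = 1], use eventually_pos in eventually_elim) (simp add: power2_eq_square)
    also have "(\<lambda>n. D n ^ 2 / real n * (1 / D n)) \<in> O(\<lambda>n. 1 * (1 / D n))"
      using D_power_div_n_bigo[of 0] by (intro landau_o.big.mult) (simp_all add: numeral_2_eq_2)
    finally show ?thesis by simp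
  qed
  then have "(\<lambda>n. D n / real n) \<longlonglongrightarrow> 0"
    by (rule tendsto_0_if_bigo[OF _ inverse_D_tendsto])
  then have "(\<lambda>n. 1 - D n / real n) \<longlonglongrightarrow> 1 - 0"
    by (intro tendsto_intros)
  then have "(\<lambda>n. 1 - D n / real n) \<longlonglongrightarrow> 1"
    by simp
  then show ?thesis
  proof (rule Lim_transform_eventually)
    show "eventually (\<lambda>n. 1 - D n / real n = K n / (real n * D n)) sequentially"
      using eventually_pos by eventually_elim (simp add: K_def field_simps power2_eq_square)
  qed
qed

lemma M_ratio: "(\<lambda>n. M n / D n ^ 3) \<longlonglongrightarrow> 1"
proof -
  have "(\<lambda>n. (M n - D n ^ 3) / D n ^ 3) \<in> O(\<lambda>n. D n ^ 2 / D n ^ 3)"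
    by (intro landau_o.big.divide_right M_deviation)
       (use eventually_pos in \<open>eventually_elim, simp\<close>)
  also have "(\<lambda>n. D n ^ 2 / D n ^ 3) \<in> O(\<lambda>n. 1 / D n)"
    by (rule bigoI[where c = 1], use eventually_pos in eventually_elim)
       (simp add: power2_eq_square power3_eq_cube)
  finally have "(\<lambda>n. (M n - D n ^ 3) / D n ^ 3) \<longlonglongrightarrow> 0"
    by (rule tendsto_0_if_bigo[OF _ inverse_D_tendsto])
  then have "(\<lambda>n. 1 + (M n - D n ^ 3) / D n ^ 3) \<longlonglongrightarrow> 1 + 0"
    by (intro tendsto_intros)
  then have "(\<lambda>n. 1 + (M n - D n ^ 3) / D n ^ 3) \<longlonglongrightarrow> 1"
    by simp
  then show ?thesis
  proof (rule Lim_transform_eventually)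
    show "eventually (\<lambda>n. 1 + (M n - D n ^ 3) / D n ^ 3 = M n / D n ^ 3) sequentially"
      using eventually_pos by eventually_elim (simp add: field_simps)
  qed
qed

lemma eventually_K: "eventually (\<lambda>n. K n \<ge> real n * D n / 2) sequentially"
proof -
  have "eventually (\<lambda>n. K n / (real n * D n) > 1 / 2) sequentially"
    by (rule order_tendstoD(1)[OF K_ratio]) simp
  then show ?thesis
    using eventually_pos by eventually_elim (simp add: field_simps)
qed

lemma eventually_M: "eventually (\<lambda>n. M n \<ge> D n ^ 3 / 2) sequentially"
proof -
  have "eventually (\<lambda>n. M n / D n ^ 3 > 1 / 2) sequentially"
    by (rule order_tendstoD(1)[OF M_ratio]) simp
  then show ?thesis
    using eventually_pos by eventually_elim (simp add: field_simps)
qed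

lemma inverse_K_bigo: "(\<lambda>n. 1 / K n) \<in> O(\<lambda>n. 1 / (real n * D n))"
proof (rule bigoI[where c = 2], use eventually_K eventually_pos in eventually_elim)
  fix n assume "real n * D n / 2 \<le> K n" "D n > 0 \<and> real n > 0"
  moreover from this have "real n * D n > 0" by simp
  moreover from calculation have "K n > 0" by linarith
  ultimately show "norm (1 / K n) \<le> 2 * norm (1 / (real n * D n))"
    by (simp add: field_simps)
qed

lemma inverse_M_bigo: "(\<lambda>n. 1 / M n) \<in> O(\<lambda>n. 1 / D n ^ 3)"
proof (rule bigoI[where c = 2], use eventually_M eventually_pos in eventually_elim)
  fix n assume "D n ^ 3 / 2 \<le> M n" "D n > 0 \<and> real n > 0"
  moreover from this have "D n ^ 3 > 0" by simp
  moreover from calculation have "M n > 0" by linarith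
  ultimately show "norm (1 / M n) \<le> 2 * norm (1 / D n ^ 3)"
    by (simp add: field_simps)
qed

text \<open>From M >= d^3 / 2 follows M / 6 >= d^3 / 12 >= d^3 / 16, the last with a convenient
  square root: the standard deviation is at least d^(3/2) / 4.\<close>

lemma inverse_sd_bigo: "(\<lambda>n. 1 / sqrt (M n / 6)) \<in> O(\<lambda>n. 1 / D n * rate n)"
proof (rule bigoI[where c = 4], use eventually_M eventually_pos in eventually_elim)
  fix n assume "D n ^ 3 / 2 \<le> M n" "D n > 0 \<and> real n > 0"
  then have D: "D n > 0" and M3: "D n ^ 3 / 2 \<le> M n" by auto
  have M: "D n ^ 3 / 16 \<le> M n / 6"
    using M3 zero_less_power[OF D, of 3] by linarith
  have "D n * sqrt (D n) / 4 = sqrt (D n ^ 3 / 16)"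
    using D by (simp add: real_sqrt_divide real_sqrt_mult power3_eq_cube)
  also have "\<dots> \<le> sqrt (M n / 6)"
    using M by (rule real_sqrt_le_mono)
  finally have le: "D n * sqrt (D n) / 4 \<le> sqrt (M n / 6)" .
  have pos: "D n * sqrt (D n) / 4 > 0" using D by simp
  have "norm (1 / sqrt (M n / 6)) = 1 / sqrt (M n / 6)"
    using pos le by simp
  also have "\<dots> \<le> 1 / (D n * sqrt (D n) / 4)"
    using mult_pos_pos[OF less_le_trans[OF pos le] pos] le by (intro divide_left_mono) auto
  finally show "norm (1 / sqrt (M n / 6)) \<le> 4 * norm (1 / D n * rate n)"
    using D by (simp add: rate_def)
qed

definition drift_error :: "nat \<Rightarrow> real" where
  "drift_error n = avg n (\<lambda>E. \<bar>real (card (closed_emb n 3 E)) - real (card (open_emb n 3 E)) - K n * (cyc 3 n E - M n)\<bar>)"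

definition gain_error :: "nat \<Rightarrow> real" where
  "gain_error n = avg n (\<lambda>E. \<bar>(\<Sum>xs\<in>open_emb n 3 E. gain n E xs) - real n * D n ^ 4\<bar>)"

definition gain_total :: "nat \<Rightarrow> real" where
  "gain_total n = avg n (\<lambda>E. \<Sum>xs\<in>open_emb n 3 E. \<bar>gain n E xs\<bar>)"

definition sd :: "nat \<Rightarrow> real" where "sd n = sqrt (M n / 6)"

definition stein_error :: "nat \<Rightarrow> real" where
  "stein_error n = drift_error n / (6 * K n * sd n) + gain_error n / (6 * K n * (sd n)\<^sup>2)
    + D n * gain_total n / (6 * K n * (sd n)\<^sup>2 * sd n) + \<bar>1 - real n * D n ^ 4 / (6 * K n * (sd n)\<^sup>2)\<bar>"

text \<open>With K of order n d and M of order d^3, the drift error is d^4 / (n d d^(3/2)) = (d^2 /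
  n) d^(-1/2), the gain error n d^3 / (n d d^3) = 1 / d, and the quadratic remainder d n d^4 / (n d
  d^3 d^(3/2)) = d^(-1/2), all up to constants. The last term vanishes because 6 K sd^2 = K M is
  asymptotic to n d^4.\<close>

lemma stein_error_tendsto: "stein_error \<longlonglongrightarrow> 0"
proof -
  have s: "(\<lambda>n. 1 / sd n) \<in> O(\<lambda>n. 1 / D n * rate n)"
    using inverse_sd_bigo by (simp add: sd_def)
  have "drift_error \<in> O(\<lambda>n. D n ^ 4)"
    using small_centred_drift by (simp add: small_def drift_error_def[abs_def])
  then have "(\<lambda>n. drift_error n * (1 / K n) * (1 / sd n)) \<in> O(\<lambda>n. D n ^ 4 * (1 / (real n * D n)) * (1 / D n * rate n))"
    by (intro landau_o.big.mult inverse_K_bigo s)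
  also have "(\<lambda>n. D n ^ 4 * (1 / (real n * D n)) * (1 / D n * rate n)) \<in> O(\<lambda>n. D n ^ 2 / real n * rate n)"
    by (rule bigoI[where c = 1], use eventually_pos in eventually_elim)
       (simp add: field_simps power2_eq_square power4_eq_xxxx)
  also have "(\<lambda>n. D n ^ 2 / real n * rate n) \<in> O(\<lambda>n. 1 * rate n)"
    using D_power_div_n_bigo[of 0] by (intro landau_o.big.mult) (simp_all add: numeral_2_eq_2)
  finally have 1: "(\<lambda>n. drift_error n * (1 / K n) * (1 / sd n)) \<longlonglongrightarrow> 0"
    by (intro tendsto_0_if_bigo[OF _ rate_tendsto]) simp
  have "gain_error \<in> O(\<lambda>n. real n * D n ^ 3)"
    using small_gain_sum by (simp add: small_def gain_error_def[abs_def])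
  then have "(\<lambda>n. gain_error n * (1 / K n) * (1 / M n)) \<in> O(\<lambda>n. real n * D n ^ 3 * (1 / (real n * D n)) * (1 / D n ^ 3))"
    by (intro landau_o.big.mult inverse_K_bigo inverse_M_bigo)
  also have "(\<lambda>n. real n * D n ^ 3 * (1 / (real n * D n)) * (1 / D n ^ 3)) \<in> O(\<lambda>n. 1 / D n)"
    by (rule bigoI[where c = 1], use eventually_pos in eventually_elim) simp
  finally have 2: "(\<lambda>n. gain_error n * (1 / K n) * (1 / M n)) \<longlonglongrightarrow> 0"
    by (rule tendsto_0_if_bigo[OF _ inverse_D_tendsto])
  have "gain_total \<in> O(\<lambda>n. real n * D n ^ 4)"
    using small_gain_abs_sum by (simp add: small_def gain_total_def[abs_def] sum_nonneg)
  then have "(\<lambda>n. D n * gain_total n * (1 / K n) * (1 / M n) * (1 / sd n)) \<in>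
      O(\<lambda>n. D n * (real n * D n ^ 4) * (1 / (real n * D n)) * (1 / D n ^ 3) * (1 / D n * rate n))"
    by (intro landau_o.big.mult inverse_K_bigo inverse_M_bigo s) auto
  also have "(\<lambda>n. D n * (real n * D n ^ 4) * (1 / (real n * D n)) * (1 / D n ^ 3) * (1 / D n * rate n)) \<in> O(rate)"
    by (rule bigoI[where c = 1], use eventually_pos in eventually_elim)
       (simp add: field_simps power3_eq_cube power4_eq_xxxx)
  finally have 3: "(\<lambda>n. D n * gain_total n * (1 / K n) * (1 / M n) * (1 / sd n)) \<longlonglongrightarrow> 0"
    by (rule tendsto_0_if_bigo[OF _ rate_tendsto])
  have "(\<lambda>n. \<bar>1 - 1 / (K n / (real n * D n) * (M n / D n ^ 3))\<bar>) \<longlonglongrightarrow> \<bar>1 - 1 / (1 * 1)\<bar>"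
    by (intro tendsto_intros K_ratio M_ratio) simp
  then have 4: "(\<lambda>n. \<bar>1 - 1 / (K n / (real n * D n) * (M n / D n ^ 3))\<bar>) \<longlonglongrightarrow> 0"
    by simp
  have "(\<lambda>n. 1 / 6 * (drift_error n * (1 / K n) * (1 / sd n)) + gain_error n * (1 / K n) * (1 / M n)
      + D n * gain_total n * (1 / K n) * (1 / M n) * (1 / sd n)
      + \<bar>1 - 1 / (K n / (real n * D n) * (M n / D n ^ 3))\<bar>) \<longlonglongrightarrow> 1 / 6 * 0 + 0 + 0 + 0"
    by (intro tendsto_add tendsto_mult_left 1 2 3 4)
  then have "(\<lambda>n. 1 / 6 * (drift_error n * (1 / K n) * (1 / sd n)) + gain_error n * (1 / K n) * (1 / M n)
      + D n * gain_total n * (1 / K n) * (1 / M n) * (1 / sd n)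
      + \<bar>1 - 1 / (K n / (real n * D n) * (M n / D n ^ 3))\<bar>) \<longlonglongrightarrow> 0"
    by simp
  then show ?thesis
  proof (rule Lim_transform_eventually)
    show "eventually (\<lambda>n. 1 / 6 * (drift_error n * (1 / K n) * (1 / sd n)) + gain_error n * (1 / K n) * (1 / M n)
      + D n * gain_total n * (1 / K n) * (1 / M n) * (1 / sd n)
      + \<bar>1 - 1 / (K n / (real n * D n) * (M n / D n ^ 3))\<bar> = stein_error n) sequentially"
      using eventually_M eventually_pos
    proof eventually_elim
      case (elim n)
      have "D n ^ 3 > 0" using elim by simp
      then have "M n > 0" using elim(1) by linarith
      then have sd2: "6 * K n * (sd n)\<^sup>2 = K n * M n"
        by (simp add: sd_def)
      have ratio: "real n * D n ^ 4 / (K n * M n) = 1 / (K n / (real n * D n) * (M n / D n ^ 3))"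
        using elim by (simp add: power3_eq_cube power4_eq_xxxx)
      show ?case
        unfolding stein_error_def sd2 ratio by simp
    qed
  qed
qed

lemma triangle_mean_eq: "R n \<noteq> {} \<Longrightarrow> triangle_mean n (d n) = M n / 6"
  by (simp add: triangle_mean_def random_regular_graph_def integral_pmf_of_set M_def gmean_def
      cnt_cycle_3 sum_distrib_left[symmetric])

lemma char_tendsto:
  "(\<lambda>n. char (distr (measure_pmf (random_regular_graph n (d n))) borel
      (\<lambda>E. (real (triangle_count n E) - triangle_mean n (d n)) / sqrt (triangle_mean n (d n)))) t)
    \<longlonglongrightarrow> char std_normal_distribution t"
proof -
  define c where "c n = char (distr (measure_pmf (random_regular_graph n (d n))) borel
      (\<lambda>E. (real (triangle_count n E) - triangle_mean n (d n)) / sqrt (triangle_mean n (d n)))) t" for n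
  have "(\<lambda>n. stein_error n * (1 + \<bar>t\<bar> + t\<^sup>2) * \<bar>t\<bar>) \<longlonglongrightarrow> 0 * (1 + \<bar>t\<bar> + t\<^sup>2) * \<bar>t\<bar>"
    by (intro tendsto_intros stein_error_tendsto)
  then have lim: "(\<lambda>n. stein_error n * (1 + \<bar>t\<bar> + t\<^sup>2) * \<bar>t\<bar>) \<longlonglongrightarrow> 0" by simp
  have "eventually (\<lambda>n. norm (c n - of_real (exp (- (t\<^sup>2) / 2))) \<le> stein_error n * (1 + \<bar>t\<bar> + t\<^sup>2) * \<bar>t\<bar>) sequentially"
    using eventually_M eventually_K eventually_pos eventually_nonempty
  proof eventually_elim
    case (elim n)
    have "D n ^ 3 > 0" "real n * D n > 0" using elim(3) by simp_all
    then have pos: "M n > 0" "K n > 0" using elim(1,2) by linarith+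
    interpret stein_setting n "d n" "M n / 6" "sd n"
      using pos elim(4) by unfold_locales (auto simp: sd_def)
    have "cmod (cf t - of_real (exp (- (t\<^sup>2) / 2))) \<le> stein_error n * (1 + \<bar>t\<bar> + t\<^sup>2) * \<bar>t\<bar>"
    proof (rule cf_approx[OF pos(2)])
      have six: "6 * (M n / 6) = M n" by simp
      show "avg n (\<lambda>E. \<bar>real (card (closed_emb n 3 E)) - real (card (open_emb n 3 E)) - K n * (cyc 3 n E - 6 * (M n / 6))\<bar>) / (6 * K n * sd n)
        + avg n (\<lambda>E. \<bar>(\<Sum>xs\<in>open_emb n 3 E. gain n E xs) - real n * D n ^ 4\<bar>) / (6 * K n * (sd n)\<^sup>2)
        + D n * avg n (\<lambda>E. \<Sum>xs\<in>open_emb n 3 E. \<bar>gain n E xs\<bar>) / (6 * K n * (sd n)\<^sup>2 * sd n)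
        + \<bar>1 - real n * D n ^ 4 / (6 * K n * (sd n)\<^sup>2)\<bar> \<le> stein_error n"
        unfolding six by (simp only: stein_error_def drift_error_def gain_error_def gain_total_def order_refl)
    qed
    then show ?case
      unfolding c_def triangle_mean_eq[OF elim(4)] char_eq_cf[of t, unfolded sd_def] by (simp only: sd_def)
  qed
  then have "(\<lambda>n. c n - of_real (exp (- (t\<^sup>2) / 2))) \<longlonglongrightarrow> 0"
    by (rule Lim_null_comparison[OF _ lim])
  then have "c \<longlonglongrightarrow> of_real (exp (- (t\<^sup>2) / 2))"
    by (simp add: LIM_zero_iff)
  then show ?thesis
    by (simp add: c_def[abs_def] char_std_normal_distribution)
qed

end

theorem theorem2p6:
  fixes d :: "nat \<Rightarrow> nat"
  assumes "\<forall>n. even (d n * n)"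
    and "(\<lambda>n. real (d n)) \<in> O(\<lambda>n. sqrt (real n))"
    and "filterlim d at_top sequentially"
  shows "weak_conv_m
           (\<lambda>n. distr (measure_pmf (random_regular_graph n (d n))) borel
                   (\<lambda>E. (real (triangle_count n E) - triangle_mean n (d n)) / sqrt (triangle_mean n (d n))))
           std_normal_distribution"
proof (rule levy_continuity)
  interpret sparse_degrees d
    using assms by unfold_locales
  show "real_distribution (distr (measure_pmf (random_regular_graph n (d n))) borel
      (\<lambda>E. (real (triangle_count n E) - triangle_mean n (d n)) / sqrt (triangle_mean n (d n))))" for n
    by (rule prob_space.real_distribution_distr[OF measure_pmf.prob_space_axioms]) simp
  show "real_distribution std_normal_distribution"
    by (rule real_dist_normal_dist)
  show "(\<lambda>n. char (distr (measure_pmf (random_regular_graph n (d n))) borel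
      (\<lambda>E. (real (triangle_count n E) - triangle_mean n (d n)) / sqrt (triangle_mean n (d n)))) t)
    \<longlonglongrightarrow> char std_normal_distribution t" for t
    by (rule char_tendsto)
qed

end
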